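(* Let $c>0$ be an absolute constant such that for all positive integers $n,m$, every $n\times n$ matrix $\mathbf{B}$ and every $\varepsilon>0$, if $\mathbf{v}_1,\ldots,\mathbf{v}_m$ are iid samples from $\operatorname{Unif}(\mathbb{S}^{n-1})$ then $$\mathbb{P}\Big[\big|n^{-1}\operatorname{tr}(\mathbf{B})-\tfrac1m\sum_{\ell=1}^m\mathbf{v}_\ell^*\mathbf{B}\mathbf{v}_\ell\big|>\varepsilon\Big]\le 2\exp\Big(-\frac{c\,n\,m\,\varepsilon^2}{\|\mathbf{B}\|_2^2}\Big).$$ Let $\mathbf{A}$ be an $n\times n$ Hermitian matrix with smallest and largest eigenvalues $\lambda_{\min}<\lambda_{\max}$ and cumulative empirical spectral measure $\Phi$. Fix $\varepsilon>0$ and $\delta\in(0,1)$. Let $s$ and $m$ be positive integers with $$s\ge\frac{36}{\varepsilon},\qquad m\ge\frac{7(\ln(s)+1)^2}{c\,n\,\varepsilon^2}\ln\Big(\frac{2s}{\delta}\Big),$$ let $\mathbf{v}_1,\ldots,\mathbf{v}_m$ be iid samples from $\operatorname{Unif}(\mathbb{S}^{n-1})$, and let $\Psi_\ell$ be the weighted cumulative empirical spectral measure of $\mathbf{A}$ and $\mathbf{v}_\ell$. Suppose that $\circ$ denotes either (g) Gaussian quadrature: $[\Psi_\ell]_s^{\circ\mathrm q}=[\Psi_\ell]_s^{\mathrm{gq}}$ is the degree $s$ Gaussian quadrature rule for $\Psi_\ell$ ($s$ odd); or (d) damped quadrature by approximation: $[\Psi_\ell]_s^{\circ\mathrm q}=[\Psi_\ell]_s^{\mathrm{dq}}$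 is the degree $s$ damped quadrature by approximation with respect to $\mu=\mu^T_{\lambda_{\min},\lambda_{\max}}$ with Jackson's damping coefficients. Then $$\mathbb{P}\Big[d_{\mathrm W}\Big(\Phi,\ \frac1m\sum_{\ell=1}^m[\Psi_\ell]_s^{\circ\mathrm q}\Big)>(\lambda_{\max}-\lambda_{\min})\,\varepsilon\Big]\le\delta.$$
   Context: $\operatorname{Unif}(\mathbb{S}^{n-1})$ is the uniform distribution on unit vectors in $\mathbb{R}^n$; $^*$ is conjugate transpose; $\|\cdot\|_2$ is the spectral norm. For a Hermitian matrix $\mathbf{A}=\sum_{i=1}^n\lambda_i\mathbf{u}_i\mathbf{u}_i^*$ (orthonormal eigenvectors $\mathbf{u}_i$), the cumulative empirical spectral measure (CESM) is $\Phi(x)=\frac1n\sum_{i=1}^n\mathbb{1}(\lambda_i\le x)$. For a unit vector $\mathbf{v}$, the weighted CESM is $\Psi(x)=\sum_{i=1}^n|\mathbf{v}^*\mathbf{u}_i|^2\,\mathbb{1}(\lambda_i\le x)$. Both are probability distribution functions, and $\int f\,d\Psi$ denotes the integral against the corresponding measure. The Wasserstein distance between distribution functions is $d_{\mathrm W}(\Upsilon_1,\Upsilon_2)=\int_{-\infty}^\infty|\Upsilon_1(x)-\Upsilon_2(x)|\,dx$. Gaussian quadrature: for odd $s=2k-1$, $[\Psi]_{s}^{\mathrm{gq}}$ is the distribution function $\sum_{j=1}^k\omega_j\mathbb{1}(\theta_j\le x)$, where $\theta_1,\ldots,\theta_k$ are the zeros of the degree $k$ orthogonal polynomial with respect to $\Psi$,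 and the weights $\omega_j$ are such that $\int p\,d[\Psi]_s^{\mathrm{gq}}=\int p\,d\Psi$ for all polynomials $p$ of degree at most $k-1$ (equivalently, at most $2k-1$). If $k$ is at least the number of support points of $\Psi$, then $[\Psi]_s^{\mathrm{gq}}=\Psi$. Chebyshev distribution: for $a<b$, $\mu_{a,b}^T(x)=\frac12+\frac1\pi\arcsin\big(\frac{2}{b-a}x-\frac{b+a}{b-a}\big)$ for $x\in[a,b]$. Its orthonormal polynomials are $p_0=1$ and $p_k(x)=\sqrt2\,T_k\big(\frac{2}{b-a}x-\frac{b+a}{b-a}\big)$ for $k\ge1$, where $T_0(x)=1$, $T_1(x)=x$, $T_{k+1}(x)=2xT_k(x)-T_{k-1}(x)$. Damped quadrature by approximation with respect to $\mu$: given damping coefficients $\rho_0,\ldots,\rho_s$, put $[f]_s^{\mathrm{dp}}=\sum_{k=0}^s\rho_k\big(\int f p_k\,d\mu\big)p_k$, where $p_k$ are the orthonormal polynomials of $\mu$. The distribution function $[\Psi]_s^{\mathrm{dq}}$ is defined by $\int f\,d[\Psi]_s^{\mathrm{dq}}=\int[f]_s^{\mathrm{dp}}\,d\Psi$, i.e. it has density $\sum_{k=0}^s\rho_k\big(\int p_k\,d\Psi\big)p_k$ with respect to $\mu$. Jackson's damping coefficients are $$\rho_k^J=\frac{1}{s+2}\Big((s-k+2)\cos\Big(\frac{k\pi}{s+2}\Big)+\sin\Big(\frac{k\pi}{s+2}\Big)\cot\Big(\frac{\pi}{s+2}\Big)\Big),\qquad k=0,\ldots,s.$$ *)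

theory Defs
  imports
    "HOL-Probability.Probability"
    "HOL-Computational_Algebra.Polynomial"
    "Jordan_Normal_Form.Schur_Decomposition"
    "Jordan_Normal_Form.Spectral_Radius"
begin

unbundle no vec_syntax
hide_const (open) Finite_Cartesian_Product.vec Finite_Cartesian_Product.mat

section \<open>Matrices\<close>

definition hermitian_mat :: "complex mat \<Rightarrow> bool" where
  "hermitian_mat A \<longleftrightarrow> square_mat A \<and> mat_adjoint A = A"

definition mat_trace :: "complex mat \<Rightarrow> complex" where
  "mat_trace B = (\<Sum>i<dim_row B. B $$ (i, i))"

definition l2_norm :: "complex vec \<Rightarrow> real" where
  "l2_norm w = sqrt (\<Sum>i<dim_vec w. (cmod (w $ i))\<^sup>2)"

definition spectral_norm :: "complex mat \<Rightarrow> real" where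
  "spectral_norm B = Sup {l2_norm (B *\<^sub>v w) | w. w \<in> carrier_vec (dim_col B) \<and> l2_norm w = 1}"

definition lambda_min :: "complex mat \<Rightarrow> real" where
  "lambda_min A = Min (Re ` spectrum A)"

definition lambda_max :: "complex mat \<Rightarrow> real" where
  "lambda_max A = Max (Re ` spectrum A)"

text \<open>Since \<open>\<bullet>c\<close> conjugates its right argument, \<open>x \<bullet>c w\<close> is the number \<open>w\<^sup>* x\<close>.\<close>

definition sesq_form :: "complex mat \<Rightarrow> complex vec \<Rightarrow> complex" where
  "sesq_form B w = (B *\<^sub>v w) \<bullet>c w"

text \<open>\<open>A = (\<Sum>i<n. lam i \<sqdot> u i (u i)\<^sup>*)\<close> with an orthonormal family \<open>u\<close>
  of \<open>n\<close> vectors in dimension \<open>n = dim_row A\<close>.\<close>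

definition is_spectral_decomp ::
    "complex mat \<Rightarrow> (nat \<Rightarrow> real) \<Rightarrow> (nat \<Rightarrow> complex vec) \<Rightarrow> bool" where
  "is_spectral_decomp A lam u \<longleftrightarrow> (let n = dim_row A in
     (\<forall>i<n. u i \<in> carrier_vec n) \<and>
     (\<forall>i<n. \<forall>j<n. u i \<bullet>c u j = (if i = j then 1 else 0)) \<and>
     A = mat n n (\<lambda>(r, c). \<Sum>i<n. complex_of_real (lam i) * u i $ r * cnj (u i $ c)))"

text \<open>A decomposition exists for every Hermitian matrix by the spectral theorem. Which one is
  chosen does not affect the distribution functions below: they depend only on the eigenvalues
  with multiplicity and on the squared norms of the projections to the eigenspaces.\<close>

definition spectral_decomp :: "complex mat \<Rightarrow> (nat \<Rightarrow> real) \<times> (nat \<Rightarrow> complex vec)" where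
  "spectral_decomp A = (SOME (lam, u). is_spectral_decomp A lam u)"

section \<open>Distribution functions\<close>

definition cesm :: "complex mat \<Rightarrow> real \<Rightarrow> real" where
  "cesm A x = (case spectral_decomp A of (lam, u) \<Rightarrow>
     (1 / real (dim_row A)) * (\<Sum>i<dim_row A. of_bool (lam i \<le> x)))"

definition wcesm :: "complex mat \<Rightarrow> complex vec \<Rightarrow> real \<Rightarrow> real" where
  "wcesm A w x = (case spectral_decomp A of (lam, u) \<Rightarrow>
     (\<Sum>i<dim_row A. (cmod (u i \<bullet>c w))\<^sup>2 * of_bool (lam i \<le> x)))"

definition dist_integral :: "(real \<Rightarrow> real) \<Rightarrow> (real \<Rightarrow> real) \<Rightarrow> real" where
  "dist_integral F f = (\<integral>x. f x \<partial>interval_measure F)"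

text \<open>Valued in \<^typ>\<open>ennreal\<close>, so that a divergent integral yields \<open>\<infinity>\<close>, not \<open>0\<close>.\<close>

definition wasserstein :: "(real \<Rightarrow> real) \<Rightarrow> (real \<Rightarrow> real) \<Rightarrow> ennreal" where
  "wasserstein F G = (\<integral>\<^sup>+x. ennreal \<bar>F x - G x\<bar> \<partial>lborel)"

text \<open>The topological support of the measure belonging to \<open>F\<close>; for a step function,
  the set of its jump points.\<close>

definition support_points :: "(real \<Rightarrow> real) \<Rightarrow> real set" where
  "support_points F = {x. \<forall>e>0. F (x - e) < F (x + e)}"

section \<open>Gaussian quadrature\<close>

definition is_orth_poly :: "(real \<Rightarrow> real) \<Rightarrow> nat \<Rightarrow> real poly \<Rightarrow> bool" where
  "is_orth_poly F k p \<longleftrightarrow> p \<noteq> 0 \<and> degree p = k \<and>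
     (\<forall>q. degree q < k \<longrightarrow> dist_integral F (\<lambda>x. poly p x * poly q x) = 0)"

definition is_gauss_rule ::
    "(real \<Rightarrow> real) \<Rightarrow> nat \<Rightarrow> (nat \<Rightarrow> real) \<Rightarrow> (nat \<Rightarrow> real) \<Rightarrow> bool" where
  "is_gauss_rule F k \<theta> \<omega> \<longleftrightarrow>
     (\<exists>p. is_orth_poly F k p \<and> inj_on \<theta> {1..k} \<and> \<theta> ` {1..k} = {x. poly p x = 0}) \<and>
     (\<forall>q. degree q \<le> k - 1 \<longrightarrow>
        (\<Sum>j=1..k. \<omega> j * poly q (\<theta> j)) = dist_integral F (poly q))"

text \<open>Only meant for odd \<open>s = 2 * k - 1\<close>.\<close>

definition gauss_quad :: "nat \<Rightarrow> (real \<Rightarrow> real) \<Rightarrow> real \<Rightarrow> real" where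
  "gauss_quad s F = (let k = (s + 1) div 2 in
     if finite (support_points F) \<and> card (support_points F) \<le> k then F
     else (case (SOME (\<theta>, \<omega>). is_gauss_rule F k \<theta> \<omega>) of (\<theta>, \<omega>) \<Rightarrow>
       (\<lambda>x. \<Sum>j=1..k. \<omega> j * of_bool (\<theta> j \<le> x))))"

section \<open>Damped quadrature by approximation\<close>

text \<open>The arguments \<open>\<mu>\<close> and \<open>p\<close> are a distribution function and its orthonormal polynomials.\<close>

definition damped_approx ::
    "nat \<Rightarrow> (nat \<Rightarrow> real) \<Rightarrow> (real \<Rightarrow> real) \<Rightarrow> (nat \<Rightarrow> real \<Rightarrow> real) \<Rightarrow> (real \<Rightarrow> real) \<Rightarrow> real \<Rightarrow> real" where
  "damped_approx s \<rho> \<mu> p f x =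
     (\<Sum>k=0..s. \<rho> k * dist_integral \<mu> (\<lambda>y. f y * p k y) * p k x)"

text \<open>The value at \<open>x\<close> is the integral of the damped approximation to the indicator of \<open>{..x}\<close>.\<close>

definition damped_quad ::
    "nat \<Rightarrow> (nat \<Rightarrow> real) \<Rightarrow> (real \<Rightarrow> real) \<Rightarrow> (nat \<Rightarrow> real \<Rightarrow> real) \<Rightarrow> (real \<Rightarrow> real) \<Rightarrow> real \<Rightarrow> real" where
  "damped_quad s \<rho> \<mu> p F x = dist_integral F (damped_approx s \<rho> \<mu> p (indicator {..x}))"

definition jackson_coeff :: "nat \<Rightarrow> nat \<Rightarrow> real" where
  "jackson_coeff s k = 1 / (real s + 2) *
     ((real s - real k + 2) * cos (real k * pi / (real s + 2))
      + sin (real k * pi / (real s + 2)) * cot (pi / (real s + 2)))"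

fun cheb_T :: "nat \<Rightarrow> real \<Rightarrow> real" where
  "cheb_T 0 x = 1"
| "cheb_T (Suc 0) x = x"
| "cheb_T (Suc (Suc k)) x = 2 * x * cheb_T (Suc k) x - cheb_T k x"

definition cheb_dist :: "real \<Rightarrow> real \<Rightarrow> real \<Rightarrow> real" where
  "cheb_dist a b x =
     (if x < a then 0
      else if x \<le> b then 1 / 2 + (1 / pi) * arcsin (2 / (b - a) * x - (b + a) / (b - a))
      else 1)"

definition cheb_orthonormal :: "real \<Rightarrow> real \<Rightarrow> nat \<Rightarrow> real \<Rightarrow> real" where
  "cheb_orthonormal a b k x =
     (if k = 0 then 1 else sqrt 2 * cheb_T k (2 / (b - a) * x - (b + a) / (b - a)))"

definition jackson_cheb_quad :: "nat \<Rightarrow> real \<Rightarrow> real \<Rightarrow> (real \<Rightarrow> real) \<Rightarrow> real \<Rightarrow> real" where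
  "jackson_cheb_quad s a b =
     damped_quad s (jackson_coeff s) (cheb_dist a b) (cheb_orthonormal a b)"

section \<open>The uniform distribution on the sphere\<close>

text \<open>Vectors of \<open>\<real>\<^sup>n\<close> are functions on \<open>{..<n}\<close>. The uniform distribution is the
  radial projection of the uniform distribution on the unit ball, that is, the mass of a set of
  unit vectors is proportional to the volume of the cone from the origin over it.\<close>

definition unit_ball :: "nat \<Rightarrow> (nat \<Rightarrow> real) set" where
  "unit_ball n = {x \<in> space (\<Pi>\<^sub>M i\<in>{..<n}. lborel). (\<Sum>i<n. (x i)\<^sup>2) \<le> 1}"

definition unif_sphere :: "nat \<Rightarrow> (nat \<Rightarrow> real) measure" where
  "unif_sphere n = distr (uniform_measure (\<Pi>\<^sub>M i\<in>{..<n}. lborel) (unit_ball n))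
     (\<Pi>\<^sub>M i\<in>{..<n}. borel)
     (\<lambda>x. \<lambda>i\<in>{..<n}. x i / sqrt (\<Sum>j<n. (x j)\<^sup>2))"

definition cvec :: "nat \<Rightarrow> (nat \<Rightarrow> real) \<Rightarrow> complex vec" where
  "cvec n x = vec n (\<lambda>i. complex_of_real (x i))"

text \<open>\<open>v 1, \<dots>, v m\<close> are independent samples from \<open>D\<close>, defined on the probability space \<open>M\<close>.\<close>

definition iid_samples :: "'a measure \<Rightarrow> 'b measure \<Rightarrow> nat \<Rightarrow> (nat \<Rightarrow> 'a \<Rightarrow> 'b) \<Rightarrow> bool" where
  "iid_samples M D m v \<longleftrightarrow> prob_space M \<and>
     prob_space.indep_vars M (\<lambda>_. D) v {1..m} \<and> (\<forall>l\<in>{1..m}. distr M D (v l) = D)"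

text \<open>The probability in the hypothesis on \<open>c\<close> depends only on the joint law of the samples,
  so it is taken for the coordinate projections of the product space.\<close>

definition trace_concentration :: "real \<Rightarrow> bool" where
  "trace_concentration c \<longleftrightarrow> (\<forall>n m B \<epsilon>. 0 < n \<longrightarrow> 0 < m \<longrightarrow> B \<in> carrier_mat n n \<longrightarrow> 0 < \<epsilon> \<longrightarrow>
     measure (\<Pi>\<^sub>M l\<in>{1..m}. unif_sphere n)
       {v \<in> space (\<Pi>\<^sub>M l\<in>{1..m}. unif_sphere n).
          cmod (mat_trace B / of_nat n - (1 / of_nat m) * (\<Sum>l=1..m. sesq_form B (cvec n (v l)))) > \<epsilon>}
     \<le> 2 * exp (- (c * real n * real m * \<epsilon>\<^sup>2 / (spectral_norm B)\<^sup>2)))"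

end

theory Submission
  imports Defs
begin

text \<open>
  Write \<open>a < b\<close> for the extreme eigenvalues and \<open>T\<^sub>k\<close> for the Chebyshev polynomials transported to
  \<open>[a, b]\<close>. All distribution functions in the theorem are carried by \<open>[a, b]\<close>, and the argument
  compares them through one linear smoothing operator: the damped approximation with Jackson's
  coefficients, applied to the indicator of \<open>{..x}\<close>. For a distribution function \<open>F\<close>
  its smoothing depends only on the moments \<open>\<integral>T\<^sub>k dF\<close> with \<open>k \<le> s\<close> (\<open>moment_smooth\<close>).

  Three facts carry the proof.

  \<^item> Smoothing moves a distribution on \<open>[a, b]\<close> by at most \<open>(b - a) / 2 \<sqdot> \<pi> / (s + 2)\<close> in Wasserstein
    distance (\<open>step_fun_smoothing_error\<close>). With \<open>x = (a + b) / 2 + (b - a) / 2 \<sqdot> cos t\<close> it is convolution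
    with Jackson's kernel, which is a nonnegative trigonometric polynomial because its coefficients
    are an autocorrelation (\<open>jackson_kernel_nonneg\<close>), and which has mean value \<open>1 - cos (\<pi> / (s + 2))\<close>
    against \<open>1 - cos t\<close>.
  \<^item> If all moments of degree \<open>1, \<dots>, s\<close> of two distributions differ by at most \<open>t\<close>, then their
    smoothings have distance at most \<open>2 (b - a) t (ln s + 1) / \<pi>\<close> (\<open>moment_smooth_distance\<close>): the
    coefficient of the \<open>k\<close>-th moment is a function of \<open>x\<close> with integral of order \<open>1 / k\<close>.
  \<^item> Both quadratures differ little from the smoothing of their argument (\<open>quadrature_error\<close>). The damped
    rule is the smoothing. A Gauss rule has nonnegative weights, nodes in \<open>[a, b]\<close> and the same
    moments up to degree \<open>s\<close> (\<open>gauss_quad_step_fun\<close>), so that it has the same smoothing and the first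
    fact applies to it.

  By the triangle inequality the distance in the theorem is at most
  \<open>(b - a) (\<pi> / (s + 2) + 2 t (ln s + 1) / \<pi>)\<close> as soon as the averaged moments of the samples are
  within \<open>t\<close> of those of the spectrum (\<open>averaged_quadrature_error\<close>). The \<open>k\<close>-th of these deviations is the
  error of the stochastic trace estimator for the matrix \<open>T\<^sub>k(A)\<close>, whose spectral norm is at most \<open>1\<close>.
  With \<open>t = \<epsilon> / (2 (ln s + 1))\<close> the trace concentration hypothesis and a union bound over \<open>k \<le> s\<close> give
  failure probability at most \<open>\<delta>\<close>, and outside of that event the distance is at most \<open>(b - a) \<epsilon>\<close>.
\<close>

section \<open>Jackson's coefficients and kernel\<close>

lemma cheb_T_cos: "cheb_T k (cos t) = cos (real k * t)"
proof (induction k rule: induct_nat_012)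
  case (ge2 k)
  have "cos (real (Suc (Suc k)) * t) = cos (real (Suc k) * t + t)"
    and "cos (real k * t) = cos (real (Suc k) * t - t)"
    by (simp_all add: algebra_simps)
  with ge2 show ?case
    by (simp add: cos_add cos_diff)
qed simp_all

text \<open>Multiplication by \<open>2 sin \<alpha>\<close> turns the product formula for two sines into a telescoping sum.\<close>

lemma sin_autocorrelation:
  fixes \<alpha> :: real
  shows "2 * sin \<alpha> * (\<Sum>j\<le>N. sin ((real j + 1) * \<alpha>) * sin ((real (j + k) + 1) * \<alpha>))
    = (real N + 1) * cos (real k * \<alpha>) * sin \<alpha>
      - (sin ((2 * real N + real k + 3) * \<alpha>) - sin ((real k + 1) * \<alpha>)) / 2"
proof -
  have summand: "2 * sin \<alpha> * (sin ((real j + 1) * \<alpha>) * sin ((real (j + k) + 1) * \<alpha>))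
      = cos (real k * \<alpha>) * sin \<alpha>
        - (sin ((2 * real j + real k + 3) * \<alpha>) - sin ((2 * real j + real k + 1) * \<alpha>)) / 2" for j
  proof -
    define b c where "b = (real j + 1) * \<alpha>" and "c = (real (j + k) + 1) * \<alpha>"
    have args: "real k * \<alpha> = c - b" "(2 * real j + real k + 3) * \<alpha> = (b + c) + \<alpha>"
        "(2 * real j + real k + 1) * \<alpha> = (b + c) - \<alpha>"
      by (simp_all add: b_def c_def algebra_simps)
    have "2 * sin \<alpha> * (sin b * sin c) = sin \<alpha> * (cos (c - b) - cos (b + c))"
      by (simp add: cos_add cos_diff)
    also have "\<dots> = cos (c - b) * sin \<alpha> - sin \<alpha> * cos (b + c)"
      by (simp add: right_diff_distrib)
    also have "sin \<alpha> * cos (b + c) = (sin ((b + c) + \<alpha>) - sin ((b + c) - \<alpha>)) / 2"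
      by (simp add: sin_add[of "b + c"] sin_diff[of "b + c"])
    finally show ?thesis
      unfolding args b_def[symmetric] c_def[symmetric] .
  qed
  show ?thesis
  proof (induction N)
    case 0
    show ?case using summand[of 0] by simp
  next
    case (Suc N)
    have arg: "2 * real (Suc N) + real k + 1 = 2 * real N + real k + 3" by simp
    have "2 * sin \<alpha> * (\<Sum>j\<le>Suc N. sin ((real j + 1) * \<alpha>) * sin ((real (j + k) + 1) * \<alpha>))
      = 2 * sin \<alpha> * (\<Sum>j\<le>N. sin ((real j + 1) * \<alpha>) * sin ((real (j + k) + 1) * \<alpha>))
        + 2 * sin \<alpha> * (sin ((real (Suc N) + 1) * \<alpha>) * sin ((real (Suc N + k) + 1) * \<alpha>))"
      by (simp only: sum.atMost_Suc distrib_left)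
    also have "\<dots> = (real N + 1) * cos (real k * \<alpha>) * sin \<alpha>
      - (sin ((2 * real N + real k + 3) * \<alpha>) - sin ((real k + 1) * \<alpha>)) / 2
      + (cos (real k * \<alpha>) * sin \<alpha>
        - (sin ((2 * real (Suc N) + real k + 3) * \<alpha>) - sin ((2 * real N + real k + 3) * \<alpha>)) / 2)"
      unfolding Suc summand arg by (rule refl)
    also have "\<dots> = (real (Suc N) + 1) * cos (real k * \<alpha>) * sin \<alpha>
      - (sin ((2 * real (Suc N) + real k + 3) * \<alpha>) - sin ((real k + 1) * \<alpha>)) / 2"
      by (simp add: distrib_right add_divide_distrib diff_divide_distrib)
    finally show ?case .
  qed
qed

definition jackson_angle :: "nat \<Rightarrow> real" where
  "jackson_angle s = pi / (real s + 2)"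

lemma jackson_angle_bounds: "0 < jackson_angle s" "jackson_angle s \<le> pi / 2"
  by (simp_all add: jackson_angle_def field_simps)

lemma sin_jackson_angle_pos: "0 < sin (jackson_angle s)"
  using jackson_angle_bounds[of s] pi_gt_zero by (intro sin_gt_zero) linarith+

text \<open>Jackson's coefficients are the autocorrelation of the sequence \<open>sin ((j + 1) \<alpha>)\<close>, \<open>j = 0, \<dots>, s\<close>,
  where \<open>\<alpha> = \<pi> / (s + 2)\<close>, normalized to start with \<open>1\<close>. Positivity of the kernel comes from
  this representation.\<close>

lemma jackson_coeff_autocorrelation:
  assumes "k \<le> s"
  shows "(\<Sum>j\<le>s - k. sin ((real j + 1) * jackson_angle s) * sin ((real (j + k) + 1) * jackson_angle s))
    = (real s + 2) / 2 * jackson_coeff s k"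
proof -
  define \<alpha> where "\<alpha> = jackson_angle s"
  define C where "C = (\<Sum>j\<le>s - k. sin ((real j + 1) * \<alpha>) * sin ((real (j + k) + 1) * \<alpha>))"
  have pos: "0 < sin \<alpha>" unfolding \<alpha>_def by (rule sin_jackson_angle_pos)
  have period: "(real s + 2) * \<alpha> = pi" by (simp add: \<alpha>_def jackson_angle_def)
  have "(2 * real (s - k) + real k + 3) * \<alpha> = 2 * ((real s + 2) * \<alpha>) - (real k + 1) * \<alpha>"
    using assms by (simp add: of_nat_diff algebra_simps)
  hence "sin ((2 * real (s - k) + real k + 3) * \<alpha>) = - sin ((real k + 1) * \<alpha>)"
    unfolding period by (simp add: sin_diff)
  hence "2 * sin \<alpha> * C = (real (s - k) + 1) * cos (real k * \<alpha>) * sin \<alpha> + sin ((real k + 1) * \<alpha>)"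
    unfolding C_def sin_autocorrelation by simp
  also have "sin ((real k + 1) * \<alpha>) = sin (real k * \<alpha>) * cos \<alpha> + cos (real k * \<alpha>) * sin \<alpha>"
    by (simp add: distrib_right sin_add)
  finally have "C = ((real s - real k + 2) * cos (real k * \<alpha>) + sin (real k * \<alpha>) * cot \<alpha>) / 2"
    using pos assms by (simp add: cot_def of_nat_diff field_simps)
  moreover have "real k * pi / (real s + 2) = real k * \<alpha>" "pi / (real s + 2) = \<alpha>"
    by (simp_all add: \<alpha>_def jackson_angle_def)
  hence "(real s + 2) * jackson_coeff s k
      = (real s - real k + 2) * cos (real k * \<alpha>) + sin (real k * \<alpha>) * cot \<alpha>"
    unfolding jackson_coeff_def by simp
  ultimately have "C = (real s + 2) / 2 * jackson_coeff s k"
    by simp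
  thus ?thesis
    unfolding \<alpha>_def[symmetric] C_def[symmetric] .
qed

lemma jackson_coeff_0: "jackson_coeff s 0 = 1"
  by (simp add: jackson_coeff_def)

lemma jackson_coeff_1: "jackson_coeff s 1 = cos (jackson_angle s)"
  using sin_jackson_angle_pos[of s]
  by (simp add: jackson_coeff_def jackson_angle_def cot_def field_simps)

lemma abs_sin_mult_le: "\<bar>sin (real k * t)\<bar> \<le> real k * \<bar>sin t\<bar>"
proof (induction k)
  case (Suc k)
  have "\<bar>sin (real (Suc k) * t)\<bar> = \<bar>sin (real k * t) * cos t + cos (real k * t) * sin t\<bar>"
    by (simp add: distrib_right sin_add algebra_simps)
  also have "\<dots> \<le> \<bar>sin (real k * t)\<bar> * \<bar>cos t\<bar> + \<bar>cos (real k * t)\<bar> * \<bar>sin t\<bar>"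
    by (metis abs_mult abs_triangle_ineq)
  also have "\<dots> \<le> \<bar>sin (real k * t)\<bar> * 1 + 1 * \<bar>sin t\<bar>"
    by (intro add_mono mult_mono) auto
  finally show ?case using Suc by (simp add: distrib_right)
qed simp

lemma abs_jackson_coeff_le_1:
  assumes "k \<le> s"
  shows "\<bar>jackson_coeff s k\<bar> \<le> 1"
proof -
  define \<alpha> where "\<alpha> = jackson_angle s"
  have pos: "0 < sin \<alpha>" unfolding \<alpha>_def by (rule sin_jackson_angle_pos)
  have "0 \<le> cos \<alpha>"
    using jackson_angle_bounds[of s] by (intro cos_ge_zero) (auto simp: \<alpha>_def)
  have "\<bar>sin (real k * \<alpha>) * cot \<alpha>\<bar> = \<bar>sin (real k * \<alpha>)\<bar> * (cos \<alpha> / sin \<alpha>)"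
    using pos \<open>0 \<le> cos \<alpha>\<close> by (simp add: abs_mult cot_def)
  also have "\<dots> \<le> (real k * sin \<alpha>) * (cos \<alpha> / sin \<alpha>)"
    using abs_sin_mult_le[of k \<alpha>] pos \<open>0 \<le> cos \<alpha>\<close> by (intro mult_right_mono) auto
  also have "\<dots> \<le> real k"
    using pos by (simp add: mult_left_le)
  finally have "\<bar>sin (real k * \<alpha>) * cot \<alpha>\<bar> \<le> real k" .
  moreover have "\<bar>(real s - real k + 2) * cos (real k * \<alpha>)\<bar> \<le> real s - real k + 2"
    using assms by (simp add: abs_mult mult_left_le)
  ultimately have "\<bar>(real s - real k + 2) * cos (real k * \<alpha>) + sin (real k * \<alpha>) * cot \<alpha>\<bar> \<le> real s + 2"
    by linarith
  moreover have "real k * pi / (real s + 2) = real k * \<alpha>" "pi / (real s + 2) = \<alpha>"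
    by (simp_all add: \<alpha>_def jackson_angle_def)
  ultimately have "\<bar>(real s + 2) * jackson_coeff s k\<bar> \<le> real s + 2"
    unfolding jackson_coeff_def by simp
  thus ?thesis by (simp add: abs_mult)
qed

lemma sum_symmetric_by_difference:
  fixes g :: "nat \<Rightarrow> nat \<Rightarrow> real"
  assumes sym: "\<And>i j. g i j = g j i"
  shows "(\<Sum>i\<le>s. \<Sum>j\<le>s. g i j) = (\<Sum>i\<le>s. g i i) + 2 * (\<Sum>k=1..s. \<Sum>j\<le>s - k. g j (j + k))"
proof (induction s)
  case (Suc s)
  have "(\<Sum>i\<le>Suc s. \<Sum>j\<le>Suc s. g i j)
      = (\<Sum>i\<le>s. \<Sum>j\<le>s. g i j) + 2 * (\<Sum>i\<le>s. g i (Suc s)) + g (Suc s) (Suc s)"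
  proof -
    have "(\<Sum>j\<le>s. g (Suc s) j) = (\<Sum>i\<le>s. g i (Suc s))"
      by (intro sum.cong refl) (rule sym)
    thus ?thesis by (simp add: sum.distrib)
  qed
  moreover have "(\<Sum>k=1..Suc s. \<Sum>j\<le>Suc s - k. g j (j + k))
      = (\<Sum>k=1..s. \<Sum>j\<le>s - k. g j (j + k)) + (\<Sum>i\<le>s. g i (Suc s))"
  proof -
    have "(\<Sum>k=1..Suc s. \<Sum>j\<le>Suc s - k. g j (j + k))
        = (\<Sum>k=1..s. \<Sum>j\<le>Suc s - k. g j (j + k)) + g 0 (Suc s)"
      by simp
    also have "(\<Sum>k=1..s. \<Sum>j\<le>Suc s - k. g j (j + k))
        = (\<Sum>k=1..s. (\<Sum>j\<le>s - k. g j (j + k)) + g (Suc s - k) (Suc s))"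
      by (intro sum.cong refl) (auto simp: Suc_diff_le)
    also have "\<dots> = (\<Sum>k=1..s. \<Sum>j\<le>s - k. g j (j + k)) + (\<Sum>k=1..s. g (Suc s - k) (Suc s))"
      by (rule sum.distrib)
    also have "(\<Sum>k=1..s. g (Suc s - k) (Suc s)) = (\<Sum>i=1..s. g i (Suc s))"
      by (rule sum.reindex_bij_witness[of _ "\<lambda>i. Suc s - i" "\<lambda>i. Suc s - i"]) auto
    also have "(\<Sum>i\<le>s. g i (Suc s)) = g 0 (Suc s) + (\<Sum>i=1..s. g i (Suc s))"
      by (simp add: atMost_atLeast0 sum.atLeast_Suc_atMost)
    ultimately show ?thesis by simp
  qed
  ultimately show ?case using Suc by simp
qed simp

definition jackson_kernel :: "nat \<Rightarrow> real \<Rightarrow> real" where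
  "jackson_kernel s u = 1 + 2 * (\<Sum>k=1..s. jackson_coeff s k * cos (real k * u))"

text \<open>Up to the factor \<open>(s + 2) / 2\<close> the kernel is the squared modulus of the trigonometric polynomial with
  coefficients \<open>sin ((j + 1) \<alpha>)\<close>.\<close>

lemma jackson_kernel_nonneg: "0 \<le> jackson_kernel s u"
proof -
  define \<alpha> where "\<alpha> = jackson_angle s"
  define g where "g i j = sin ((real i + 1) * \<alpha>) * sin ((real j + 1) * \<alpha>) * cos ((real j - real i) * u)"
    for i j :: nat
  have "0 \<le> (\<Sum>i\<le>s. sin ((real i + 1) * \<alpha>) * cos (real i * u))\<^sup>2
      + (\<Sum>i\<le>s. sin ((real i + 1) * \<alpha>) * sin (real i * u))\<^sup>2"
    by simp
  also have "\<dots> = (\<Sum>i\<le>s. \<Sum>j\<le>s. g i j)"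
    unfolding power2_eq_square sum_product sum.distrib[symmetric] g_def
    by (intro sum.cong refl) (simp add: left_diff_distrib cos_diff algebra_simps)
  also have "\<dots> = (\<Sum>i\<le>s. g i i) + 2 * (\<Sum>k=1..s. \<Sum>j\<le>s - k. g j (j + k))"
  proof (rule sum_symmetric_by_difference)
    fix i j
    have "cos ((real j - real i) * u) = cos ((real i - real j) * u)"
      using cos_minus[of "(real i - real j) * u"] by (simp add: algebra_simps)
    thus "g i j = g j i" by (simp add: g_def)
  qed
  also have "(\<Sum>i\<le>s. g i i) = (real s + 2) / 2"
    using jackson_coeff_autocorrelation[of 0 s] by (simp add: g_def \<alpha>_def jackson_coeff_0)
  also have "(\<Sum>k=1..s. \<Sum>j\<le>s - k. g j (j + k))
      = (\<Sum>k=1..s. (real s + 2) / 2 * jackson_coeff s k * cos (real k * u))"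
  proof (intro sum.cong refl)
    fix k assume "k \<in> {1..s}"
    have "(\<Sum>j\<le>s - k. g j (j + k)) = (\<Sum>j\<le>s - k. sin ((real j + 1) * jackson_angle s)
        * sin ((real (j + k) + 1) * jackson_angle s)) * cos (real k * u)"
      by (simp add: g_def \<alpha>_def sum_distrib_right)
    also have "\<dots> = (real s + 2) / 2 * jackson_coeff s k * cos (real k * u)"
      using jackson_coeff_autocorrelation[of k s] \<open>k \<in> {1..s}\<close> by simp
    finally show "(\<Sum>j\<le>s - k. g j (j + k)) = (real s + 2) / 2 * jackson_coeff s k * cos (real k * u)" .
  qed
  also have "(real s + 2) / 2 + 2 * \<dots> = (real s + 2) / 2 * jackson_kernel s u"
    by (simp add: jackson_kernel_def sum_distrib_left distrib_left mult.assoc mult.left_commute)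
  finally show ?thesis by (simp add: zero_le_mult_iff)
qed

section \<open>The Chebyshev distribution in the angle variable\<close>

definition cheb_point :: "real \<Rightarrow> real \<Rightarrow> real \<Rightarrow> real" where
  "cheb_point a b t = (a + b) / 2 + (b - a) / 2 * cos t"

text \<open>Points of \<open>[a, b]\<close> are parametrized by angles in \<open>[-\<pi>, 0]\<close>, on which \<open>cheb_point\<close> is increasing.
  The inverse clips its argument, so that an \<open>x\<close> outside \<open>[a, b]\<close> has the angle of the nearer end point;
  formulas in the angle then hold for all real \<open>x\<close>.\<close>

definition cheb_angle :: "real \<Rightarrow> real \<Rightarrow> real \<Rightarrow> real" where
  "cheb_angle a b x = - arccos (max (- 1) (min 1 ((2 * x - (a + b)) / (b - a))))"

lemma cheb_angle_bounds: "- pi \<le> cheb_angle a b x" "cheb_angle a b x \<le> 0"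
  using arccos_bounded[of "max (- 1) (min 1 ((2 * x - (a + b)) / (b - a)))"]
  by (auto simp: cheb_angle_def)

lemma continuous_cheb_angle: "continuous_on UNIV (cheb_angle a b)"
proof -
  have eq: "cheb_angle a b x = - arccos (max (- 1) (min 1 (x * (2 / (b - a)) - (a + b) / (b - a))))" for x
    by (simp add: cheb_angle_def diff_divide_distrib mult.commute)
  show ?thesis
    unfolding eq[abs_def] by (intro continuous_intros) auto
qed

lemma cheb_angle_measurable [measurable]: "cheb_angle a b \<in> borel_measurable borel"
  by (rule borel_measurable_continuous_onI[OF continuous_cheb_angle])

lemma cheb_point_measurable [measurable]: "cheb_point a b \<in> borel_measurable borel"
  unfolding cheb_point_def[abs_def] by (intro borel_measurable_continuous_onI continuous_intros)

lemma cheb_scale_point: "a < b \<Longrightarrow> (2 * cheb_point a b t - (a + b)) / (b - a) = cos t"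
  by (simp add: cheb_point_def field_simps)

lemma cheb_point_bounds:
  assumes "a < b"
  shows "a \<le> cheb_point a b t" "cheb_point a b t \<le> b"
proof -
  have "(b - a) / 2 * (- 1) \<le> (b - a) / 2 * cos t" "(b - a) / 2 * cos t \<le> (b - a) / 2 * 1"
    using assms by (intro mult_left_mono; simp)+
  thus "a \<le> cheb_point a b t" "cheb_point a b t \<le> b"
    by (simp_all add: cheb_point_def field_simps)
qed

lemma cheb_angle_point:
  assumes "a < b" "- pi \<le> t" "t \<le> 0"
  shows "cheb_angle a b (cheb_point a b t) = t"
  using assms by (simp add: cheb_angle_def cheb_scale_point arccos_cos2)

lemma cheb_angle_left: "a < b \<Longrightarrow> x \<le> a \<Longrightarrow> cheb_angle a b x = - pi"
proof -
  assume "a < b" "x \<le> a"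
  hence "(2 * x - (a + b)) / (b - a) \<le> - 1" by (simp add: field_simps)
  thus ?thesis by (simp add: cheb_angle_def)
qed

lemma cheb_angle_right: "a < b \<Longrightarrow> b \<le> x \<Longrightarrow> cheb_angle a b x = 0"
proof -
  assume "a < b" "b \<le> x"
  hence "1 \<le> (2 * x - (a + b)) / (b - a)" by (simp add: field_simps)
  thus ?thesis by (simp add: cheb_angle_def)
qed

lemma cheb_point_angle:
  assumes "a < b" "a \<le> x" "x \<le> b"
  shows "cheb_point a b (cheb_angle a b x) = x"
proof -
  have "- 1 \<le> (2 * x - (a + b)) / (b - a)" "(2 * x - (a + b)) / (b - a) \<le> 1"
    using assms by (auto simp: field_simps)
  hence "cos (cheb_angle a b x) = (2 * x - (a + b)) / (b - a)"
    by (simp add: cheb_angle_def)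
  thus ?thesis using assms by (simp add: cheb_point_def field_simps)
qed

lemma cheb_point_le_iff:
  assumes "a < b" "- pi \<le> t" "t \<le> 0" "a \<le> x"
  shows "cheb_point a b t \<le> x \<longleftrightarrow> t \<le> cheb_angle a b x"
proof -
  define y where "y = (2 * x - (a + b)) / (b - a)"
  have "- 1 \<le> y" using assms by (simp add: y_def field_simps)
  have eq: "2 * (x - cheb_point a b t) = (2 * x - (a + b)) - cos t * (b - a)"
    by (simp add: cheb_point_def field_simps)
  have "cheb_point a b t \<le> x \<longleftrightarrow> 0 \<le> 2 * (x - cheb_point a b t)"
    by simp
  also have "\<dots> \<longleftrightarrow> cos t * (b - a) \<le> 2 * x - (a + b)"
    by (simp only: eq diff_ge_0_iff_ge)
  also have "\<dots> \<longleftrightarrow> cos t \<le> y"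
    using assms by (simp add: y_def pos_le_divide_eq)
  also have "\<dots> \<longleftrightarrow> cos t \<le> max (- 1) (min 1 y)"
    using \<open>- 1 \<le> y\<close> by (auto simp: max_def min_def intro: order.trans[OF cos_le_one])
  also have "\<dots> \<longleftrightarrow> arccos (max (- 1) (min 1 y)) \<le> arccos (cos t)"
    by (subst arccos_le_mono) auto
  also have "\<dots> \<longleftrightarrow> t \<le> cheb_angle a b x"
    using assms by (auto simp: arccos_cos2 cheb_angle_def y_def)
  finally show ?thesis .
qed

lemma cheb_dist_eq:
  assumes "a < b"
  shows "cheb_dist a b x = 1 + cheb_angle a b x / pi"
proof (cases "x < a \<or> b < x")
  case True
  thus ?thesis
    using assms cheb_angle_left[of a b x] cheb_angle_right[of a b x] by (auto simp: cheb_dist_def)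
next
  case False
  define y where "y = (2 * x - (a + b)) / (b - a)"
  have y: "- 1 \<le> y" "y \<le> 1" using False assms by (auto simp: y_def field_simps)
  have "2 / (b - a) * x - (b + a) / (b - a) = y"
    by (simp add: y_def diff_divide_distrib add.commute)
  hence "cheb_dist a b x = 1 / 2 + (1 / pi) * arcsin y"
    using False by (simp add: cheb_dist_def)
  also have "\<dots> = 1 + cheb_angle a b x / pi"
  proof -
    have "cheb_angle a b x = - arccos y"
      using y by (simp add: cheb_angle_def y_def[symmetric])
    thus ?thesis using y by (simp add: arcsin_arccos_eq field_simps)
  qed
  finally show ?thesis .
qed

text \<open>The Chebyshev distribution is the image of the uniform distribution of the angle.\<close>

definition angle_measure :: "real measure" where
  "angle_measure = uniform_measure lborel {- pi..0}"

lemma prob_space_angle_measure: "prob_space angle_measure"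
  unfolding angle_measure_def by (intro prob_space_uniform_measure) (auto simp: emeasure_lborel_Icc)

lemma sets_angle_measure [measurable_cong]: "sets angle_measure = sets borel"
  by (simp add: angle_measure_def)

lemma space_angle_measure: "space angle_measure = UNIV"
  by (simp add: angle_measure_def)

lemma integral_angle_measure:
  fixes f :: "real \<Rightarrow> real"
  assumes [measurable]: "f \<in> borel_measurable borel"
  shows "(\<integral>t. f t \<partial>angle_measure) = (\<integral>t. f t * indicator {- pi..0} t \<partial>lborel) / pi"
proof -
  have "1 / ennreal pi = ennreal (1 / pi)"
    using divide_ennreal[of 1 pi] by simp
  hence eq: "angle_measure = density lborel (\<lambda>t. ennreal (indicator {- pi..0} t / pi))"
    unfolding angle_measure_def uniform_measure_def
    by (intro density_cong) (auto simp: emeasure_lborel_Icc divide_ennreal split: split_indicator)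
  have "(\<integral>t. f t \<partial>angle_measure) = (\<integral>t. (indicator {- pi..0} t / pi) *\<^sub>R f t \<partial>lborel)"
    unfolding eq by (rule integral_density) auto
  thus ?thesis by (simp add: mult.commute)
qed

lemma interval_measure_cdf:
  assumes "real_distribution N"
  shows "interval_measure (cdf N) = N"
proof (rule cdf_unique)
  interpret real_distribution N by (rule assms)
  show "real_distribution (interval_measure (cdf N))"
    by (intro real_distribution_interval_measure cdf_nondecreasing cdf_is_right_cont
        cdf_lim_at_bot cdf_lim_at_top_prob)
  show "cdf (interval_measure (cdf N)) = cdf N"
    by (intro cdf_interval_measure cdf_nondecreasing cdf_is_right_cont cdf_lim_at_bot)
qed (rule assms)

lemma interval_measure_cheb_dist:
  assumes "a < b"
  shows "interval_measure (cheb_dist a b) = distr angle_measure borel (cheb_point a b)"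
proof -
  interpret P: prob_space angle_measure by (rule prob_space_angle_measure)
  interpret D: real_distribution "distr angle_measure borel (cheb_point a b)"
    by (rule P.real_distribution_distr) measurable
  have cdf: "cdf (distr angle_measure borel (cheb_point a b)) x = cheb_dist a b x" for x
  proof -
    have meas: "cheb_point a b -` {..x} \<in> sets borel"
      using measurable_sets[OF cheb_point_measurable, of "{..x}" a b] by simp
    have "cdf (distr angle_measure borel (cheb_point a b)) x
        = measure angle_measure (cheb_point a b -` {..x})"
      by (simp add: cdf_def measure_distr space_angle_measure)
    also have "\<dots> = measure lborel ({- pi..0} \<inter> cheb_point a b -` {..x}) / pi"
      unfolding angle_measure_def using meas
      by (subst measure_uniform_measure) (auto simp: emeasure_lborel_Icc)
    also have "\<dots> = 1 + cheb_angle a b x / pi"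
    proof (cases "x < a")
      case True
      have "\<not> cheb_point a b t \<le> x" for t
        using cheb_point_bounds(1)[OF assms, of t] True by linarith
      hence "{- pi..0} \<inter> cheb_point a b -` {..x} = {}" by auto
      thus ?thesis using True assms by (simp add: cheb_angle_left)
    next
      case False
      hence "{- pi..0} \<inter> cheb_point a b -` {..x} = {- pi..cheb_angle a b x}"
        using cheb_point_le_iff[OF assms, of _ x] cheb_angle_bounds[of a b x] by auto
      thus ?thesis using cheb_angle_bounds[of a b x] by (simp add: field_simps)
    qed
    finally show ?thesis by (simp add: cheb_dist_eq[OF assms])
  qed
  show ?thesis
    using interval_measure_cdf[OF D.real_distribution_axioms] by (simp only: cdf[abs_def])
qed

lemma cheb_orthonormal_point:
  assumes "a < b"
  shows "cheb_orthonormal a b k (cheb_point a b t) = (if k = 0 then 1 else sqrt 2 * cos (real k * t))"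
proof -
  have "2 / (b - a) * cheb_point a b t - (b + a) / (b - a) = cos t"
    using cheb_scale_point[OF assms, of t] by (simp add: diff_divide_distrib add.commute)
  thus ?thesis by (simp add: cheb_orthonormal_def cheb_T_cos)
qed

lemma cheb_T_continuous: "continuous_on UNIV (cheb_T k)"
proof (induction k rule: induct_nat_012)
  case (ge2 n)
  have "cheb_T (Suc (Suc n)) = (\<lambda>x. 2 * x * cheb_T (Suc n) x - cheb_T n x)" by auto
  thus ?case using ge2 by (auto intro!: continuous_intros)
next
  case 0
  have "cheb_T 0 = (\<lambda>x. 1)" by auto
  thus ?case by (simp only: continuous_on_const)
next
  case 1
  have "cheb_T (Suc 0) = (\<lambda>x. x)" by auto
  thus ?case by (simp only: continuous_on_id)
qed

lemma cheb_T_measurable [measurable]: "cheb_T k \<in> borel_measurable borel"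
  by (rule borel_measurable_continuous_onI[OF cheb_T_continuous])

lemma cheb_orthonormal_measurable [measurable]: "cheb_orthonormal a b k \<in> borel_measurable borel"
  unfolding cheb_orthonormal_def[abs_def] by measurable

text \<open>The integrals over \<open>{..x}\<close> of the orthonormal polynomials, as functions of the angle of \<open>x\<close>.\<close>

definition cheb_primitive :: "nat \<Rightarrow> real \<Rightarrow> real" where
  "cheb_primitive k t = (if k = 0 then 1 + t / pi else sqrt 2 * sin (real k * t) / (real k * pi))"

lemma cheb_primitive_measurable [measurable]: "cheb_primitive k \<in> borel_measurable borel"
  unfolding cheb_primitive_def[abs_def]
  by (cases "k = 0") (auto intro!: borel_measurable_continuous_onI continuous_intros)

lemma cheb_primitive_ends: 
  "cheb_primitive k (- pi) = 0" "cheb_primitive k 0 = (if k = 0 then 1 else 0)"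
  by (simp_all add: cheb_primitive_def)

lemma dist_integral_cheb_dist_below:
  assumes "a < b"
  shows "dist_integral (cheb_dist a b) (\<lambda>y. indicator {..x} y * cheb_orthonormal a b k y)
    = cheb_primitive k (cheb_angle a b x)"
proof -
  define \<theta> where "\<theta> = cheb_angle a b x"
  define f where "f t = (if k = 0 then 1 else sqrt 2 * cos (real k * t))" for t
  have "dist_integral (cheb_dist a b) (\<lambda>y. indicator {..x} y * cheb_orthonormal a b k y)
      = (\<integral>t. indicator {..x} (cheb_point a b t) * cheb_orthonormal a b k (cheb_point a b t) \<partial>angle_measure)"
    unfolding dist_integral_def interval_measure_cheb_dist[OF assms]
    by (subst integral_distr) auto
  also have "\<dots> = (\<integral>t. indicator {..x} (cheb_point a b t) * cheb_orthonormal a b k (cheb_point a b t)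
      * indicator {- pi..0} t \<partial>lborel) / pi"
    by (rule integral_angle_measure) measurable
  also have "\<dots> = cheb_primitive k \<theta>"
  proof (cases "x < a")
    case True
    hence "indicator {..x} (cheb_point a b t) = (0 :: real)" for t
      using cheb_point_bounds(1)[OF assms, of t] by (auto split: split_indicator)
    thus ?thesis
      using True assms by (simp add: \<theta>_def cheb_angle_left cheb_primitive_ends)
  next
    case False
    have "indicator {..x} (cheb_point a b t) * cheb_orthonormal a b k (cheb_point a b t) * indicator {- pi..0} t
        = f t * indicator {- pi..\<theta>} t" for t
    proof (cases "t \<in> {- pi..0}")
      case True
      thus ?thesis
        using cheb_point_le_iff[OF assms, of t x] \<open>\<not> x < a\<close>
        by (auto simp: f_def \<theta>_def cheb_orthonormal_point[OF assms] split: split_indicator)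
    next
      case False
      hence "t \<notin> {- pi..\<theta>}" using cheb_angle_bounds(2)[of a b x] by (auto simp: \<theta>_def)
      with False show ?thesis by simp
    qed
    hence "(\<integral>t. indicator {..x} (cheb_point a b t) * cheb_orthonormal a b k (cheb_point a b t)
      * indicator {- pi..0} t \<partial>lborel) = (\<integral>t. f t * indicator {- pi..\<theta>} t \<partial>lborel)"
      by simp
    also have "\<dots> = pi * cheb_primitive k \<theta> - pi * cheb_primitive k (- pi)"
    proof (rule integral_FTC_Icc_real)
      show "- pi \<le> \<theta>" unfolding \<theta>_def by (rule cheb_angle_bounds)
      show "((\<lambda>t. pi * cheb_primitive k t) has_real_derivative f t) (at t)" for t
        unfolding cheb_primitive_def[abs_def] f_def
        by (cases "k = 0") (auto intro!: derivative_eq_intros simp: field_simps)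
      show "isCont f t" for t
        unfolding f_def[abs_def] by (cases "k = 0") (auto intro!: continuous_intros)
    qed
    finally show ?thesis by (simp add: cheb_primitive_ends)
  qed
  finally show ?thesis by (simp add: \<theta>_def)
qed

text \<open>The damped approximation to the indicator of \<open>{..x}\<close>, evaluated at the point with angle \<open>\<phi>\<close>, where \<open>t\<close>
  is the angle of \<open>x\<close>. Read as a function of \<open>t\<close> it is the distribution function of the smoothed point
  mass at \<open>\<phi>\<close>.\<close>

definition smooth_step :: "nat \<Rightarrow> real \<Rightarrow> real \<Rightarrow> real" where
  "smooth_step s \<phi> t = 1 + t / pi
     + (\<Sum>k=1..s. jackson_coeff s k * (2 * sin (real k * t) / (real k * pi)) * cos (real k * \<phi>))"

lemma smooth_step_ends: "smooth_step s \<phi> (- pi) = 0" "smooth_step s \<phi> 0 = 1"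
  by (simp_all add: smooth_step_def)

lemma smooth_step_deriv:
  "(smooth_step s \<phi> has_real_derivative
     (jackson_kernel s (t + \<phi>) + jackson_kernel s (t - \<phi>)) / (2 * pi)) (at t)"
proof -
  have "(smooth_step s \<phi> has_real_derivative
     1 / pi + (\<Sum>k=1..s. jackson_coeff s k * (2 * cos (real k * t) / pi) * cos (real k * \<phi>))) (at t)"
    unfolding smooth_step_def[abs_def]
    by (auto intro!: derivative_eq_intros sum.cong)
  also have "(\<Sum>k=1..s. jackson_coeff s k * (2 * cos (real k * t) / pi) * cos (real k * \<phi>))
      = (\<Sum>k=1..s. jackson_coeff s k * cos (real k * (t + \<phi>)) / pi + jackson_coeff s k * cos (real k * (t - \<phi>)) / pi)"
    by (intro sum.cong refl) (simp add: distrib_left right_diff_distrib cos_add cos_diff add_divide_distrib diff_divide_distrib)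
  also have "1 / pi + \<dots> = (jackson_kernel s (t + \<phi>) + jackson_kernel s (t - \<phi>)) / (2 * pi)"
    by (simp add: jackson_kernel_def sum.distrib add_divide_distrib sum_divide_distrib[symmetric])
  finally show ?thesis .
qed

text \<open>The place where nonnegativity of the kernel enters.\<close>

lemma smooth_step_mono: "t \<le> u \<Longrightarrow> smooth_step s \<phi> t \<le> smooth_step s \<phi> u"
proof (erule DERIV_nonneg_imp_nondecreasing)
  fix x
  show "\<exists>y. (smooth_step s \<phi> has_real_derivative y) (at x) \<and> 0 \<le> y"
    by (intro exI conjI, rule smooth_step_deriv) (simp add: jackson_kernel_nonneg)
qed

lemma smooth_step_bounds:
  assumes "- pi \<le> t" "t \<le> 0"
  shows "0 \<le> smooth_step s \<phi> t" "smooth_step s \<phi> t \<le> 1"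
  using smooth_step_mono[OF assms(1), of s \<phi>] smooth_step_mono[OF assms(2), of s \<phi>]
  by (simp_all add: smooth_step_ends)

lemma smooth_step_measurable [measurable]: "smooth_step s \<phi> \<in> borel_measurable borel"
  unfolding smooth_step_def[abs_def] by measurable

lemma damped_approx_indicator:
  assumes "a < b"
  shows "damped_approx s (jackson_coeff s) (cheb_dist a b) (cheb_orthonormal a b) (indicator {..x}) (cheb_point a b \<phi>)
    = smooth_step s \<phi> (cheb_angle a b x)"
proof -
  have "{0..s} = insert 0 {1..s}" by auto
  thus ?thesis
    unfolding damped_approx_def dist_integral_cheb_dist_below[OF assms] cheb_orthonormal_point[OF assms]
    by (auto simp: smooth_step_def cheb_primitive_def jackson_coeff_0 intro!: sum.cong)
qed

section \<open>The error of smoothing a point mass\<close>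

lemma one_minus_cos_le: "1 - cos t \<le> t\<^sup>2 / 2" for t :: real
proof -
  have "1 - cos t = 2 * (sin (t / 2))\<^sup>2"
    using cos_double_sin[of "t / 2"] by simp
  also have "\<dots> \<le> 2 * (t / 2)\<^sup>2"
    by (intro mult_left_mono abs_le_square_iff[THEN iffD1] abs_sin_x_le_abs_x) simp
  finally show ?thesis by (simp add: power2_eq_square)
qed

text \<open>The factorization of \<open>cos t - cos \<phi>\<close> bounds its square by \<open>2 (1 - cos (t - \<phi>))\<close>; the inequality between
  arithmetic and geometric means then trades the absolute value for a trigonometric polynomial,
  whose integral against the kernel is explicit. The parameter \<open>\<eta>\<close> is chosen in \<open>smooth_step_error\<close>.\<close>

lemma cos_diff_le:
  fixes t \<phi> \<eta> :: real
  assumes "0 < \<eta>"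
  shows "\<bar>cos t - cos \<phi>\<bar> \<le> \<eta> / 2 + (1 - cos (t - \<phi>)) / \<eta>"
proof -
  define d where "d = \<bar>cos t - cos \<phi>\<bar>"
  have "d\<^sup>2 = 4 * ((sin ((t + \<phi>) / 2))\<^sup>2 * (sin ((\<phi> - t) / 2))\<^sup>2)"
    by (simp add: d_def cos_diff_cos power_mult_distrib)
  also have "\<dots> \<le> 4 * (1 * (sin ((\<phi> - t) / 2))\<^sup>2)"
    by (intro mult_left_mono mult_right_mono) (auto simp: abs_square_le_1)
  also have "\<dots> = 2 * (1 - cos (t - \<phi>))"
  proof -
    have "2 * ((\<phi> - t) / 2) = \<phi> - t" by simp
    hence "cos (\<phi> - t) = 1 - 2 * (sin ((\<phi> - t) / 2))\<^sup>2"
      using cos_double_sin[of "(\<phi> - t) / 2"] by (simp only:)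
    moreover have "cos (t - \<phi>) = cos (\<phi> - t)" using cos_minus[of "\<phi> - t"] by simp
    ultimately show ?thesis by simp
  qed
  finally have "d\<^sup>2 \<le> 2 * (1 - cos (t - \<phi>))" .
  moreover have "2 * \<eta> * d \<le> \<eta>\<^sup>2 + d\<^sup>2"
    using sum_squares_bound[of \<eta> d] by simp
  ultimately have "2 * \<eta> * d \<le> \<eta>\<^sup>2 + 2 * (1 - cos (t - \<phi>))" by linarith
  thus ?thesis
    using assms unfolding d_def[symmetric] by (simp add: field_simps power2_eq_square)
qed

definition sin_primitive :: "nat \<Rightarrow> real \<Rightarrow> real" where
  "sin_primitive k t = (if k = 0 then t else sin (real k * t) / real k)"

lemma sin_primitive_deriv: "(sin_primitive k has_real_derivative cos (real k * t)) (at t)"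
  unfolding sin_primitive_def[abs_def]
  by (cases "k = 0") (auto intro!: derivative_eq_intros)

lemma sin_primitive_ends: "sin_primitive k 0 = 0" "sin_primitive k (- pi) = (if k = 0 then - pi else 0)"
  by (simp_all add: sin_primitive_def)

text \<open>An antiderivative of the mean of \<open>cos u \<sqdot> jackson_kernel s u / \<pi>\<close> over \<open>u = t + \<phi>\<close> and \<open>u = t - \<phi>\<close>.\<close>

definition cos_kernel_primitive :: "nat \<Rightarrow> real \<Rightarrow> real \<Rightarrow> real" where
  "cos_kernel_primitive s \<phi> t = (sin_primitive 1 t * cos \<phi> + (\<Sum>k=1..s. jackson_coeff s k *
     (sin_primitive (k + 1) t * cos (real (k + 1) * \<phi>) + sin_primitive (k - 1) t * cos (real (k - 1) * \<phi>)))) / pi"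

lemma cos_mult_jackson_kernel:
  "cos u * jackson_kernel s u
    = cos u + (\<Sum>k=1..s. jackson_coeff s k * (cos (real (k + 1) * u) + cos (real (k - 1) * u)))"
proof -
  have "2 * cos u * cos (real k * u) = cos (real (k + 1) * u) + cos (real (k - 1) * u)" if "k \<in> {1..s}" for k
  proof -
    have "real (k + 1) * u = real k * u + u" "real (k - 1) * u = real k * u - u"
      using that by (auto simp: algebra_simps of_nat_diff)
    thus ?thesis by (simp add: cos_add cos_diff)
  qed
  hence "(\<Sum>k=1..s. jackson_coeff s k * (2 * cos u * cos (real k * u)))
      = (\<Sum>k=1..s. jackson_coeff s k * (cos (real (k + 1) * u) + cos (real (k - 1) * u)))"
    by (intro sum.cong refl) simp
  moreover have "cos u * jackson_kernel s u = cos u + (\<Sum>k=1..s. jackson_coeff s k * (2 * cos u * cos (real k * u)))"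
    by (simp add: jackson_kernel_def distrib_left sum_distrib_left mult_ac)
  ultimately show ?thesis by simp
qed

lemma cos_kernel_primitive_deriv:
  "(cos_kernel_primitive s \<phi> has_real_derivative
     (cos (t + \<phi>) * jackson_kernel s (t + \<phi>) + cos (t - \<phi>) * jackson_kernel s (t - \<phi>)) / (2 * pi)) (at t)"
proof -
  have prod: "cos (real j * (t + \<phi>)) + cos (real j * (t - \<phi>)) = 2 * (cos (real j * t) * cos (real j * \<phi>))" for j
    by (simp add: distrib_left right_diff_distrib cos_add cos_diff)
  have "(cos_kernel_primitive s \<phi> has_real_derivative
      (cos (real 1 * t) * cos \<phi> + (\<Sum>k=1..s. jackson_coeff s k *
       (cos (real (k + 1) * t) * cos (real (k + 1) * \<phi>) + cos (real (k - 1) * t) * cos (real (k - 1) * \<phi>)))) / pi) (at t)"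
    unfolding cos_kernel_primitive_def[abs_def]
    by (intro DERIV_cdivide DERIV_add DERIV_sum DERIV_cmult DERIV_cmult_right sin_primitive_deriv)
  moreover have "(cos (t + \<phi>) * jackson_kernel s (t + \<phi>) + cos (t - \<phi>) * jackson_kernel s (t - \<phi>)) / (2 * pi)
    = (cos (real 1 * t) * cos \<phi> + (\<Sum>k=1..s. jackson_coeff s k *
       (cos (real (k + 1) * t) * cos (real (k + 1) * \<phi>) + cos (real (k - 1) * t) * cos (real (k - 1) * \<phi>)))) / pi"
  proof -
    have "cos (t + \<phi>) * jackson_kernel s (t + \<phi>) + cos (t - \<phi>) * jackson_kernel s (t - \<phi>)
      = (cos (real 1 * (t + \<phi>)) + cos (real 1 * (t - \<phi>)))
        + (\<Sum>k=1..s. jackson_coeff s k * ((cos (real (k + 1) * (t + \<phi>)) + cos (real (k + 1) * (t - \<phi>)))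
            + (cos (real (k - 1) * (t + \<phi>)) + cos (real (k - 1) * (t - \<phi>)))))"
      unfolding cos_mult_jackson_kernel by (simp add: sum.distrib distrib_left)
    also have "\<dots> = 2 * (cos (real 1 * t) * cos \<phi>) + (\<Sum>k=1..s. 2 * (jackson_coeff s k *
       (cos (real (k + 1) * t) * cos (real (k + 1) * \<phi>) + cos (real (k - 1) * t) * cos (real (k - 1) * \<phi>))))"
      unfolding prod by (intro arg_cong2[of _ _ _ _ "(+)"] sum.cong refl) (simp_all add: distrib_left)
    finally show ?thesis
      by (simp only: sum_distrib_left[symmetric] distrib_left[symmetric])
  qed
  ultimately show ?thesis by (simp only:)
qed

text \<open>Only the summand \<open>k = 1\<close> has a nonzero mean: \<open>sin_primitive (k - 1)\<close> is then the identity.\<close>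

lemma cos_kernel_primitive_diff:
  assumes "0 < s"
  shows "cos_kernel_primitive s \<phi> 0 - cos_kernel_primitive s \<phi> (- pi) = cos (jackson_angle s)"
proof -
  have "cos_kernel_primitive s \<phi> 0 = 0"
    by (simp add: cos_kernel_primitive_def sin_primitive_ends)
  moreover have "(\<Sum>k=1..s. jackson_coeff s k *
     (sin_primitive (k + 1) (- pi) * cos (real (k + 1) * \<phi>) + sin_primitive (k - 1) (- pi) * cos (real (k - 1) * \<phi>)))
    = (\<Sum>k=1..s. if k = 1 then - pi * jackson_coeff s 1 else 0)"
    by (intro sum.cong refl) (auto simp: sin_primitive_ends)
  ultimately show ?thesis
    using assms jackson_coeff_1[of s] by (simp add: cos_kernel_primitive_def sin_primitive_ends)
qed

text \<open>The left-hand side is the Wasserstein distance from the point mass at \<open>\<phi>\<close> to its smoothing. On either side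
  of \<open>\<phi>\<close> the integrand has a sign, and integration by parts against \<open>cos t - cos \<phi>\<close> turns the integral into
  the mean of \<open>\<bar>cos t - cos \<phi>\<bar>\<close> under the smoothed mass, with boundary terms that vanish. By \<open>cos_diff_le\<close> this mean is at most
  \<open>\<eta> / 2 + (1 - cos \<alpha>) / \<eta>\<close>, where \<open>\<alpha>\<close> is \<open>jackson_angle s\<close>, and \<open>\<eta> = \<alpha>\<close> gives the bound.\<close>

lemma smooth_step_error:
  assumes "0 < s" "- pi \<le> \<phi>" "\<phi> \<le> 0"
  shows "(\<integral>\<^sup>+t. ennreal (\<bar>of_bool (\<phi> \<le> t) - smooth_step s \<phi> t\<bar> * - sin t) * indicator {- pi..0} t \<partial>lborel)
    \<le> ennreal (jackson_angle s)"
proof -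
  define \<eta> where "\<eta> = jackson_angle s"
  have \<eta>: "0 < \<eta>" by (simp add: \<eta>_def jackson_angle_bounds)
  define S where "S = smooth_step s \<phi>"
  define J where "J u = jackson_kernel s u / (2 * pi)" for u
  define S' where "S' t = J (t + \<phi>) + J (t - \<phi>)" for t
  define C where "C t = cos (t + \<phi>) * J (t + \<phi>) + cos (t - \<phi>) * J (t - \<phi>)" for t
  define h where "h t = (\<eta> / 2 + 1 / \<eta>) * S' t - C t / \<eta>" for t
  define W where "W t = (\<eta> / 2 + 1 / \<eta>) * S t - cos_kernel_primitive s \<phi> t / \<eta>" for t
  have S_deriv: "(S has_real_derivative S' t) (at t)" for t
    using smooth_step_deriv[of s \<phi> t] by (simp add: S_def S'_def J_def add_divide_distrib)
  have "(cos_kernel_primitive s \<phi> has_real_derivative C t) (at t)" for t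
    using cos_kernel_primitive_deriv[of s \<phi> t] by (simp add: C_def J_def add_divide_distrib)
  hence W_deriv: "(W has_real_derivative h t) (at t)" for t
    unfolding W_def[abs_def] h_def by (intro DERIV_diff DERIV_cmult DERIV_cdivide S_deriv)
  have J_nonneg: "0 \<le> J u" for u
    by (simp add: J_def jackson_kernel_nonneg)
  have S'_bound: "\<bar>cos t - cos \<phi>\<bar> * S' t \<le> h t" for t
  proof -
    have "\<bar>cos t - cos \<phi>\<bar> * J (t + \<phi>) \<le> (\<eta> / 2 + (1 - cos (t + \<phi>)) / \<eta>) * J (t + \<phi>)"
      using cos_diff_le[OF \<eta>, of t "- \<phi>"] J_nonneg by (intro mult_right_mono) auto
    moreover have "\<bar>cos t - cos \<phi>\<bar> * J (t - \<phi>) \<le> (\<eta> / 2 + (1 - cos (t - \<phi>)) / \<eta>) * J (t - \<phi>)"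
      using cos_diff_le[OF \<eta>, of t \<phi>] J_nonneg by (intro mult_right_mono) auto
    ultimately show ?thesis
      by (simp add: h_def S'_def C_def algebra_simps add_divide_distrib diff_divide_distrib)
  qed
  have W_diff: "W 0 - W (- pi) \<le> \<eta>"
  proof -
    have "W 0 - W (- pi) = (\<eta> / 2 + 1 / \<eta>) * (S 0 - S (- pi))
        - (cos_kernel_primitive s \<phi> 0 - cos_kernel_primitive s \<phi> (- pi)) / \<eta>"
      by (simp add: W_def diff_divide_distrib algebra_simps)
    also have "\<dots> = \<eta> / 2 + (1 - cos \<eta>) / \<eta>"
      unfolding cos_kernel_primitive_diff[OF assms(1)]
      by (simp add: S_def smooth_step_ends \<eta>_def[symmetric] diff_divide_distrib)
    also have "\<dots> \<le> \<eta> / 2 + (\<eta>\<^sup>2 / 2) / \<eta>"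
      using \<eta> by (intro add_left_mono divide_right_mono one_minus_cos_le) auto
    also have "\<dots> = \<eta>" using \<eta> by (simp add: power2_eq_square)
    finally show ?thesis .
  qed
  have [measurable]: "S \<in> borel_measurable borel" "S' \<in> borel_measurable borel" "h \<in> borel_measurable borel"
    by (simp_all add: S_def S'_def[abs_def] h_def[abs_def] C_def J_def jackson_kernel_def)
  \<comment> \<open>The derivatives of \<open>S (cos t - cos \<phi>) + W\<close> and \<open>W - (S - 1) (cos t - cos \<phi>)\<close>; they dominate the integrand to the left and to the right of \<open>\<phi>\<close>.\<close>
  define f1 where "f1 t = (S' t * (cos t - cos \<phi>) - S t * sin t) + h t" for t
  define f2 where "f2 t = h t - (S' t * (cos t - cos \<phi>) - (S t - 1) * sin t)" for t
  have abs_bound: "S' t * (cos t - cos \<phi>) \<le> h t" "- (S' t * (cos t - cos \<phi>)) \<le> h t" for t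
  proof -
    have "\<bar>S' t * (cos t - cos \<phi>)\<bar> = \<bar>cos t - cos \<phi>\<bar> * S' t"
      using J_nonneg by (simp add: abs_mult S'_def)
    with S'_bound[of t] show "S' t * (cos t - cos \<phi>) \<le> h t" "- (S' t * (cos t - cos \<phi>)) \<le> h t"
      by linarith+
  qed
  have sin: "0 \<le> - sin t" if "t \<in> {- pi..0}" for t
    using sin_ge_zero[of "- t"] that by simp
  have le1: "S t * - sin t \<le> f1 t" and le2: "(1 - S t) * - sin t \<le> f2 t" for t
    using abs_bound[of t] by (simp_all add: f1_def f2_def algebra_simps)
  have S_bounds: "0 \<le> S t" "S t \<le> 1" if "t \<in> {- pi..0}" for t
    using smooth_step_bounds[of t s \<phi>] that by (auto simp: S_def)
  have "(\<integral>\<^sup>+t. ennreal (\<bar>of_bool (\<phi> \<le> t) - S t\<bar> * - sin t) * indicator {- pi..0} t \<partial>lborel)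
      \<le> (\<integral>\<^sup>+t. ennreal (f1 t) * indicator {- pi..\<phi>} t + ennreal (f2 t) * indicator {\<phi>..0} t \<partial>lborel)"
  proof (rule nn_integral_mono)
    fix t
    show "ennreal (\<bar>of_bool (\<phi> \<le> t) - S t\<bar> * - sin t) * indicator {- pi..0} t
      \<le> ennreal (f1 t) * indicator {- pi..\<phi>} t + ennreal (f2 t) * indicator {\<phi>..0} t"
    proof (cases "t \<in> {- pi..0}")
      case True
      show ?thesis
      proof (cases "\<phi> \<le> t")
        case ge: True
        have "\<bar>1 - S t\<bar> * - sin t \<le> f2 t" using le2[of t] S_bounds[OF True] by simp
        hence "ennreal (\<bar>of_bool (\<phi> \<le> t) - S t\<bar> * - sin t) * indicator {- pi..0} t \<le> ennreal (f2 t)"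
          using ge True by (simp add: ennreal_leI del: mult_minus_right)
        also have "\<dots> \<le> ennreal (f1 t) * indicator {- pi..\<phi>} t + ennreal (f2 t) * indicator {\<phi>..0} t"
          using ge True by (simp add: add_increasing)
        finally show ?thesis .
      next
        case lt: False
        have "\<bar>0 - S t\<bar> * - sin t \<le> f1 t" using le1[of t] S_bounds[OF True] by simp
        hence "ennreal (\<bar>of_bool (\<phi> \<le> t) - S t\<bar> * - sin t) \<le> ennreal (f1 t)"
          using lt by (intro ennreal_leI) simp
        thus ?thesis using lt True by simp
      qed
    qed simp
  qed
  also have "\<dots> = (\<integral>\<^sup>+t. ennreal (f1 t) * indicator {- pi..\<phi>} t \<partial>lborel)
      + (\<integral>\<^sup>+t. ennreal (f2 t) * indicator {\<phi>..0} t \<partial>lborel)"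
    by (rule nn_integral_add) (simp_all add: f1_def[abs_def] f2_def[abs_def])
  also have "(\<integral>\<^sup>+t. ennreal (f1 t) * indicator {- pi..\<phi>} t \<partial>lborel)
      = ennreal ((S \<phi> * (cos \<phi> - cos \<phi>) + W \<phi>) - (S (- pi) * (cos (- pi) - cos \<phi>) + W (- pi)))"
  proof (rule nn_integral_FTC_Icc)
    show "f1 \<in> borel_measurable borel" unfolding f1_def[abs_def] by measurable
    show "((\<lambda>t. S t * (cos t - cos \<phi>) + W t) has_real_derivative f1 t) (at t)" for t
      unfolding f1_def
      by (auto intro!: derivative_eq_intros S_deriv W_deriv)
    show "0 \<le> f1 t" if "t \<in> {- pi..\<phi>}" for t
    proof -
      have t: "t \<in> {- pi..0}" using that assms by auto
      from mult_nonneg_nonneg[OF S_bounds(1)[OF t] sin[OF t]] le1[of t] show ?thesis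
        by (rule order.trans)
    qed
  qed (use assms in auto)
  also have "(\<integral>\<^sup>+t. ennreal (f2 t) * indicator {\<phi>..0} t \<partial>lborel)
      = ennreal ((W 0 - (S 0 - 1) * (cos 0 - cos \<phi>)) - (W \<phi> - (S \<phi> - 1) * (cos \<phi> - cos \<phi>)))"
  proof (rule nn_integral_FTC_Icc)
    show "f2 \<in> borel_measurable borel" unfolding f2_def[abs_def] by measurable
    show "((\<lambda>t. W t - (S t - 1) * (cos t - cos \<phi>)) has_real_derivative f2 t) (at t)" for t
      unfolding f2_def
      by (auto intro!: derivative_eq_intros S_deriv W_deriv)
    show "0 \<le> f2 t" if "t \<in> {\<phi>..0}" for t
    proof -
      have t: "t \<in> {- pi..0}" using that assms by auto
      have "0 \<le> 1 - S t" using S_bounds(2)[OF t] by simp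
      from mult_nonneg_nonneg[OF this sin[OF t]] le2[of t] show ?thesis
        by (rule order.trans)
    qed
  qed (use assms in auto)
  also have "ennreal ((S \<phi> * (cos \<phi> - cos \<phi>) + W \<phi>) - (S (- pi) * (cos (- pi) - cos \<phi>) + W (- pi)))
      = ennreal (W \<phi> - W (- pi))"
    by (simp add: S_def smooth_step_ends)
  also have "ennreal ((W 0 - (S 0 - 1) * (cos 0 - cos \<phi>)) - (W \<phi> - (S \<phi> - 1) * (cos \<phi> - cos \<phi>)))
      = ennreal (W 0 - W \<phi>)"
    by (simp add: S_def smooth_step_ends)
  also have "ennreal (W \<phi> - W (- pi)) + ennreal (W 0 - W \<phi>) = ennreal (W 0 - W (- pi))"
  proof -
    have "0 \<le> h t" for t
    proof -
      have "0 \<le> \<bar>cos t - cos \<phi>\<bar> * S' t" using J_nonneg by (simp add: S'_def)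
      with S'_bound[of t] show ?thesis by linarith
    qed
    hence "t \<le> u \<Longrightarrow> W t \<le> W u" for t u
      using W_deriv by (intro DERIV_nonneg_imp_nondecreasing[of t u W]) auto
    hence "0 \<le> W \<phi> - W (- pi)" "0 \<le> W 0 - W \<phi>" using assms by auto
    thus ?thesis by (simp add: ennreal_plus[symmetric] del: ennreal_plus)
  qed
  also have "\<dots> \<le> ennreal \<eta>" using W_diff by (rule ennreal_leI)
  finally show ?thesis by (simp add: S_def \<eta>_def)
qed

lemma sin_primitive_error:
  assumes "0 \<le> c"
  shows "(\<integral>\<^sup>+t. ennreal (\<bar>c * sin (real k * t)\<bar> * - sin t) * indicator {- pi..0} t \<partial>lborel) \<le> ennreal (2 * c)"
proof -
  have sin: "0 \<le> - sin t" if "t \<in> {- pi..0}" for t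
    using sin_ge_zero[of "- t"] that by simp
  have "(\<integral>\<^sup>+t. ennreal (\<bar>c * sin (real k * t)\<bar> * - sin t) * indicator {- pi..0} t \<partial>lborel)
      \<le> (\<integral>\<^sup>+t. ennreal (c * - sin t) * indicator {- pi..0} t \<partial>lborel)"
  proof (rule nn_integral_mono)
    fix t
    show "ennreal (\<bar>c * sin (real k * t)\<bar> * - sin t) * indicator {- pi..0} t
      \<le> ennreal (c * - sin t) * indicator {- pi..0} t"
    proof (cases "t \<in> {- pi..0}")
      case True
      have "\<bar>c * sin (real k * t)\<bar> * - sin t \<le> c * - sin t"
        using assms sin[OF True] by (intro mult_right_mono) (auto simp: abs_mult mult_left_le)
      thus ?thesis using True by (auto intro: ennreal_leI)
    qed simp
  qed
  also have "\<dots> = ennreal (c * cos 0 - c * cos (- pi))"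
  proof (rule nn_integral_FTC_Icc)
    show "((\<lambda>t. c * cos t) has_real_derivative c * - sin t) (at t)" for t
      by (auto intro!: derivative_eq_intros)
    show "0 \<le> c * - sin t" if "t \<in> {- pi..0}" for t
      using that sin[of t] assms by (intro mult_nonneg_nonneg) auto
  qed auto
  finally show ?thesis by simp
qed

text \<open>The substitution \<open>x = cheb_point a b t\<close>.\<close>

lemma nn_integral_cheb_angle:
  assumes "a < b" and [measurable]: "F \<in> borel_measurable borel"
  shows "(\<integral>\<^sup>+x. ennreal (F (cheb_angle a b x)) * indicator {a..b} x \<partial>lborel)
    = ennreal ((b - a) / 2) * (\<integral>\<^sup>+t. ennreal (F t * - sin t) * indicator {- pi..0} t \<partial>lborel)"
proof -
  have sin: "0 \<le> - sin t" if "t \<in> {- pi..0}" for t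
    using sin_ge_zero[of "- t"] that by simp
  have ends: "cheb_point a b (- pi) = a" "cheb_point a b 0 = b"
    by (simp_all add: cheb_point_def field_simps)
  have "(\<integral>\<^sup>+x. ennreal (F (cheb_angle a b x)) * indicator {cheb_point a b (- pi)..cheb_point a b 0} x \<partial>lborel)
    = (\<integral>\<^sup>+t. ennreal (F (cheb_angle a b (cheb_point a b t))) * ennreal ((b - a) / 2 * - sin t)
        * indicator {- pi..0} t \<partial>lborel)"
  proof (rule nn_integral_substitution_aux)
    show "(cheb_point a b has_real_derivative (b - a) / 2 * - sin t) (at t)" for t
      unfolding cheb_point_def[abs_def] by (auto intro!: derivative_eq_intros)
    show "continuous_on {- pi..0} (\<lambda>t. (b - a) / 2 * - sin t)"
      by (intro continuous_intros)
    show "0 \<le> (b - a) / 2 * - sin t" if "t \<in> {- pi..0}" for t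
      using assms sin[OF that] by (intro mult_nonneg_nonneg) auto
  qed auto
  also have "\<dots> = (\<integral>\<^sup>+t. ennreal ((b - a) / 2) * (ennreal (F t * - sin t) * indicator {- pi..0} t) \<partial>lborel)"
  proof (intro nn_integral_cong)
    fix t
    show "ennreal (F (cheb_angle a b (cheb_point a b t))) * ennreal ((b - a) / 2 * - sin t) * indicator {- pi..0} t
      = ennreal ((b - a) / 2) * (ennreal (F t * - sin t) * indicator {- pi..0} t)"
    proof (cases "t \<in> {- pi..0}")
      case True
      have "ennreal (F t) * ennreal ((b - a) / 2 * - sin t) = ennreal ((b - a) / 2) * ennreal (F t * - sin t)"
        unfolding ennreal_mult''[OF sin[OF True]] by (simp only: mult_ac)
      thus ?thesis using True assms(1) by (simp add: cheb_angle_point)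
    qed simp
  qed
  also have "\<dots> = ennreal ((b - a) / 2) * (\<integral>\<^sup>+t. ennreal (F t * - sin t) * indicator {- pi..0} t \<partial>lborel)"
    by (rule nn_integral_cmult) simp
  finally show ?thesis by (simp only: ends)
qed

lemma smoothed_indicator_error:
  assumes "a < b" "0 < s" "a \<le> l" "l \<le> b"
  shows "(\<integral>\<^sup>+x. ennreal \<bar>of_bool (l \<le> x) - smooth_step s (cheb_angle a b l) (cheb_angle a b x)\<bar> \<partial>lborel)
    \<le> ennreal ((b - a) / 2 * jackson_angle s)"
proof -
  define \<phi> where "\<phi> = cheb_angle a b l"
  define F where "F t = \<bar>of_bool (\<phi> \<le> t) - smooth_step s \<phi> t\<bar>" for t
  have [measurable]: "F \<in> borel_measurable borel"
    unfolding F_def[abs_def] by measurable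
  have \<phi>: "- pi \<le> \<phi>" "\<phi> \<le> 0" "cheb_point a b \<phi> = l"
    using cheb_angle_bounds[of a b l] cheb_point_angle[OF assms(1,3,4)] by (auto simp: \<phi>_def)
  have "(\<integral>\<^sup>+x. ennreal \<bar>of_bool (l \<le> x) - smooth_step s \<phi> (cheb_angle a b x)\<bar> \<partial>lborel)
      = (\<integral>\<^sup>+x. ennreal (F (cheb_angle a b x)) * indicator {a..b} x \<partial>lborel)"
  proof (intro nn_integral_cong)
    fix x
    consider "x < a" | "b < x" | "x \<in> {a..b}" by fastforce
    thus "ennreal \<bar>of_bool (l \<le> x) - smooth_step s \<phi> (cheb_angle a b x)\<bar>
        = ennreal (F (cheb_angle a b x)) * indicator {a..b} x"
    proof cases
      case 1
      thus ?thesis using assms by (simp add: cheb_angle_left smooth_step_ends)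
    next
      case 2
      thus ?thesis using assms by (simp add: cheb_angle_right smooth_step_ends)
    next
      case 3
      hence "l \<le> x \<longleftrightarrow> \<phi> \<le> cheb_angle a b x"
        using cheb_point_le_iff[OF assms(1) \<phi>(1,2), of x] \<phi>(3) by simp
      thus ?thesis using 3 by (simp add: F_def)
    qed
  qed
  also have "\<dots> = ennreal ((b - a) / 2) * (\<integral>\<^sup>+t. ennreal (F t * - sin t) * indicator {- pi..0} t \<partial>lborel)"
    by (rule nn_integral_cheb_angle[OF assms(1)]) measurable
  also have "\<dots> \<le> ennreal ((b - a) / 2) * ennreal (jackson_angle s)"
    unfolding F_def using smooth_step_error[OF assms(2) \<phi>(1,2)] by (intro mult_left_mono) auto
  also have "\<dots> = ennreal ((b - a) / 2 * jackson_angle s)"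
    using assms(1) by (intro ennreal_mult[symmetric]) (auto simp: jackson_angle_bounds less_imp_le)
  finally show ?thesis by (simp add: \<phi>_def)
qed

lemma cheb_primitive_integral:
  assumes "a < b" "0 < k"
  shows "(\<integral>\<^sup>+x. ennreal \<bar>cheb_primitive k (cheb_angle a b x)\<bar> \<partial>lborel)
    \<le> ennreal ((b - a) * sqrt 2 / (real k * pi))"
proof -
  define c where "c = sqrt 2 / (real k * pi)"
  have c: "0 \<le> c" by (simp add: c_def)
  have "(\<integral>\<^sup>+x. ennreal \<bar>cheb_primitive k (cheb_angle a b x)\<bar> \<partial>lborel)
      = (\<integral>\<^sup>+x. ennreal \<bar>c * sin (real k * cheb_angle a b x)\<bar> * indicator {a..b} x \<partial>lborel)"
  proof (intro nn_integral_cong)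
    fix x
    consider "x < a" | "b < x" | "x \<in> {a..b}" by fastforce
    thus "ennreal \<bar>cheb_primitive k (cheb_angle a b x)\<bar>
        = ennreal \<bar>c * sin (real k * cheb_angle a b x)\<bar> * indicator {a..b} x"
    proof cases
      case 1
      thus ?thesis using assms by (simp add: cheb_angle_left cheb_primitive_ends)
    next
      case 2
      thus ?thesis using assms by (simp add: cheb_angle_right cheb_primitive_ends)
    next
      case 3
      thus ?thesis using assms by (simp add: cheb_primitive_def c_def)
    qed
  qed
  also have "\<dots> = ennreal ((b - a) / 2)
      * (\<integral>\<^sup>+t. ennreal (\<bar>c * sin (real k * t)\<bar> * - sin t) * indicator {- pi..0} t \<partial>lborel)"
    by (rule nn_integral_cheb_angle[OF assms(1)]) measurable
  also have "\<dots> \<le> ennreal ((b - a) / 2) * ennreal (2 * c)"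
    by (intro mult_left_mono sin_primitive_error c) auto
  also have "\<dots> = ennreal ((b - a) * c)"
    using assms(1) c by (simp add: ennreal_mult[symmetric])
  finally show ?thesis by (simp add: c_def)
qed

section \<open>Step functions and Gaussian quadrature\<close>

text \<open>A polynomial times the linear factors at suitable roots keeps its sign on the interval. (These roots are the ones of odd
  multiplicity, but the induction on the degree avoids multiplicities: a root \<open>z\<close> that is split off is removed
  from the set of the quotient if it is there, and added otherwise.)\<close>

lemma sign_change_roots:
  fixes p :: "real poly"
  assumes "a < b" "p \<noteq> 0"
  shows "\<exists>Z. finite Z \<and> (\<forall>z\<in>Z. poly p z = 0 \<and> a < z \<and> z < b) \<and>
    ((\<forall>x\<in>{a..b}. 0 \<le> poly (p * (\<Prod>z\<in>Z. [:- z, 1:])) x) \<or>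
     (\<forall>x\<in>{a..b}. poly (p * (\<Prod>z\<in>Z. [:- z, 1:])) x \<le> 0))"
  using \<open>p \<noteq> 0\<close>
proof (induction "degree p" arbitrary: p rule: less_induct)
  case less
  show ?case
  proof (cases "(\<forall>x\<in>{a..b}. 0 \<le> poly p x) \<or> (\<forall>x\<in>{a..b}. poly p x \<le> 0)")
    case True
    thus ?thesis by (intro exI[of _ "{}"]) auto
  next
    case False
    then obtain x y where xy: "x \<in> {a..b}" "poly p x < 0" "y \<in> {a..b}" "0 < poly p y"
      by (auto simp: not_le)
    have "\<exists>z. a < z \<and> z < b \<and> poly p z = 0"
    proof (cases x y rule: linorder_cases)
      case less
      from poly_IVT_pos[OF this xy(2) xy(4)] show ?thesis
        using xy(1,3) by (meson atLeastAtMost_iff le_less_trans less_le_trans)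
    next
      case greater
      from poly_IVT_neg[OF this xy(4) xy(2)] show ?thesis
        using xy(1,3) by (meson atLeastAtMost_iff le_less_trans less_le_trans)
    qed (use xy in auto)
    then obtain z where z: "a < z" "z < b" "poly p z = 0" by blast
    then obtain q where p: "p = [:- z, 1:] * q"
      by (auto simp: poly_eq_0_iff_dvd elim: dvdE)
    have "q \<noteq> 0" using less.prems p by auto
    hence "degree q < degree p"
      unfolding p by (subst degree_mult_eq) auto
    from less.hyps[OF this \<open>q \<noteq> 0\<close>] obtain Z where Z: "finite Z"
      "\<forall>z\<in>Z. poly q z = 0 \<and> a < z \<and> z < b"
      "(\<forall>x\<in>{a..b}. 0 \<le> poly (q * (\<Prod>z\<in>Z. [:- z, 1:])) x) \<or>
       (\<forall>x\<in>{a..b}. poly (q * (\<Prod>z\<in>Z. [:- z, 1:])) x \<le> 0)" by blast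
    show ?thesis
    proof (cases "z \<in> Z")
      case True
      have "p * (\<Prod>z\<in>Z - {z}. [:- z, 1:]) = q * (\<Prod>z\<in>Z. [:- z, 1:])"
        using Z(1) True by (simp add: p prod.remove algebra_simps)
      thus ?thesis
        using Z by (intro exI[of _ "Z - {z}"]) (auto simp: p)
    next
      case False
      have "p * (\<Prod>z\<in>insert z Z. [:- z, 1:]) = [:- z, 1:]\<^sup>2 * (q * (\<Prod>z\<in>Z. [:- z, 1:]))"
        by (simp only: p power2_eq_square prod.insert[OF Z(1) False] mult_ac)
      hence eq: "poly (p * (\<Prod>z\<in>insert z Z. [:- z, 1:])) x
          = (x - z)\<^sup>2 * poly (q * (\<Prod>z\<in>Z. [:- z, 1:])) x" for x
        by (simp add: poly_power)
      from Z(3) have "(\<forall>x\<in>{a..b}. 0 \<le> poly (p * (\<Prod>z\<in>insert z Z. [:- z, 1:])) x) \<or>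
          (\<forall>x\<in>{a..b}. poly (p * (\<Prod>z\<in>insert z Z. [:- z, 1:])) x \<le> 0)"
        unfolding eq by (meson mult_nonneg_nonneg mult_nonneg_nonpos zero_le_power2)
      thus ?thesis
        using Z(1,2) z by (intro exI[of _ "insert z Z"]) (auto simp: p)
    qed
  qed
qed

definition step_fun :: "nat \<Rightarrow> (nat \<Rightarrow> real) \<Rightarrow> (nat \<Rightarrow> real) \<Rightarrow> real \<Rightarrow> real" where
  "step_fun n w lam x = (\<Sum>i<n. w i * of_bool (lam i \<le> x))"

lemma step_fun_eq_sum_vimage:
  "step_fun n w lam x = (\<Sum>i\<in>{..<n} \<inter> lam -` {..x}. w i)"
  by (simp add: step_fun_def of_bool_def if_distrib sum.inter_restrict cong: if_cong)

text \<open>The measure of a step function is the image of a weighted counting measure, since both have the same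
  distribution function.\<close>

lemma dist_integral_step_fun:
  assumes w: "\<And>i. i < n \<Longrightarrow> 0 \<le> w i" and total: "(\<Sum>i<n. w i) = 1"
    and f: "f \<in> borel_measurable borel"
  shows "dist_integral (step_fun n w lam) f = (\<Sum>i<n. w i * f (lam i))"
proof -
  define P where "P = point_measure {..<n} (\<lambda>i. ennreal (w i))"
  have lam: "lam \<in> measurable P borel" by (simp add: P_def measurable_point_measure_eq1)
  interpret P: prob_space P
  proof (rule prob_spaceI)
    have "emeasure P (space P) = (\<Sum>i<n. ennreal (w i))"
      by (simp add: P_def emeasure_point_measure_finite space_point_measure)
    also have "\<dots> = ennreal (\<Sum>i<n. w i)" using w by (intro sum_ennreal) auto
    finally show "emeasure P (space P) = 1" by (simp add: total)
  qed
  interpret D: real_distribution "distr P borel lam"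
    using lam by (rule P.real_distribution_distr)
  have cdf: "cdf (distr P borel lam) x = step_fun n w lam x" for x
  proof -
    have "cdf (distr P borel lam) x = measure P ({..<n} \<inter> lam -` {..x})"
      using lam by (simp add: cdf_def measure_distr P_def space_point_measure Int_commute)
    also have "\<dots> = enn2real (\<Sum>i\<in>{..<n} \<inter> lam -` {..x}. ennreal (w i))"
      unfolding P_def measure_def by (subst emeasure_point_measure_finite) auto
    also have "(\<Sum>i\<in>{..<n} \<inter> lam -` {..x}. ennreal (w i)) = ennreal (\<Sum>i\<in>{..<n} \<inter> lam -` {..x}. w i)"
      using w by (intro sum_ennreal) auto
    also have "enn2real \<dots> = (\<Sum>i\<in>{..<n} \<inter> lam -` {..x}. w i)"
      using w by (intro enn2real_ennreal sum_nonneg) auto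
    finally show ?thesis by (simp add: step_fun_eq_sum_vimage)
  qed
  have "interval_measure (step_fun n w lam) = distr P borel lam"
    using interval_measure_cdf[OF D.real_distribution_axioms] by (simp only: cdf[abs_def])
  hence "dist_integral (step_fun n w lam) f = (\<integral>i. f (lam i) \<partial>P)"
    using lam f by (simp add: dist_integral_def integral_distr)
  also have "\<dots> = (\<Sum>i<n. w i * f (lam i))"
    using w unfolding P_def by (subst lebesgue_integral_point_measure_finite) auto
  finally show ?thesis .
qed

lemma support_points_step_fun:
  assumes w: "\<And>i. i < n \<Longrightarrow> 0 \<le> w i"
  shows "support_points (step_fun n w lam) \<subseteq> lam ` {i. i < n \<and> 0 < w i}"
proof
  fix x assume x: "x \<in> support_points (step_fun n w lam)"
  define S where "S = lam ` {i. i < n \<and> 0 < w i}"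
  have "finite S" by (simp add: S_def)
  show "x \<in> lam ` {i. i < n \<and> 0 < w i}"
  proof (rule ccontr)
    assume "x \<notin> lam ` {i. i < n \<and> 0 < w i}"
    hence "x \<notin> S" by (simp add: S_def)
    obtain d where d0: "0 < d" "\<forall>y\<in>S. y \<noteq> x \<longrightarrow> d \<le> dist x y"
      using finite_set_avoid[OF \<open>finite S\<close>] by blast
    hence d: "0 < d" "\<And>y. y \<in> S \<Longrightarrow> d \<le> \<bar>x - y\<bar>"
      using \<open>x \<notin> S\<close> by (auto simp: dist_real_def)
    have "step_fun n w lam (x - d / 2) = step_fun n w lam (x + d / 2)"
      unfolding step_fun_def
    proof (intro sum.cong refl)
      fix i assume "i \<in> {..<n}"
      show "w i * of_bool (lam i \<le> x - d / 2) = w i * of_bool (lam i \<le> x + d / 2)"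
      proof (cases "w i = 0")
        case False
        hence "lam i \<in> S" using w[of i] \<open>i \<in> {..<n}\<close> by (auto simp: S_def)
        from d(2)[OF this] d(1) show ?thesis by (auto simp: of_bool_def abs_if split: if_splits)
      qed simp
    qed
    moreover have "step_fun n w lam (x - d / 2) < step_fun n w lam (x + d / 2)"
      using x d(1) by (simp add: support_points_def)
    ultimately show False by simp
  qed
qed

text \<open>Degree below \<open>k\<close>, in a form closed under linear combinations that for \<open>k = 0\<close> means the zero polynomial.\<close>

definition poly_below :: "nat \<Rightarrow> real poly \<Rightarrow> bool" where
  "poly_below k q \<longleftrightarrow> (\<forall>i\<ge>k. coeff q i = 0)"

lemma poly_below_degree: "degree q < k \<Longrightarrow> poly_below k q"
  by (auto simp: poly_below_def coeff_eq_0)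

locale weighted_points =
  fixes n :: nat and w lam :: "nat \<Rightarrow> real" and a b :: real
  assumes weight_nonneg: "\<And>i. i < n \<Longrightarrow> 0 \<le> w i"
    and weight_sum: "(\<Sum>i<n. w i) = 1"
    and point_bounds: "\<And>i. i < n \<Longrightarrow> a \<le> lam i" "\<And>i. i < n \<Longrightarrow> lam i \<le> b"
begin

definition mean :: "(real \<Rightarrow> real) \<Rightarrow> real" where
  "mean f = (\<Sum>i<n. w i * f (lam i))"

definition atoms :: "real set" where
  "atoms = lam ` {i. i < n \<and> 0 < w i}"

lemma dist_integral_eq_mean:
  "f \<in> borel_measurable borel \<Longrightarrow> dist_integral (step_fun n w lam) f = mean f"
  unfolding mean_def by (rule dist_integral_step_fun[OF weight_nonneg weight_sum])

lemma poly_borel_measurable: "(\<lambda>x :: real. poly p x) \<in> borel_measurable borel"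
  by (intro borel_measurable_continuous_onI continuous_intros)

lemma mean_add: "mean (\<lambda>x. f x + g x) = mean f + mean g"
  by (simp add: mean_def distrib_left sum.distrib)

lemma mean_diff: "mean (\<lambda>x. f x - g x) = mean f - mean g"
  by (simp add: mean_def right_diff_distrib sum_subtractf)

lemma mean_cmult: "mean (\<lambda>x. c * f x) = c * mean f"
  by (simp add: mean_def sum_distrib_left mult.left_commute)

lemma mean_nonneg: "(\<And>i. i < n \<Longrightarrow> 0 \<le> f (lam i)) \<Longrightarrow> 0 \<le> mean f"
  unfolding mean_def using weight_nonneg by (intro sum_nonneg) auto

lemma mean_eq_0_atoms:
  assumes "\<And>i. i < n \<Longrightarrow> 0 \<le> f (lam i)" "mean f = 0" "x \<in> atoms"
  shows "f x = 0"
proof -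
  obtain i where i: "i < n" "0 < w i" "x = lam i" using assms(3) by (auto simp: atoms_def)
  have "\<forall>i\<in>{..<n}. w i * f (lam i) = 0"
    using assms(2) weight_nonneg assms(1) unfolding mean_def
    by (subst (asm) sum_nonneg_eq_0_iff) auto
  hence "w i * f (lam i) = 0" using i(1) by blast
  thus ?thesis using i(2,3) by simp
qed

lemma finite_atoms: "finite atoms"
  by (simp add: atoms_def)

lemma poly_nonzero_at_atom:
  assumes "p \<noteq> 0" "degree p < card atoms"
  shows "\<exists>x\<in>atoms. poly p x \<noteq> 0"
proof (rule ccontr)
  assume "\<not> ?thesis"
  hence "atoms \<subseteq> {x. poly p x = 0}" by auto
  hence "card atoms \<le> card {x. poly p x = 0}"
    using assms(1) by (intro card_mono poly_roots_finite)
  also have "\<dots> \<le> degree p" by (rule card_poly_roots_bound[OF assms(1)])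
  finally show False using assms(2) by simp
qed

text \<open>Orthogonal projection onto the polynomials of degree below \<open>k\<close>. The bound on \<open>k\<close> makes the inner product definite
  there. In the step, the error of projecting \<open>x\<^sup>k\<close> is the next orthogonal direction.\<close>

lemma projection_exists:
  "k \<le> card atoms \<Longrightarrow>
    \<exists>g. poly_below k g \<and> (\<forall>q. poly_below k q \<longrightarrow> mean (poly ((f - g) * q)) = 0)"
proof (induction k arbitrary: f)
  case 0
  have "mean (poly ((f - 0) * q)) = 0" if "poly_below 0 q" for q
  proof -
    have "q = 0" using that by (auto simp: poly_below_def poly_eq_iff)
    thus ?thesis by (simp add: mean_def)
  qed
  moreover have "poly_below 0 0" by (simp add: poly_below_def)
  ultimately show ?case by blast
next
  case (Suc k)
  obtain g where g: "poly_below k g" "\<And>q. poly_below k q \<Longrightarrow> mean (poly ((f - g) * q)) = 0"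
    using Suc.IH[of f] Suc_leD[OF Suc.prems] by blast
  obtain g0 where g0: "poly_below k g0"
      "\<And>q. poly_below k q \<Longrightarrow> mean (poly ((monom 1 k - g0) * q)) = 0"
    using Suc.IH[of "monom 1 k"] Suc_leD[OF Suc.prems] by blast
  define h where "h = monom 1 k - g0"
  have h_coeff: "coeff h k = 1" "\<And>i. i > k \<Longrightarrow> coeff h i = 0"
    using g0(1) by (auto simp: h_def poly_below_def)
  have h_orth: "mean (poly (h * q)) = 0" if "poly_below k q" for q
    using g0(2)[OF that] by (simp add: h_def)
  have "h \<noteq> 0" using h_coeff by auto
  have "degree h \<le> k" using h_coeff by (intro degree_le) auto
  hence "\<exists>x\<in>atoms. poly h x \<noteq> 0"
    using Suc.prems \<open>h \<noteq> 0\<close> by (intro poly_nonzero_at_atom) auto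
  hence hh: "mean (poly (h * h)) \<noteq> 0"
    using mean_eq_0_atoms[of "poly (h * h)"] by auto
  define c where "c = mean (poly (f * h)) / mean (poly (h * h))"
  define g' where "g' = g + Polynomial.smult c h"
  have "poly_below (Suc k) g'"
    using g(1) h_coeff by (auto simp: g'_def poly_below_def)
  moreover have "mean (poly ((f - g') * q)) = 0" if q: "poly_below (Suc k) q" for q
  proof -
    define d r where "d = coeff q k" and "r = q - Polynomial.smult d h"
    have r: "poly_below k r"
      unfolding poly_below_def
    proof (intro allI impI)
      fix i assume "k \<le> i"
      thus "coeff r i = 0"
        using q h_coeff by (cases "i = k") (auto simp: r_def d_def poly_below_def)
    qed
    have "(f - g') * q = (f - g) * r + Polynomial.smult d (f * h) - Polynomial.smult d (h * g) - Polynomial.smult (c * d) (h * h) - Polynomial.smult c (h * r)"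
      by (simp add: g'_def r_def algebra_simps smult_diff_right smult_add_right)
    hence "poly ((f - g') * q) = (\<lambda>x. poly ((f - g) * r) x + d * poly (f * h) x - d * poly (h * g) x
        - (c * d) * poly (h * h) x - c * poly (h * r) x)"
      by (simp only: poly_add poly_diff poly_smult fun_eq_iff simp_thms)
    hence "mean (poly ((f - g') * q)) = mean (poly ((f - g) * r)) + d * mean (poly (f * h))
        - d * mean (poly (h * g)) - (c * d) * mean (poly (h * h)) - c * mean (poly (h * r))"
      by (simp only: mean_add mean_diff mean_cmult)
    also have "\<dots> = 0"
      using hh by (simp add: g(2)[OF r] h_orth[OF r] h_orth[OF g(1)] c_def)
    finally show ?thesis .
  qed
  ultimately show ?case by blast
qed

lemma orth_poly_mean:
  "dist_integral (step_fun n w lam) (\<lambda>x. poly p x * poly q x) = mean (poly (p * q))"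
proof -
  have "poly (p * q) = (\<lambda>x. poly p x * poly q x)" by (simp add: fun_eq_iff)
  thus ?thesis using dist_integral_eq_mean[OF poly_borel_measurable[of "p * q"]] by simp
qed

lemma orth_poly_exists:
  assumes "k \<le> card atoms"
  shows "\<exists>p. is_orth_poly (step_fun n w lam) k p"
proof -
  obtain g where g: "poly_below k g"
      "\<And>q. poly_below k q \<Longrightarrow> mean (poly ((monom 1 k - g) * q)) = 0"
    using projection_exists[OF assms, of "monom 1 k"] by auto
  define p where "p = monom 1 k - g"
  have "coeff p k = 1" "\<And>i. i > k \<Longrightarrow> coeff p i = 0"
    using g(1) by (auto simp: p_def poly_below_def)
  hence "p \<noteq> 0" "degree p \<le> k" "k \<le> degree p"
    by (auto intro: degree_le le_degree)
  hence "p \<noteq> 0" "degree p = k" by auto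
  thus ?thesis
    using g(2) poly_below_degree unfolding is_orth_poly_def orth_poly_mean p_def by blast
qed

text \<open>If fewer than \<open>k\<close> roots are needed to fix the sign of \<open>p\<close> on the interval, the product \<open>q\<close> of their linear factors is
  orthogonal to \<open>p\<close>. As \<open>p q\<close> has constant sign it vanishes at every atom, hence so does \<open>p\<close>: there are too many atoms for that.\<close>

lemma orth_poly_roots:
  assumes p: "is_orth_poly (step_fun n w lam) k p" and k: "k < card atoms" and "a < b"
  shows "card {x. poly p x = 0} = k" "\<And>x. poly p x = 0 \<Longrightarrow> a < x \<and> x < b"
proof -
  have "p \<noteq> 0" "degree p = k" and orth: "\<And>q. degree q < k \<Longrightarrow> mean (poly (p * q)) = 0"
    using p by (auto simp: is_orth_poly_def orth_poly_mean)
  obtain Z where Z: "finite Z" "\<And>z. z \<in> Z \<Longrightarrow> poly p z = 0 \<and> a < z \<and> z < b"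
    and sign: "(\<forall>x\<in>{a..b}. 0 \<le> poly (p * (\<Prod>z\<in>Z. [:- z, 1:])) x) \<or>
      (\<forall>x\<in>{a..b}. poly (p * (\<Prod>z\<in>Z. [:- z, 1:])) x \<le> 0)"
    using sign_change_roots[OF \<open>a < b\<close> \<open>p \<noteq> 0\<close>] by auto
  define q where "q = (\<Prod>z\<in>Z. [:- z, 1:])"
  have "degree q = card Z"
    unfolding q_def by (subst degree_prod_eq_sum_degree) auto
  have roots: "finite {x. poly p x = 0}" "card {x. poly p x = 0} \<le> k"
    using poly_roots_finite[OF \<open>p \<noteq> 0\<close>] card_poly_roots_bound[OF \<open>p \<noteq> 0\<close>] \<open>degree p = k\<close> by auto
  have sub: "Z \<subseteq> {x. poly p x = 0}" using Z by auto
  have "k \<le> card Z"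
  proof (rule ccontr)
    assume "\<not> k \<le> card Z"
    hence zero: "mean (poly (p * q)) = 0"
      using \<open>degree q = card Z\<close> by (intro orth) simp
    have "poly (p * q) x = 0" if x: "x \<in> atoms" for x
      using sign
    proof
      assume "\<forall>x\<in>{a..b}. 0 \<le> poly (p * (\<Prod>z\<in>Z. [:- z, 1:])) x"
      hence "0 \<le> poly (p * q) (lam i)" if "i < n" for i
        using point_bounds[OF that] unfolding q_def by (metis atLeastAtMost_iff)
      from mean_eq_0_atoms[OF this zero x] show ?thesis .
    next
      assume "\<forall>x\<in>{a..b}. poly (p * (\<Prod>z\<in>Z. [:- z, 1:])) x \<le> 0"
      hence "poly (p * q) (lam i) \<le> 0" if "i < n" for i
        using point_bounds[OF that] unfolding q_def by (metis atLeastAtMost_iff)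
      hence neg: "0 \<le> -1 * poly (p * q) (lam i)" if "i < n" for i
        using that by (simp only: mult_minus1 neg_0_le_iff_le)
      have "mean (\<lambda>x. -1 * poly (p * q) x) = 0"
        unfolding mean_cmult zero by simp
      from mean_eq_0_atoms[OF neg this x] show ?thesis by (simp only: mult_minus1 neg_equal_0_iff_equal)
    qed
    hence "poly p x = 0" if "x \<in> atoms" for x
      using that Z by (auto simp: q_def poly_prod prod_zero_iff)
    moreover have "\<exists>x\<in>atoms. poly p x \<noteq> 0"
      using k \<open>p \<noteq> 0\<close> \<open>degree p = k\<close> by (intro poly_nonzero_at_atom) auto
    ultimately show False by blast
  qed
  have "card Z \<le> card {x. poly p x = 0}"
    using sub roots(1) by (intro card_mono)
  with \<open>k \<le> card Z\<close> show card: "card {x. poly p x = 0} = k"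
    using roots(2) by linarith
  have "card Z = card {x. poly p x = 0}"
    using \<open>k \<le> card Z\<close> \<open>card Z \<le> card {x. poly p x = 0}\<close> card by linarith
  hence "Z = {x. poly p x = 0}"
    by (rule card_subset_eq[OF roots(1) sub])
  thus "a < x \<and> x < b" if "poly p x = 0" for x
    using Z(2)[of x] that by blast
qed

end

definition lagrange_basis :: "nat \<Rightarrow> (nat \<Rightarrow> real) \<Rightarrow> nat \<Rightarrow> real poly" where
  "lagrange_basis k \<theta> j = (\<Prod>i\<in>{1..k} - {j}. Polynomial.smult (1 / (\<theta> j - \<theta> i)) [:- \<theta> i, 1:])"

lemma lagrange_basis_degree:
  assumes "j \<in> {1..k}"
  shows "degree (lagrange_basis k \<theta> j) \<le> k - 1"
proof -
  have "degree (lagrange_basis k \<theta> j) \<le> (\<Sum>i\<in>{1..k} - {j}. degree (Polynomial.smult (1 / (\<theta> j - \<theta> i)) [:- \<theta> i, 1:]))"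
    unfolding lagrange_basis_def by (rule order.trans[OF degree_prod_sum_le]) (simp_all only: o_def finite_Diff finite_atLeastAtMost order.refl)
  also have "\<dots> \<le> (\<Sum>i\<in>{1..k} - {j}. 1)"
    by (intro sum_mono) (auto intro: order.trans[OF degree_smult_le])
  finally show ?thesis using assms by simp
qed

lemma lagrange_basis_node:
  assumes "inj_on \<theta> {1..k}" "j \<in> {1..k}" "i \<in> {1..k}"
  shows "poly (lagrange_basis k \<theta> j) (\<theta> i) = (if i = j then 1 else 0)"
proof (cases "i = j")
  case True
  have "poly (Polynomial.smult (1 / (\<theta> j - \<theta> l)) [:- \<theta> l, 1:]) (\<theta> j) = 1"
    if "l \<in> {1..k} - {j}" for l
  proof -
    have "l \<in> {1..k}" "l \<noteq> j" using that by blast+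
    hence "\<theta> j - \<theta> l \<noteq> 0"
      using inj_onD[OF assms(1) _ assms(2), of l] by (metis eq_iff_diff_eq_0)
    thus ?thesis by (simp add: diff_divide_distrib[symmetric])
  qed
  hence "poly (lagrange_basis k \<theta> j) (\<theta> j) = 1"
    unfolding lagrange_basis_def poly_prod by (intro prod.neutral) blast
  thus ?thesis using True by simp
next
  case False
  hence "i \<in> {1..k} - {j}" using assms(3) by simp
  moreover have "poly (Polynomial.smult (1 / (\<theta> j - \<theta> i)) [:- \<theta> i, 1:]) (\<theta> i) = 0" by simp
  ultimately show ?thesis
    using False unfolding lagrange_basis_def poly_prod
    by (metis (no_types, lifting) finite_Diff finite_atLeastAtMost prod_zero)
qed

text \<open>Lagrange interpolation.\<close>

lemma poly_eq_on_nodes: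
  assumes "inj_on \<theta> {1..k}" "0 < k" "degree q \<le> k - 1"
  shows "q = (\<Sum>j=1..k. Polynomial.smult (poly q (\<theta> j)) (lagrange_basis k \<theta> j))" (is "_ = ?r")
proof (rule ccontr)
  assume "q \<noteq> ?r"
  hence ne: "q - ?r \<noteq> 0" by simp
  have "degree ?r \<le> k - 1"
    by (intro degree_sum_le order.trans[OF degree_smult_le] lagrange_basis_degree) simp_all
  hence deg: "degree (q - ?r) \<le> k - 1"
    using assms(3) by (intro degree_diff_le)
  have "\<theta> ` {1..k} \<subseteq> {x. poly (q - ?r) x = 0}"
  proof clarify
    fix i assume i: "i \<in> {1..k}"
    have "poly ?r (\<theta> i) = (\<Sum>j=1..k. if j = i then poly q (\<theta> i) else 0)"
      unfolding poly_sum
      by (intro sum.cong refl) (use lagrange_basis_node[OF assms(1) _ i] in auto)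
    thus "poly (q - ?r) (\<theta> i) = 0" using i by simp
  qed
  hence "card (\<theta> ` {1..k}) \<le> card {x. poly (q - ?r) x = 0}"
    by (intro card_mono poly_roots_finite[OF ne])
  also have "\<dots> \<le> k - 1" using card_poly_roots_bound[OF ne] deg by simp
  finally show False using assms by (simp add: card_image)
qed

context weighted_points begin

lemma gauss_rule_exists:
  assumes k: "0 < k" "k < card atoms" and "a < b"
  shows "\<exists>\<theta> \<omega>. is_gauss_rule (step_fun n w lam) k \<theta> \<omega>"
proof -
  obtain p where p: "is_orth_poly (step_fun n w lam) k p"
    using orth_poly_exists[of k] k by auto
  have "finite {x. poly p x = 0}"
    using p by (intro poly_roots_finite) (auto simp: is_orth_poly_def)
  from ex_bij_betw_nat_finite_1[OF this] orth_poly_roots(1)[OF p k(2) \<open>a < b\<close>]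
  obtain \<theta> where \<theta>: "bij_betw \<theta> {1..k} {x. poly p x = 0}" by auto
  hence inj: "inj_on \<theta> {1..k}" by (rule bij_betw_imp_inj_on)
  have "(\<Sum>j=1..k. mean (poly (lagrange_basis k \<theta> j)) * poly q (\<theta> j))
      = dist_integral (step_fun n w lam) (poly q)" if q: "degree q \<le> k - 1" for q
  proof -
    have expand: "poly q x = (\<Sum>j=1..k. poly q (\<theta> j) * poly (lagrange_basis k \<theta> j) x)" for x
    proof -
      have "poly q x = poly (\<Sum>j=1..k. Polynomial.smult (poly q (\<theta> j)) (lagrange_basis k \<theta> j)) x"
        using poly_eq_on_nodes[OF inj k(1) q] by (rule arg_cong)
      also have "\<dots> = (\<Sum>j=1..k. poly q (\<theta> j) * poly (lagrange_basis k \<theta> j) x)"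
        by (simp add: poly_sum)
      finally show ?thesis .
    qed
    have "mean (poly q) = (\<Sum>i<n. w i * (\<Sum>j=1..k. poly q (\<theta> j) * poly (lagrange_basis k \<theta> j) (lam i)))"
      unfolding mean_def by (intro sum.cong refl arg_cong2[of _ _ _ _ "(*)"] expand)
    also have "\<dots> = (\<Sum>i<n. \<Sum>j=1..k. w i * (poly q (\<theta> j) * poly (lagrange_basis k \<theta> j) (lam i)))"
      by (simp add: sum_distrib_left)
    also have "\<dots> = (\<Sum>j=1..k. \<Sum>i<n. w i * (poly q (\<theta> j) * poly (lagrange_basis k \<theta> j) (lam i)))"
      by (rule sum.swap)
    also have "\<dots> = (\<Sum>j=1..k. poly q (\<theta> j) * mean (poly (lagrange_basis k \<theta> j)))"
      by (simp add: mean_def sum_distrib_left mult.left_commute)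
    finally show ?thesis
      by (simp add: dist_integral_eq_mean[OF poly_borel_measurable] mult.commute)
  qed
  moreover have "\<theta> ` {1..k} = {x. poly p x = 0}"
    using \<theta> by (rule bij_betw_imp_surj_on)
  ultimately have "is_gauss_rule (step_fun n w lam) k \<theta> (\<lambda>j. mean (poly (lagrange_basis k \<theta> j)))"
    using p inj unfolding is_gauss_rule_def by blast
  thus ?thesis by blast
qed

text \<open>Division by the orthogonal polynomial extends exactness from degree \<open>k - 1\<close> to \<open>2 k - 1\<close>, which covers the squares of
  the Lagrange polynomials and so shows that the weights are nonnegative.\<close>

lemma gauss_rule_properties:
  assumes k: "0 < k" "k < card atoms" and "a < b"
    and rule: "is_gauss_rule (step_fun n w lam) k \<theta> \<omega>"
  shows "degree q \<le> 2 * k - 1 \<Longrightarrow> (\<Sum>j=1..k. \<omega> j * poly q (\<theta> j)) = mean (poly q)"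
    and "j \<in> {1..k} \<Longrightarrow> 0 \<le> \<omega> j"
    and "j \<in> {1..k} \<Longrightarrow> a < \<theta> j \<and> \<theta> j < b"
proof -
  obtain p where p: "is_orth_poly (step_fun n w lam) k p" and inj: "inj_on \<theta> {1..k}"
    and nodes: "\<theta> ` {1..k} = {x. poly p x = 0}"
    and low: "\<And>q. degree q \<le> k - 1 \<Longrightarrow> (\<Sum>j=1..k. \<omega> j * poly q (\<theta> j)) = mean (poly q)"
    using rule by (auto simp: is_gauss_rule_def dist_integral_eq_mean[OF poly_borel_measurable])
  have "p \<noteq> 0" "degree p = k" and orth: "\<And>q. degree q < k \<Longrightarrow> mean (poly (p * q)) = 0"
    using p by (auto simp: is_orth_poly_def orth_poly_mean)
  have exact: "(\<Sum>j=1..k. \<omega> j * poly q (\<theta> j)) = mean (poly q)" if q: "degree q \<le> 2 * k - 1" for q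
  proof -
    define g r where "g = q div p" and "r = q mod p"
    have split: "q = p * g + r" by (simp add: g_def r_def)
    have r: "degree r \<le> k - 1"
      using degree_mod_less[OF \<open>p \<noteq> 0\<close>, of q] \<open>degree p = k\<close> by (auto simp: r_def)
    have g: "degree g < k"
    proof (cases "g = 0")
      case False
      have "p * g = q - r" by (simp add: split)
      hence "degree (p * g) \<le> 2 * k - 1"
        using degree_diff_le[of q "2 * k - 1" r] q r k by simp
      thus ?thesis
        using False \<open>p \<noteq> 0\<close> \<open>degree p = k\<close> k by (simp add: degree_mult_eq)
    qed (use k in simp)
    have "mean (poly q) = mean (\<lambda>x. poly (p * g) x + poly r x)"
      by (subst split) (simp add: poly_add[abs_def] fun_eq_iff mean_def)
    also have "\<dots> = mean (poly r)" unfolding mean_add orth[OF g] by simp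
    also have "\<dots> = (\<Sum>j=1..k. \<omega> j * poly r (\<theta> j))" by (rule low[OF r, symmetric])
    also have "\<dots> = (\<Sum>j=1..k. \<omega> j * poly q (\<theta> j))"
    proof (intro sum.cong refl)
      fix j assume "j \<in> {1..k}"
      hence "poly p (\<theta> j) = 0" using nodes by auto
      hence "poly q (\<theta> j) = poly r (\<theta> j)"
        using arg_cong[OF split, of "\<lambda>q. poly q (\<theta> j)"] by simp
      thus "\<omega> j * poly r (\<theta> j) = \<omega> j * poly q (\<theta> j)" by simp
    qed
    finally show ?thesis by simp
  qed
  thus "degree q \<le> 2 * k - 1 \<Longrightarrow> (\<Sum>j=1..k. \<omega> j * poly q (\<theta> j)) = mean (poly q)" .
  show "0 \<le> \<omega> j" if j: "j \<in> {1..k}"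
  proof -
    define l where "l = lagrange_basis k \<theta> j * lagrange_basis k \<theta> j"
    have "degree l \<le> 2 * k - 1"
      using lagrange_basis_degree[OF j, of \<theta>] degree_mult_le[of "lagrange_basis k \<theta> j" "lagrange_basis k \<theta> j"]
      by (simp add: l_def)
    hence "mean (poly l) = (\<Sum>i=1..k. \<omega> i * poly l (\<theta> i))" by (rule exact[symmetric])
    also have "\<dots> = (\<Sum>i=1..k. if i = j then \<omega> j else 0)"
      by (intro sum.cong refl) (simp add: l_def lagrange_basis_node[OF inj j])
    also have "\<dots> = \<omega> j" using j by simp
    finally have "\<omega> j = mean (poly l)" by simp
    also have "\<dots> \<ge> 0" by (intro mean_nonneg) (simp add: l_def)
    finally show ?thesis .
  qed
  show "a < \<theta> j \<and> \<theta> j < b" if "j \<in> {1..k}"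
  proof -
    have "poly p (\<theta> j) = 0" using nodes that by blast
    from orth_poly_roots(2)[OF p k(2) \<open>a < b\<close> this] show ?thesis .
  qed
qed

text \<open>If the support has at most \<open>k = (s + 1) div 2\<close> points, the quadrature is the distribution itself. Otherwise there are more
  than \<open>k\<close> atoms, as the support consists of atoms; a Gauss rule then exists, and the one that is chosen has the properties
  common to all of them.\<close>

theorem gauss_quad_step_fun:
  assumes s: "odd s" and "a < b"
  obtains N w' lam' where "gauss_quad s (step_fun n w lam) = step_fun N w' lam'"
    and "weighted_points N w' lam' a b"
    and "\<And>q. degree q \<le> s \<Longrightarrow> (\<Sum>i<N. w' i * poly q (lam' i)) = mean (poly q)"
proof -
  define k where "k = (s + 1) div 2"
  have k: "0 < k" and sk: "2 * k - 1 = s" using s by (auto simp: k_def elim!: oddE)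
  show thesis
  proof (cases "finite (support_points (step_fun n w lam)) \<and> card (support_points (step_fun n w lam)) \<le> k")
    case True
    hence "gauss_quad s (step_fun n w lam) = step_fun n w lam"
      by (simp add: gauss_quad_def k_def)
    thus thesis
      using that weighted_points_axioms by (auto simp: mean_def)
  next
    case False
    have sub: "support_points (step_fun n w lam) \<subseteq> atoms"
      unfolding atoms_def by (rule support_points_step_fun[OF weight_nonneg])
    have "k < card atoms"
      using False sub finite_subset[OF sub finite_atoms] card_mono[OF finite_atoms sub] by linarith
    note kk = k this \<open>a < b\<close>
    obtain \<theta> \<omega> where eq: "(SOME (\<theta>, \<omega>). is_gauss_rule (step_fun n w lam) k \<theta> \<omega>) = (\<theta>, \<omega>)"
      by (metis surj_pair)
    have "\<exists>x. case x of (\<theta>, \<omega>) \<Rightarrow> is_gauss_rule (step_fun n w lam) k \<theta> \<omega>"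
      using gauss_rule_exists[OF kk] by auto
    from someI_ex[OF this] have rule: "is_gauss_rule (step_fun n w lam) k \<theta> \<omega>"
      by (simp add: eq)
    note props = gauss_rule_properties[OF kk rule]
    define w' lam' where "w' i = \<omega> (Suc i)" and "lam' i = \<theta> (Suc i)" for i
    have exact: "(\<Sum>i<k. w' i * poly q (lam' i)) = mean (poly q)" if "degree q \<le> s" for q
      using props(1)[of q] that sk by (simp add: w'_def lam'_def sum.atLeast1_atMost_eq)
    have "gauss_quad s (step_fun n w lam) = (\<lambda>x. \<Sum>j=1..k. \<omega> j * of_bool (\<theta> j \<le> x))"
      unfolding gauss_quad_def Let_def k_def[symmetric] if_not_P[OF False] eq prod.case by (rule refl)
    also have "\<dots> = step_fun k w' lam'"
      by (intro ext) (simp only: One_nat_def sum.atLeast1_atMost_eq step_fun_def w'_def lam'_def)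
    finally have "gauss_quad s (step_fun n w lam) = step_fun k w' lam'" .
    moreover have "weighted_points k w' lam' a b"
    proof
      show "(\<Sum>i<k. w' i) = 1"
        using exact[of 1] weight_sum by (simp add: mean_def)
      fix i assume "i < k"
      hence "Suc i \<in> {1..k}" by simp
      from props(2)[OF this] props(3)[OF this]
      show "0 \<le> w' i" "a \<le> lam' i" "lam' i \<le> b" by (simp_all add: w'_def lam'_def)
    qed
    ultimately show thesis using that exact by blast
  qed
qed

end

section \<open>Wasserstein distance and moments\<close>

lemma wasserstein_triangle:
  assumes [measurable]: "F \<in> borel_measurable borel" "G \<in> borel_measurable borel" "H \<in> borel_measurable borel"
  shows "wasserstein F H \<le> wasserstein F G + wasserstein G H"
proof -
  have "wasserstein F H \<le> (\<integral>\<^sup>+x. ennreal \<bar>F x - G x\<bar> + ennreal \<bar>G x - H x\<bar> \<partial>lborel)"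
    unfolding wasserstein_def
    by (intro nn_integral_mono) (simp add: ennreal_plus[symmetric] ennreal_leI del: ennreal_plus)
  also have "\<dots> = wasserstein F G + wasserstein G H"
    unfolding wasserstein_def by (rule nn_integral_add) auto
  finally show ?thesis .
qed

lemma wasserstein_commute: "wasserstein F G = wasserstein G F"
  by (simp add: wasserstein_def abs_minus_commute)

lemma wasserstein_linear_le:
  assumes "finite I"
    and meas: "\<And>i. i \<in> I \<Longrightarrow> D i \<in> borel_measurable borel"
    and bound: "\<And>i. i \<in> I \<Longrightarrow> (\<integral>\<^sup>+x. ennreal \<bar>D i x\<bar> \<partial>lborel) \<le> ennreal (c i)"
    and c: "\<And>i. i \<in> I \<Longrightarrow> 0 \<le> c i"
    and diff: "\<And>x. F x - G x = (\<Sum>i\<in>I. w i * D i x)"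
  shows "wasserstein F G \<le> ennreal (\<Sum>i\<in>I. \<bar>w i\<bar> * c i)"
proof -
  have "wasserstein F G \<le> (\<integral>\<^sup>+x. (\<Sum>i\<in>I. ennreal \<bar>w i\<bar> * ennreal \<bar>D i x\<bar>) \<partial>lborel)"
    unfolding wasserstein_def
  proof (rule nn_integral_mono)
    fix x
    have "ennreal \<bar>F x - G x\<bar> \<le> ennreal (\<Sum>i\<in>I. \<bar>w i\<bar> * \<bar>D i x\<bar>)"
      unfolding diff by (intro ennreal_leI) (simp add: sum_abs[THEN order.trans] abs_mult)
    also have "\<dots> = (\<Sum>i\<in>I. ennreal \<bar>w i\<bar> * ennreal \<bar>D i x\<bar>)"
      by (simp add: sum_ennreal[symmetric] ennreal_mult)
    finally show "ennreal \<bar>F x - G x\<bar> \<le> (\<Sum>i\<in>I. ennreal \<bar>w i\<bar> * ennreal \<bar>D i x\<bar>)" .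
  qed
  also have "\<dots> = (\<Sum>i\<in>I. \<integral>\<^sup>+x. ennreal \<bar>w i\<bar> * ennreal \<bar>D i x\<bar> \<partial>lborel)"
    using meas by (intro nn_integral_sum) auto
  also have "\<dots> = (\<Sum>i\<in>I. ennreal \<bar>w i\<bar> * (\<integral>\<^sup>+x. ennreal \<bar>D i x\<bar> \<partial>lborel))"
    using meas by (intro sum.cong refl nn_integral_cmult) auto
  also have "\<dots> \<le> (\<Sum>i\<in>I. ennreal \<bar>w i\<bar> * ennreal (c i))"
    using bound by (intro sum_mono mult_left_mono) auto
  also have "\<dots> = ennreal (\<Sum>i\<in>I. \<bar>w i\<bar> * c i)"
    using c by (simp add: sum_ennreal[symmetric] ennreal_mult)
  finally show ?thesis .
qed

lemma wasserstein_average_le: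
  assumes "finite I" and w: "\<And>i. i \<in> I \<Longrightarrow> 0 \<le> w i" "(\<Sum>i\<in>I. w i) = 1" and "0 \<le> c"
    and meas: "\<And>i. i \<in> I \<Longrightarrow> F i \<in> borel_measurable borel" "\<And>i. i \<in> I \<Longrightarrow> G i \<in> borel_measurable borel"
    and bound: "\<And>i. i \<in> I \<Longrightarrow> wasserstein (F i) (G i) \<le> ennreal c"
  shows "wasserstein (\<lambda>x. \<Sum>i\<in>I. w i * F i x) (\<lambda>x. \<Sum>i\<in>I. w i * G i x) \<le> ennreal c"
proof -
  have "wasserstein (\<lambda>x. \<Sum>i\<in>I. w i * F i x) (\<lambda>x. \<Sum>i\<in>I. w i * G i x)
      \<le> ennreal (\<Sum>i\<in>I. \<bar>w i\<bar> * c)"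
    using assms
    by (intro wasserstein_linear_le[where D = "\<lambda>i x. F i x - G i x"])
      (auto simp: wasserstein_def sum_subtractf right_diff_distrib)
  also have "(\<Sum>i\<in>I. \<bar>w i\<bar> * c) = c"
    using w by (simp add: sum_distrib_right[symmetric])
  finally show ?thesis .
qed

definition cheb_shifted :: "real \<Rightarrow> real \<Rightarrow> nat \<Rightarrow> real \<Rightarrow> real" where
  "cheb_shifted a b k x = cheb_T k (2 / (b - a) * x - (b + a) / (b - a))"

lemma cheb_shifted_angle:
  assumes "a < b" "a \<le> x" "x \<le> b"
  shows "cos (real k * cheb_angle a b x) = cheb_shifted a b k x"
proof -
  have "cos (cheb_angle a b x) = (2 * cheb_point a b (cheb_angle a b x) - (a + b)) / (b - a)"
    by (simp only: cheb_scale_point[OF assms(1)])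
  also have "\<dots> = 2 / (b - a) * x - (b + a) / (b - a)"
    using assms by (simp add: cheb_point_angle diff_divide_distrib add.commute)
  finally show ?thesis by (simp add: cheb_shifted_def cheb_T_cos[symmetric])
qed

lemma abs_cheb_shifted_le_1:
  assumes "a < b" "a \<le> x" "x \<le> b"
  shows "\<bar>cheb_shifted a b k x\<bar> \<le> 1"
  unfolding cheb_shifted_angle[OF assms, symmetric] by (rule abs_cos_le_one)

lemma cheb_T_affine_poly: "\<exists>p. degree p \<le> k \<and> (\<forall>x. poly p x = cheb_T k (c * x + d))"
proof (induction k rule: induct_nat_012)
  case 0
  show ?case by (intro exI[of _ 1]) auto
next
  case 1
  show ?case by (intro exI[of _ "[:d, c:]"]) auto
next
  case (ge2 k)
  then obtain p q where p: "degree p \<le> k" "\<And>x. poly p x = cheb_T k (c * x + d)"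
    and q: "degree q \<le> Suc k" "\<And>x. poly q x = cheb_T (Suc k) (c * x + d)" by blast
  define r where "r = [:2 * d, 2 * c:] * q - p"
  have "degree ([:2 * d, 2 * c:] * q) \<le> 1 + Suc k"
    using q(1) by (intro order.trans[OF degree_mult_le] add_mono) auto
  hence "degree r \<le> Suc (Suc k)"
    unfolding r_def using p(1) by (intro degree_diff_le) auto
  moreover have "poly r x = cheb_T (Suc (Suc k)) (c * x + d)" for x
    by (simp add: r_def p(2) q(2) algebra_simps)
  ultimately show ?case by blast
qed

lemma cheb_shifted_poly: "\<exists>p. degree p \<le> k \<and> (\<forall>x. poly p x = cheb_shifted a b k x)"
  using cheb_T_affine_poly[of k "2 / (b - a)" "- ((b + a) / (b - a))"] by (simp add: cheb_shifted_def)

text \<open>The smoothing of a distribution with Chebyshev moments \<open>M k\<close>.\<close>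

definition moment_smooth :: "nat \<Rightarrow> real \<Rightarrow> real \<Rightarrow> (nat \<Rightarrow> real) \<Rightarrow> real \<Rightarrow> real" where
  "moment_smooth s a b M x = cheb_primitive 0 (cheb_angle a b x)
     + (\<Sum>k=1..s. jackson_coeff s k * (sqrt 2 * cheb_primitive k (cheb_angle a b x)) * M k)"

lemma moment_smooth_measurable [measurable]: "moment_smooth s a b M \<in> borel_measurable borel"
  unfolding moment_smooth_def[abs_def] by measurable

lemma smooth_step_eq_moment_smooth:
  assumes "a < b" "a \<le> l" "l \<le> b"
  shows "smooth_step s (cheb_angle a b l) (cheb_angle a b x) = moment_smooth s a b (\<lambda>k. cheb_shifted a b k l) x"
  unfolding smooth_step_def moment_smooth_def
  by (intro arg_cong2[of _ _ _ _ "(+)"] sum.cong refl)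
    (auto simp: cheb_primitive_def cheb_shifted_angle[OF assms])

lemma moment_smooth_average:
  assumes "(\<Sum>i\<in>I. w i) = 1"
  shows "(\<Sum>i\<in>I. w i * moment_smooth s a b (M i) x) = moment_smooth s a b (\<lambda>k. \<Sum>i\<in>I. w i * M i k) x"
proof -
  have "(\<Sum>i\<in>I. w i * moment_smooth s a b (M i) x) = (\<Sum>i\<in>I. w i) * cheb_primitive 0 (cheb_angle a b x)
      + (\<Sum>i\<in>I. \<Sum>k=1..s. jackson_coeff s k * (sqrt 2 * cheb_primitive k (cheb_angle a b x)) * (w i * M i k))"
    by (simp add: moment_smooth_def distrib_left sum.distrib sum_distrib_left sum_distrib_right mult_ac)
  also have "(\<Sum>i\<in>I. \<Sum>k=1..s. jackson_coeff s k * (sqrt 2 * cheb_primitive k (cheb_angle a b x)) * (w i * M i k))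
      = (\<Sum>k=1..s. \<Sum>i\<in>I. jackson_coeff s k * (sqrt 2 * cheb_primitive k (cheb_angle a b x)) * (w i * M i k))"
    by (rule sum.swap)
  also have "\<dots> = (\<Sum>k=1..s. jackson_coeff s k * (sqrt 2 * cheb_primitive k (cheb_angle a b x)) * (\<Sum>i\<in>I. w i * M i k))"
    by (simp add: sum_distrib_left)
  finally show ?thesis using assms by (simp add: moment_smooth_def)
qed

lemma harm_le_ln: "0 < n \<Longrightarrow> harm n \<le> ln (real n) + 1"
proof -
  assume "0 < n"
  then obtain k where n: "n = Suc k" by (cases n) auto
  have "harm (Suc k) - ln (real (Suc k)) \<le> harm (Suc 0) - ln (real (Suc 0))"
    using decseq_harm_diff_ln by (rule decseqD) simp
  thus ?thesis by (simp add: n harm_def)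
qed

text \<open>The sum of the bounds for the single moments is harmonic.\<close>

lemma moment_smooth_distance:
  assumes "a < b" "0 < s" and close: "\<And>k. k \<in> {1..s} \<Longrightarrow> \<bar>M k - M' k\<bar> \<le> t"
  shows "wasserstein (moment_smooth s a b M) (moment_smooth s a b M') \<le> ennreal (2 * (b - a) / pi * t * (ln s + 1))"
proof -
  have "0 \<le> t" using close[of 1] assms(2) by (simp add: order.trans[OF abs_ge_zero])
  define c where "c k = (b - a) * sqrt 2 / (real k * pi)" for k
  have c: "0 \<le> c k" for k using assms(1) by (simp add: c_def)
  have "wasserstein (moment_smooth s a b M) (moment_smooth s a b M')
      \<le> ennreal (\<Sum>k=1..s. \<bar>jackson_coeff s k * sqrt 2 * (M k - M' k)\<bar> * c k)"
  proof (rule wasserstein_linear_le)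
    fix k assume "k \<in> {1..s}"
    thus "(\<integral>\<^sup>+x. ennreal \<bar>cheb_primitive k (cheb_angle a b x)\<bar> \<partial>lborel) \<le> ennreal (c k)"
      unfolding c_def by (intro cheb_primitive_integral assms(1)) simp
  next
    fix x
    have "moment_smooth s a b M x - moment_smooth s a b M' x
        = (\<Sum>k=1..s. jackson_coeff s k * (sqrt 2 * cheb_primitive k (cheb_angle a b x)) * M k
            - jackson_coeff s k * (sqrt 2 * cheb_primitive k (cheb_angle a b x)) * M' k)"
      by (simp add: moment_smooth_def sum_subtractf)
    also have "\<dots> = (\<Sum>k=1..s. jackson_coeff s k * sqrt 2 * (M k - M' k) * cheb_primitive k (cheb_angle a b x))"
      by (intro sum.cong refl) (simp add: algebra_simps)
    finally show "moment_smooth s a b M x - moment_smooth s a b M' x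
        = (\<Sum>k=1..s. jackson_coeff s k * sqrt 2 * (M k - M' k) * cheb_primitive k (cheb_angle a b x))" .
  qed (use c in auto)
  also have "\<dots> \<le> ennreal (\<Sum>k=1..s. 2 * (b - a) / pi * t * (1 / real k))"
  proof (intro ennreal_leI sum_mono)
    fix k assume k: "k \<in> {1..s}"
    have "\<bar>jackson_coeff s k * sqrt 2 * (M k - M' k)\<bar> = \<bar>jackson_coeff s k\<bar> * sqrt 2 * \<bar>M k - M' k\<bar>"
      by (simp add: abs_mult)
    also have "\<dots> \<le> 1 * sqrt 2 * t"
      using abs_jackson_coeff_le_1[of k s] close[OF k] k by (intro mult_mono) auto
    finally have "\<bar>jackson_coeff s k * sqrt 2 * (M k - M' k)\<bar> * c k \<le> 1 * sqrt 2 * t * c k"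
      using c by (rule mult_right_mono)
    also have "\<dots> = (sqrt 2 * sqrt 2) * (b - a) / pi * t * (1 / real k)"
      by (simp only: c_def) (simp add: field_simps)
    finally show "\<bar>jackson_coeff s k * sqrt 2 * (M k - M' k)\<bar> * c k \<le> 2 * (b - a) / pi * t * (1 / real k)"
      by simp
  qed
  also have "(\<Sum>k=1..s. 2 * (b - a) / pi * t * (1 / real k)) = 2 * (b - a) / pi * t * harm s"
    unfolding sum_distrib_left[symmetric] by (simp add: harm_def inverse_eq_divide)
  also have "ennreal (2 * (b - a) / pi * t * harm s) \<le> ennreal (2 * (b - a) / pi * t * (ln s + 1))"
    using harm_le_ln[OF assms(2)] assms(1) \<open>0 \<le> t\<close> by (intro ennreal_leI mult_left_mono) auto
  finally show ?thesis .
qed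

lemma step_fun_measurable [measurable]: "step_fun n w lam \<in> borel_measurable borel"
  unfolding step_fun_def[abs_def] by measurable

context weighted_points begin

definition cheb_moment :: "nat \<Rightarrow> real" where
  "cheb_moment k = mean (cheb_shifted a b k)"

lemma moment_smooth_eq_mean:
  assumes "a < b"
  shows "moment_smooth s a b cheb_moment x = mean (\<lambda>l. smooth_step s (cheb_angle a b l) (cheb_angle a b x))"
proof -
  have "mean (\<lambda>l. smooth_step s (cheb_angle a b l) (cheb_angle a b x))
      = (\<Sum>i<n. w i * moment_smooth s a b (\<lambda>k. cheb_shifted a b k (lam i)) x)"
    unfolding mean_def using point_bounds
    by (intro sum.cong refl) (simp add: smooth_step_eq_moment_smooth[OF assms])
  also have "\<dots> = moment_smooth s a b cheb_moment x"
    unfolding cheb_moment_def mean_def by (rule moment_smooth_average[OF weight_sum])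
  finally show ?thesis by simp
qed

text \<open>The distance is convex, so point masses suffice.\<close>

lemma step_fun_smoothing_error:
  assumes "a < b" "0 < s"
  shows "wasserstein (step_fun n w lam) (moment_smooth s a b cheb_moment) \<le> ennreal ((b - a) / 2 * jackson_angle s)"
proof -
  have "wasserstein (\<lambda>x. \<Sum>i<n. w i * of_bool (lam i \<le> x))
      (\<lambda>x. \<Sum>i<n. w i * smooth_step s (cheb_angle a b (lam i)) (cheb_angle a b x))
      \<le> ennreal ((b - a) / 2 * jackson_angle s)"
  proof (rule wasserstein_average_le)
    show "0 \<le> (b - a) / 2 * jackson_angle s"
      using assms(1) by (simp add: jackson_angle_bounds less_imp_le)
    fix i assume "i \<in> {..<n}"
    thus "wasserstein (\<lambda>x. of_bool (lam i \<le> x)) (\<lambda>x. smooth_step s (cheb_angle a b (lam i)) (cheb_angle a b x))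
        \<le> ennreal ((b - a) / 2 * jackson_angle s)"
      unfolding wasserstein_def using point_bounds by (intro smoothed_indicator_error assms) auto
  qed (use weight_nonneg weight_sum in auto)
  also have "(\<lambda>x. \<Sum>i<n. w i * smooth_step s (cheb_angle a b (lam i)) (cheb_angle a b x))
      = moment_smooth s a b cheb_moment"
    by (intro ext) (simp add: moment_smooth_eq_mean[OF assms(1)] mean_def)
  also have "(\<lambda>x. \<Sum>i<n. w i * of_bool (lam i \<le> x)) = step_fun n w lam"
    by (intro ext) (simp add: step_fun_def)
  finally show ?thesis .
qed

lemma jackson_cheb_quad_step_fun:
  assumes "a < b"
  shows "jackson_cheb_quad s a b (step_fun n w lam) = moment_smooth s a b cheb_moment"
proof
  fix x
  define f where "f = damped_approx s (jackson_coeff s) (cheb_dist a b) (cheb_orthonormal a b) (indicator {..x})"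
  have [measurable]: "f \<in> borel_measurable borel"
    unfolding f_def damped_approx_def[abs_def] by measurable
  have "jackson_cheb_quad s a b (step_fun n w lam) x = mean f"
    unfolding jackson_cheb_quad_def damped_quad_def f_def[symmetric] by (rule dist_integral_eq_mean) measurable
  also have "\<dots> = mean (\<lambda>l. smooth_step s (cheb_angle a b l) (cheb_angle a b x))"
    unfolding mean_def
  proof (intro sum.cong refl)
    fix i assume "i \<in> {..<n}"
    hence "cheb_point a b (cheb_angle a b (lam i)) = lam i"
      using point_bounds assms by (intro cheb_point_angle) auto
    thus "w i * f (lam i) = w i * smooth_step s (cheb_angle a b (lam i)) (cheb_angle a b x)"
      using damped_approx_indicator[OF assms, of s x "cheb_angle a b (lam i)"] by (simp add: f_def)
  qed
  also have "\<dots> = moment_smooth s a b cheb_moment x"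
    by (rule moment_smooth_eq_mean[OF assms, symmetric])
  finally show "jackson_cheb_quad s a b (step_fun n w lam) x = moment_smooth s a b cheb_moment x" .
qed

lemma quadrature_error:
  assumes "a < b" "0 < s" "odd s \<and> Q = gauss_quad s \<or> Q = jackson_cheb_quad s a b"
  shows "Q (step_fun n w lam) \<in> borel_measurable borel"
    and "wasserstein (moment_smooth s a b cheb_moment) (Q (step_fun n w lam)) \<le> ennreal ((b - a) / 2 * jackson_angle s)"
proof -
  have "Q (step_fun n w lam) \<in> borel_measurable borel \<and>
    wasserstein (moment_smooth s a b cheb_moment) (Q (step_fun n w lam)) \<le> ennreal ((b - a) / 2 * jackson_angle s)"
    using assms(3)
  proof
    assume "odd s \<and> Q = gauss_quad s"
    then obtain N w' lam' where eq: "Q (step_fun n w lam) = step_fun N w' lam'"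
      and wp: "weighted_points N w' lam' a b"
      and exact: "\<And>q. degree q \<le> s \<Longrightarrow> (\<Sum>i<N. w' i * poly q (lam' i)) = mean (poly q)"
      using gauss_quad_step_fun[OF _ assms(1)] by metis
    interpret G: weighted_points N w' lam' a b by (rule wp)
    have "G.cheb_moment k = cheb_moment k" if k: "k \<in> {1..s}" for k
    proof -
      obtain p where p: "degree p \<le> k" "\<And>x. poly p x = cheb_shifted a b k x"
        using cheb_shifted_poly by blast
      hence "poly p = cheb_shifted a b k" by auto
      thus ?thesis
        using exact[of p] p(1) k by (simp add: G.cheb_moment_def cheb_moment_def G.mean_def)
    qed
    hence "moment_smooth s a b cheb_moment = moment_smooth s a b G.cheb_moment"
      by (auto simp: moment_smooth_def fun_eq_iff intro!: sum.cong)
    thus ?thesis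
      using G.step_fun_smoothing_error[OF assms(1,2)] wasserstein_commute by (simp add: eq)
  next
    assume "Q = jackson_cheb_quad s a b"
    thus ?thesis
      using jackson_cheb_quad_step_fun[OF assms(1)] by (simp add: wasserstein_def)
  qed
  thus "Q (step_fun n w lam) \<in> borel_measurable borel"
    and "wasserstein (moment_smooth s a b cheb_moment) (Q (step_fun n w lam)) \<le> ennreal ((b - a) / 2 * jackson_angle s)"
    by auto
qed

end

text \<open>The deterministic part of the theorem. The path from the spectral measure to the averaged quadrature goes through the
  smoothing of the spectral measure and the average of the smoothings of the weighted measures, which is the
  smoothing for the averaged moments.\<close>

theorem averaged_quadrature_error:
  fixes m s :: nat
  assumes ab: "a < b" and s: "0 < s" and m: "0 < m" and Q: "odd s \<and> Q = gauss_quad s \<or> Q = jackson_cheb_quad s a b"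
    and P: "weighted_points n p lam a b" and W: "\<And>l. l \<in> {1..m} \<Longrightarrow> weighted_points n (w l) lam a b"
    and close: "\<And>k. k \<in> {1..s} \<Longrightarrow>
      \<bar>(\<Sum>i<n. p i * cheb_shifted a b k (lam i))
        - (1 / real m) * (\<Sum>l=1..m. \<Sum>i<n. w l i * cheb_shifted a b k (lam i))\<bar> \<le> t"
  shows "wasserstein (step_fun n p lam) (\<lambda>x. (1 / real m) * (\<Sum>l=1..m. Q (step_fun n (w l) lam) x))
    \<le> ennreal ((b - a) * (jackson_angle s + 2 / pi * t * (ln (real s) + 1)))"
proof -
  define c where "c = (b - a) / 2 * jackson_angle s"
  have c: "0 \<le> c" using ab by (simp add: c_def jackson_angle_bounds less_imp_le)
  define N where "N l k = (\<Sum>i<n. w l i * cheb_shifted a b k (lam i))" for l k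
  define N' where "N' k = (\<Sum>l=1..m. (1 / real m) * N l k)" for k
  interpret P: weighted_points n p lam a b by (rule P)
  have N: "weighted_points.cheb_moment n (w l) lam a b = N l" if "l \<in> {1..m}" for l
    using weighted_points.cheb_moment_def[OF W[OF that]] weighted_points.mean_def[OF W[OF that]]
    by (auto simp: N_def fun_eq_iff)
  have Q_meas: "Q (step_fun n (w l) lam) \<in> borel_measurable borel" if "l \<in> {1..m}" for l
    by (rule weighted_points.quadrature_error(1)[OF W[OF that] ab s Q])
  have "0 \<le> t" using close[of 1] s by (simp add: order.trans[OF abs_ge_zero])
  have 1: "wasserstein (step_fun n p lam) (moment_smooth s a b P.cheb_moment) \<le> ennreal c"
    unfolding c_def by (rule P.step_fun_smoothing_error[OF ab s])
  have 2: "wasserstein (moment_smooth s a b P.cheb_moment) (moment_smooth s a b N')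
      \<le> ennreal (2 * (b - a) / pi * t * (ln (real s) + 1))"
  proof (rule moment_smooth_distance[OF ab s])
    fix k assume "k \<in> {1..s}"
    thus "\<bar>P.cheb_moment k - N' k\<bar> \<le> t"
      using close[of k] by (simp add: P.cheb_moment_def P.mean_def N'_def N_def sum_distrib_left)
  qed
  have 3: "wasserstein (\<lambda>x. \<Sum>l=1..m. (1 / real m) * moment_smooth s a b (N l) x)
      (\<lambda>x. \<Sum>l=1..m. (1 / real m) * Q (step_fun n (w l) lam) x) \<le> ennreal c"
  proof (rule wasserstein_average_le)
    fix l assume l: "l \<in> {1..m}"
    show "wasserstein (moment_smooth s a b (N l)) (Q (step_fun n (w l) lam)) \<le> ennreal c"
      using weighted_points.quadrature_error(2)[OF W[OF l] ab s Q] unfolding N[OF l] c_def .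
  qed (use c m Q_meas in auto)
  have avg: "(\<lambda>x. \<Sum>l=1..m. (1 / real m) * moment_smooth s a b (N l) x) = moment_smooth s a b N'"
    unfolding N'_def using m by (intro ext moment_smooth_average) auto
  define G where "G x = (\<Sum>l=1..m. (1 / real m) * Q (step_fun n (w l) lam) x)" for x
  have [measurable]: "G \<in> borel_measurable borel"
    unfolding G_def[abs_def] using Q_meas by measurable
  have "wasserstein (step_fun n p lam) G
      \<le> wasserstein (step_fun n p lam) (moment_smooth s a b P.cheb_moment)
        + wasserstein (moment_smooth s a b P.cheb_moment) G"
    by (rule wasserstein_triangle) measurable
  also have "\<dots> \<le> wasserstein (step_fun n p lam) (moment_smooth s a b P.cheb_moment)
        + (wasserstein (moment_smooth s a b P.cheb_moment) (moment_smooth s a b N')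
        + wasserstein (moment_smooth s a b N') G)"
    by (intro add_left_mono wasserstein_triangle) measurable
  also have "\<dots> \<le> ennreal c + (ennreal (2 * (b - a) / pi * t * (ln (real s) + 1)) + ennreal c)"
    using 1 2 3 unfolding avg G_def[abs_def] by (intro add_mono)
  also have "\<dots> = ennreal (c + (2 * (b - a) / pi * t * (ln (real s) + 1) + c))"
    using c \<open>0 \<le> t\<close> ab s by (simp add: ennreal_plus[symmetric] del: ennreal_plus)
  also have "c + (2 * (b - a) / pi * t * (ln (real s) + 1) + c)
      = (b - a) * (jackson_angle s + 2 / pi * t * (ln (real s) + 1))"
    by (simp add: c_def algebra_simps)
  finally show ?thesis by (simp add: G_def[abs_def] sum_distrib_left)
qed

section \<open>The spectral theorem for Hermitian matrices\<close>

lemma cscalar_prod_eq_sum: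
  fixes x y :: "complex vec"
  assumes "y \<in> carrier_vec n"
  shows "x \<bullet>c y = (\<Sum>i<n. x $ i * cnj (y $ i))"
  using assms by (auto simp: scalar_prod_def conjugate_complex_def atLeast0LessThan intro!: sum.cong)

lemma mult_mat_vec_eq_sum:
  fixes A :: "complex mat"
  assumes "A \<in> carrier_mat n n" "w \<in> carrier_vec n" "r < n"
  shows "(A *\<^sub>v w) $ r = (\<Sum>c<n. A $$ (r, c) * w $ c)"
  using assms by (auto simp: scalar_prod_def atLeast0LessThan intro!: sum.cong)

lemma cscalar_prod_swap:
  fixes x y :: "complex vec"
  assumes "x \<in> carrier_vec n" "y \<in> carrier_vec n"
  shows "y \<bullet>c x = cnj (x \<bullet>c y)"
  unfolding cscalar_prod_eq_sum[OF assms(1)] cscalar_prod_eq_sum[OF assms(2)]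
  by (simp add: mult.commute)

lemma cscalar_prod_self:
  fixes x :: "complex vec"
  assumes "x \<in> carrier_vec n"
  shows "x \<bullet>c x = complex_of_real ((l2_norm x)\<^sup>2)"
proof -
  have "(l2_norm x)\<^sup>2 = (\<Sum>i<n. (cmod (x $ i))\<^sup>2)"
    using assms by (simp add: l2_norm_def sum_nonneg)
  thus ?thesis
    by (simp only: cscalar_prod_eq_sum[OF assms] of_real_sum complex_norm_square)
qed

lemma l2_norm_nonneg: "0 \<le> l2_norm x"
  by (simp add: l2_norm_def sum_nonneg)

lemma l2_norm_eq_0_iff:
  assumes "x \<in> carrier_vec n"
  shows "l2_norm x = 0 \<longleftrightarrow> x = 0\<^sub>v n"
  using assms by (auto simp: l2_norm_def sum_nonneg_eq_0_iff intro!: eq_vecI)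

definition orthonormal_family :: "nat \<Rightarrow> nat \<Rightarrow> (nat \<Rightarrow> complex vec) \<Rightarrow> bool" where
  "orthonormal_family n k u \<longleftrightarrow>
    (\<forall>i<k. u i \<in> carrier_vec n) \<and> (\<forall>i<k. \<forall>j<k. u i \<bullet>c u j = (if i = j then 1 else 0))"

text \<open>The columns form a square matrix with a left inverse, which is also a right inverse.\<close>

lemma orthonormal_family_complete:
  assumes "orthonormal_family n n u" "r < n" "c < n"
  shows "(\<Sum>i<n. u i $ r * cnj (u i $ c)) = (if r = c then 1 else 0)"
proof -
  define U V where "U = mat n n (\<lambda>(i, c). cnj (u i $ c))" and "V = mat n n (\<lambda>(r, j). u j $ r)"
  have carr: "U \<in> carrier_mat n n" "V \<in> carrier_mat n n" by (auto simp: U_def V_def)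
  have "U * V = 1\<^sub>m n"
  proof (rule eq_matI)
    fix i j assume "i < dim_row (1\<^sub>m n)" "j < dim_col (1\<^sub>m n)"
    hence ij: "i < n" "j < n" by auto
    have "(U * V) $$ (i, j) = (\<Sum>r<n. u j $ r * cnj (u i $ r))"
      using ij by (auto simp: U_def V_def scalar_prod_def atLeast0LessThan intro!: sum.cong)
    also have "\<dots> = u j \<bullet>c u i"
      using assms(1) ij by (intro cscalar_prod_eq_sum[symmetric]) (auto simp: orthonormal_family_def)
    also have "\<dots> = 1\<^sub>m n $$ (i, j)"
      using assms(1) ij by (auto simp: orthonormal_family_def)
    finally show "(U * V) $$ (i, j) = 1\<^sub>m n $$ (i, j)" .
  qed (auto simp: U_def V_def)
  hence "V * U = 1\<^sub>m n"
    by (rule mat_mult_left_right_inverse[OF carr])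
  hence "(V * U) $$ (r, c) = (if r = c then 1 else 0)"
    using assms by simp
  thus ?thesis
    using assms by (auto simp: U_def V_def scalar_prod_def atLeast0LessThan)
qed

lemma mat_trace_comm:
  fixes X Y :: "complex mat"
  assumes "X \<in> carrier_mat n n" "Y \<in> carrier_mat n n"
  shows "mat_trace (X * Y) = mat_trace (Y * X)"
proof -
  have "mat_trace (X * Y) = (\<Sum>i<n. \<Sum>j<n. X $$ (i, j) * Y $$ (j, i))"
    using assms by (auto simp: mat_trace_def scalar_prod_def atLeast0LessThan intro!: sum.cong)
  also have "\<dots> = (\<Sum>j<n. \<Sum>i<n. Y $$ (j, i) * X $$ (i, j))"
    by (subst sum.swap) (simp add: mult.commute)
  also have "\<dots> = mat_trace (Y * X)"
    using assms by (auto simp: mat_trace_def scalar_prod_def atLeast0LessThan intro!: sum.cong)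
  finally show ?thesis .
qed

text \<open>Schur's triangular form.\<close>

lemma mat_trace_eq_sum_eigenvalues:
  fixes A :: "complex mat"
  assumes A: "A \<in> carrier_mat n n"
  obtains es where "length es = n" "\<And>e. e \<in> set es \<Longrightarrow> eigenvalue A e" "mat_trace A = sum_list es"
proof -
  obtain es where es: "char_poly A = (\<Prod>e\<leftarrow>es. [:- e, 1:])" "length es = n"
    using char_poly_factorized[OF A] by blast
  obtain B P Q where BPQ: "schur_decomposition A es = (B, P, Q)" by (metis prod_cases3)
  have wit: "similar_mat_wit A B P Q" and diag: "diag_mat B = es"
    using schur_decomposition[OF A es(1) BPQ] by auto
  from similar_mat_witD2[OF A wit]
  have carr: "B \<in> carrier_mat n n" "P \<in> carrier_mat n n" "Q \<in> carrier_mat n n"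
    and AB: "A = P * B * Q" and QP: "Q * P = 1\<^sub>m n"
    by auto
  have "mat_trace A = mat_trace (Q * (P * B))"
    unfolding AB using carr by (intro mat_trace_comm) auto
  also have "Q * (P * B) = B"
    using carr QP by (simp add: assoc_mult_mat[symmetric])
  also have "mat_trace B = sum_list (diag_mat B)"
    using carr by (simp add: mat_trace_def diag_mat_def sum_list_sum_nth atLeast0LessThan)
  finally have "mat_trace A = sum_list es" by (simp add: diag)
  moreover have "eigenvalue A e" if "e \<in> set es" for e
  proof -
    have "poly (char_poly A) e = (\<Prod>x\<leftarrow>es. e - x)"
      by (simp add: es poly_prod_list o_def)
    also have "\<dots> = 0" using that by (simp add: prod_list_zero_iff)
    finally show ?thesis using eigenvalue_root_char_poly[OF A] by blast
  qed
  ultimately show thesis using es(2) that by blast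
qed

lemma hermitian_mat_entry:
  assumes "A \<in> carrier_mat n n" "hermitian_mat A" "r < n" "c < n"
  shows "A $$ (c, r) = cnj (A $$ (r, c))"
proof -
  have "A $$ (c, r) = mat_adjoint A $$ (c, r)"
    using assms by (simp add: hermitian_mat_def)
  also have "\<dots> = cnj (A $$ (r, c))"
    using assms by (auto simp: mat_adjoint_def mat_of_rows_def conjugate_complex_def)
  finally show ?thesis .
qed

lemma hermitian_mat_cscalar_prod:
  assumes "A \<in> carrier_mat n n" "hermitian_mat A" "x \<in> carrier_vec n" "y \<in> carrier_vec n"
  shows "(A *\<^sub>v x) \<bullet>c y = x \<bullet>c (A *\<^sub>v y)"
proof -
  have "(A *\<^sub>v x) \<bullet>c y = (\<Sum>r<n. (A *\<^sub>v x) $ r * cnj (y $ r))"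
    using assms by (intro cscalar_prod_eq_sum) auto
  also have "\<dots> = (\<Sum>r<n. \<Sum>c<n. A $$ (r, c) * x $ c * cnj (y $ r))"
    using assms by (intro sum.cong refl, subst mult_mat_vec_eq_sum) (auto simp: sum_distrib_right)
  also have "\<dots> = (\<Sum>c<n. \<Sum>r<n. A $$ (r, c) * x $ c * cnj (y $ r))"
    by (rule sum.swap)
  also have "\<dots> = (\<Sum>c<n. \<Sum>r<n. x $ c * cnj (A $$ (c, r) * y $ r))"
  proof (intro sum.cong refl)
    fix r c assume "r \<in> {..<n}" "c \<in> {..<n}"
    hence "A $$ (r, c) = cnj (A $$ (c, r))"
      using hermitian_mat_entry[OF assms(1,2), of c r] by simp
    thus "A $$ (r, c) * x $ c * cnj (y $ r) = x $ c * cnj (A $$ (c, r) * y $ r)" by simp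
  qed
  also have "\<dots> = (\<Sum>c<n. x $ c * cnj ((A *\<^sub>v y) $ c))"
    using assms by (intro sum.cong refl, subst mult_mat_vec_eq_sum) (auto simp: sum_distrib_left)
  also have "\<dots> = x \<bullet>c (A *\<^sub>v y)"
    using assms by (intro cscalar_prod_eq_sum[symmetric]) auto
  finally show ?thesis .
qed

lemma hermitian_mat_eigenvalue_real:
  assumes "A \<in> carrier_mat n n" "hermitian_mat A" "w \<in> carrier_vec n" "w \<noteq> 0\<^sub>v n"
    and "A *\<^sub>v w = e \<cdot>\<^sub>v w"
  shows "complex_of_real (Re e) = e"
proof -
  have "e * (w \<bullet>c w) = (A *\<^sub>v w) \<bullet>c w"
    using assms by simp
  also have "\<dots> = w \<bullet>c (A *\<^sub>v w)"
    using assms by (intro hermitian_mat_cscalar_prod)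
  also have "\<dots> = cnj e * (w \<bullet>c w)"
    using assms by (simp add: conjugate_smult_vec conjugate_complex_def)
  finally have "e = cnj e \<or> w \<bullet>c w = 0" by auto
  moreover have "w \<bullet>c w \<noteq> 0"
    using assms cscalar_prod_self[of w n] l2_norm_eq_0_iff[of w n] by simp
  ultimately have "e = cnj e" by blast
  thus ?thesis by (simp add: complex_eq_iff)
qed

text \<open>The functional calculus: if the vectors \<open>u i\<close> are orthonormal eigenvectors of a Hermitian matrix for the
  eigenvalues \<open>\<lambda>\<^sub>i\<close>, then \<open>g i = f(\<lambda>\<^sub>i)\<close> gives the matrix \<open>f(A)\<close> when \<open>k = n\<close>.\<close>

definition spectral_mat :: "nat \<Rightarrow> nat \<Rightarrow> (nat \<Rightarrow> complex vec) \<Rightarrow> (nat \<Rightarrow> complex) \<Rightarrow> complex mat" where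
  "spectral_mat n k u g = mat n n (\<lambda>(r, c). \<Sum>i<k. g i * u i $ r * cnj (u i $ c))"

lemma spectral_mat_carrier: "spectral_mat n k u g \<in> carrier_mat n n"
  by (simp add: spectral_mat_def)

lemma orthonormal_family_carrier: "orthonormal_family n k u \<Longrightarrow> i < k \<Longrightarrow> u i \<in> carrier_vec n"
  by (simp add: orthonormal_family_def)

lemma orthonormal_family_cscalar_prod:
  "orthonormal_family n k u \<Longrightarrow> i < k \<Longrightarrow> j < k \<Longrightarrow> u i \<bullet>c u j = (if i = j then 1 else 0)"
  by (simp add: orthonormal_family_def)

lemma spectral_mat_mult_vec:
  assumes orth: "orthonormal_family n k u" and w: "w \<in> carrier_vec n" and r: "r < n"
  shows "(spectral_mat n k u g *\<^sub>v w) $ r = (\<Sum>i<k. g i * (w \<bullet>c u i) * u i $ r)"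
proof -
  have "(spectral_mat n k u g *\<^sub>v w) $ r = (\<Sum>c<n. \<Sum>i<k. g i * u i $ r * cnj (u i $ c) * w $ c)"
    using r by (subst mult_mat_vec_eq_sum[OF spectral_mat_carrier w r])
      (auto simp: spectral_mat_def sum_distrib_right)
  also have "\<dots> = (\<Sum>i<k. \<Sum>c<n. g i * u i $ r * cnj (u i $ c) * w $ c)"
    by (rule sum.swap)
  also have "\<dots> = (\<Sum>i<k. g i * (\<Sum>c<n. w $ c * cnj (u i $ c)) * u i $ r)"
    by (intro sum.cong refl) (simp add: sum_distrib_left sum_distrib_right algebra_simps)
  also have "\<dots> = (\<Sum>i<k. g i * (w \<bullet>c u i) * u i $ r)"
    by (intro sum.cong refl) (simp add: cscalar_prod_eq_sum[OF orthonormal_family_carrier[OF orth]])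
  finally show ?thesis .
qed

lemma spectral_mat_cscalar_prod:
  assumes orth: "orthonormal_family n k u" and w: "w \<in> carrier_vec n" and x: "x \<in> carrier_vec n"
  shows "(spectral_mat n k u g *\<^sub>v w) \<bullet>c x = (\<Sum>i<k. g i * (w \<bullet>c u i) * (u i \<bullet>c x))"
proof -
  have "(spectral_mat n k u g *\<^sub>v w) \<bullet>c x
      = (\<Sum>r<n. \<Sum>i<k. g i * (w \<bullet>c u i) * u i $ r * cnj (x $ r))"
    by (subst cscalar_prod_eq_sum[OF x])
      (simp add: spectral_mat_mult_vec[OF orth w] sum_distrib_right)
  also have "\<dots> = (\<Sum>i<k. \<Sum>r<n. g i * (w \<bullet>c u i) * u i $ r * cnj (x $ r))"
    by (rule sum.swap)
  also have "\<dots> = (\<Sum>i<k. g i * (w \<bullet>c u i) * (u i \<bullet>c x))"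
    by (intro sum.cong refl) (simp add: cscalar_prod_eq_sum[OF x] sum_distrib_left mult.assoc)
  finally show ?thesis .
qed

lemma spectral_mat_cscalar_prod_basis:
  assumes orth: "orthonormal_family n k u" and w: "w \<in> carrier_vec n" and i: "i < k"
  shows "(spectral_mat n k u g *\<^sub>v w) \<bullet>c u i = g i * (w \<bullet>c u i)"
proof -
  have "(spectral_mat n k u g *\<^sub>v w) \<bullet>c u i = (\<Sum>j<k. g j * (w \<bullet>c u j) * (u j \<bullet>c u i))"
    by (rule spectral_mat_cscalar_prod[OF orth w orthonormal_family_carrier[OF orth i]])
  also have "\<dots> = (\<Sum>j<k. if j = i then g i * (w \<bullet>c u i) else 0)"
    using orthonormal_family_cscalar_prod[OF orth] i by (intro sum.cong refl) auto
  finally show ?thesis using i by simp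
qed

lemma mat_trace_spectral_mat:
  assumes orth: "orthonormal_family n k u"
  shows "mat_trace (spectral_mat n k u g) = (\<Sum>i<k. g i)"
proof -
  have "mat_trace (spectral_mat n k u g) = (\<Sum>r<n. \<Sum>i<k. g i * u i $ r * cnj (u i $ r))"
    by (simp add: mat_trace_def spectral_mat_def)
  also have "\<dots> = (\<Sum>i<k. \<Sum>r<n. g i * u i $ r * cnj (u i $ r))"
    by (rule sum.swap)
  also have "\<dots> = (\<Sum>i<k. g i * (u i \<bullet>c u i))"
    by (intro sum.cong refl)
      (simp add: cscalar_prod_eq_sum[OF orthonormal_family_carrier[OF orth]] sum_distrib_left mult.assoc)
  also have "\<dots> = (\<Sum>i<k. g i)"
    using orthonormal_family_cscalar_prod[OF orth] by simp
  finally show ?thesis .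
qed

definition eigen_family :: "complex mat \<Rightarrow> nat \<Rightarrow> nat \<Rightarrow> (nat \<Rightarrow> real) \<Rightarrow> (nat \<Rightarrow> complex vec) \<Rightarrow> bool" where
  "eigen_family A n k lam u \<longleftrightarrow> orthonormal_family n k u \<and>
    (\<forall>i<k. A *\<^sub>v u i = complex_of_real (lam i) \<cdot>\<^sub>v u i)"

text \<open>Replacing the known eigenvalues by a common value \<open>c0\<close> changes \<open>A\<close> only on the span of the known eigenvectors. Eigenvectors
  of the new matrix for eigenvalues other than \<open>c0\<close> are orthogonal to that span, hence eigenvectors of \<open>A\<close>. The trace shows that
  such an eigenvalue exists if \<open>c0\<close> is chosen to prevent the trace from being \<open>n c0\<close>.\<close>

lemma eigen_family_extend:
  assumes A: "A \<in> carrier_mat n n" "hermitian_mat A" and fam: "eigen_family A n k lam u" and "k < n"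
  obtains e w where "w \<in> carrier_vec n" "w \<noteq> 0\<^sub>v n" "A *\<^sub>v w = e \<cdot>\<^sub>v w" "\<And>i. i < k \<Longrightarrow> w \<bullet>c u i = 0"
proof -
  have orth: "orthonormal_family n k u"
    and ev: "\<And>i. i < k \<Longrightarrow> A *\<^sub>v u i = complex_of_real (lam i) \<cdot>\<^sub>v u i"
    using fam by (auto simp: eigen_family_def)
  note u = orthonormal_family_carrier[OF orth]
  \<comment> \<open>The quotient is the only value for which the modified matrix could have trace \<open>n c0\<close>; adding \<open>1\<close> avoids it.\<close>
  define c0 where "c0 = (mat_trace A - (\<Sum>i<k. complex_of_real (lam i))) / of_nat (n - k) + 1"
  define R where "R = spectral_mat n k u (\<lambda>i. c0 - complex_of_real (lam i))"
  have R: "R \<in> carrier_mat n n" unfolding R_def by (rule spectral_mat_carrier)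
  have AR: "A + R \<in> carrier_mat n n" using A R by simp
  have trace: "mat_trace (A + R) = mat_trace A + (\<Sum>i<k. c0 - complex_of_real (lam i))"
  proof -
    have "mat_trace (A + R) = mat_trace A + mat_trace R"
      using A R by (simp add: mat_trace_def sum.distrib)
    thus ?thesis by (simp only: R_def mat_trace_spectral_mat[OF orth])
  qed
  have "\<exists>e. eigenvalue (A + R) e \<and> e \<noteq> c0"
  proof (rule ccontr)
    assume all: "\<not> ?thesis"
    obtain es where es: "length es = n" "\<And>e. e \<in> set es \<Longrightarrow> eigenvalue (A + R) e"
        "mat_trace (A + R) = sum_list es"
      using mat_trace_eq_sum_eigenvalues[OF AR] by blast
    have "es = replicate n c0"
      using es all by (intro replicate_eqI) auto
    hence "mat_trace (A + R) = of_nat n * c0"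
      using es by (simp add: sum_list_replicate)
    hence "of_nat (n - k) * c0 = mat_trace A - (\<Sum>i<k. complex_of_real (lam i))"
      unfolding trace using \<open>k < n\<close> by (simp add: sum_subtractf of_nat_diff algebra_simps)
    moreover have "of_nat (n - k) * c0
        = mat_trace A - (\<Sum>i<k. complex_of_real (lam i)) + of_nat (n - k)"
      using \<open>k < n\<close> by (simp add: c0_def distrib_left)
    ultimately show False using \<open>k < n\<close> by simp
  qed
  then obtain e w where e: "e \<noteq> c0" and w: "w \<in> carrier_vec n" "w \<noteq> 0\<^sub>v n"
    and eq: "(A + R) *\<^sub>v w = e \<cdot>\<^sub>v w"
    using AR unfolding eigenvalue_def eigenvector_def by auto
  have split: "(A + R) *\<^sub>v w = A *\<^sub>v w + R *\<^sub>v w"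
    using A R w by (intro add_mult_distrib_mat_vec) auto
  have zero: "w \<bullet>c u i = 0" if i: "i < k" for i
  proof -
    have Rwi: "(R *\<^sub>v w) \<bullet>c u i = (c0 - complex_of_real (lam i)) * (w \<bullet>c u i)"
      unfolding R_def by (rule spectral_mat_cscalar_prod_basis[OF orth w(1) i])
    have Awi: "(A *\<^sub>v w) \<bullet>c u i = complex_of_real (lam i) * (w \<bullet>c u i)"
      using A w u[OF i] ev[OF i]
      by (simp add: hermitian_mat_cscalar_prod[OF A w(1) u[OF i]] conjugate_smult_vec conjugate_complex_def)
    have "e * (w \<bullet>c u i) = ((A + R) *\<^sub>v w) \<bullet>c u i"
      using w u[OF i] by (simp add: eq)
    also have "\<dots> = (A *\<^sub>v w) \<bullet>c u i + (R *\<^sub>v w) \<bullet>c u i"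
      unfolding split using A R w u[OF i] by (intro add_scalar_prod_distrib[where n = n]) auto
    also have "\<dots> = c0 * (w \<bullet>c u i)"
      by (simp add: Rwi Awi algebra_simps)
    finally show ?thesis using e by simp
  qed
  have "R *\<^sub>v w = 0\<^sub>v n"
    using R zero by (intro eq_vecI)
      (auto simp: R_def spectral_mat_mult_vec[OF orth w(1)] simp del: index_mult_mat_vec)
  hence "A *\<^sub>v w = e \<cdot>\<^sub>v w"
    using eq A w by (simp add: split)
  thus thesis using that w zero by blast
qed

lemma eigen_family_exists:
  assumes A: "A \<in> carrier_mat n n" "hermitian_mat A"
  shows "k \<le> n \<Longrightarrow> \<exists>lam u. eigen_family A n k lam u"
proof (induction k)
  case (Suc k)
  then obtain lam u where fam: "eigen_family A n k lam u" by auto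
  from eigen_family_extend[OF A fam] Suc.prems
  obtain e w where w: "w \<in> carrier_vec n" "w \<noteq> 0\<^sub>v n" and eq: "A *\<^sub>v w = e \<cdot>\<^sub>v w"
    and orth: "\<And>i. i < k \<Longrightarrow> w \<bullet>c u i = 0"
    by (metis Suc_le_lessD)
  define N w' where "N = l2_norm w" and "w' = complex_of_real (1 / N) \<cdot>\<^sub>v w"
  have "N \<noteq> 0" using w l2_norm_eq_0_iff by (simp add: N_def)
  have w': "w' \<in> carrier_vec n" using w by (simp add: w'_def)
  have u: "u i \<in> carrier_vec n" if "i < k" for i
    using fam that by (auto simp: eigen_family_def orthonormal_family_def)
  have self: "w' \<bullet>c w' = 1"
    using w \<open>N \<noteq> 0\<close> cscalar_prod_self[OF w(1)]
    by (simp add: w'_def conjugate_smult_vec conjugate_complex_def N_def power2_eq_square)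
  have left: "w' \<bullet>c u i = 0" if "i < k" for i
    using w u[OF that] orth[OF that] by (simp add: w'_def)
  have right: "u i \<bullet>c w' = 0" if "i < k" for i
    using cscalar_prod_swap[OF w' u[OF that]] left[OF that] by simp
  have "A *\<^sub>v w' = complex_of_real (Re e) \<cdot>\<^sub>v w'"
    using A w eq hermitian_mat_eigenvalue_real[OF A w eq]
    by (simp add: w'_def mult_mat_vec smult_smult_assoc mult.commute)
  hence "eigen_family A n (Suc k) (lam(k := Re e)) (u(k := w'))"
    using fam w' self left right
    by (auto simp: eigen_family_def orthonormal_family_def less_Suc_eq)
  thus ?case by blast
next
  case 0
  have "eigen_family A n 0 (\<lambda>_. 0) (\<lambda>_. 0\<^sub>v n)"
    by (simp add: eigen_family_def orthonormal_family_def)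
  thus ?case by blast
qed

lemma is_spectral_decomp_iff:
  assumes "A \<in> carrier_mat n n"
  shows "is_spectral_decomp A lam u \<longleftrightarrow> orthonormal_family n n u \<and> A = spectral_mat n n u (\<lambda>i. complex_of_real (lam i))"
  using assms by (auto simp: is_spectral_decomp_def orthonormal_family_def spectral_mat_def)

theorem hermitian_spectral_decomp:
  assumes A: "A \<in> carrier_mat n n" "hermitian_mat A"
  shows "\<exists>lam u. is_spectral_decomp A lam u"
proof -
  obtain lam u where fam: "eigen_family A n n lam u"
    using eigen_family_exists[OF A order.refl] by blast
  hence orth: "orthonormal_family n n u"
    and ev: "\<And>i. i < n \<Longrightarrow> A *\<^sub>v u i = complex_of_real (lam i) \<cdot>\<^sub>v u i"
    by (auto simp: eigen_family_def)
  have u: "u i \<in> carrier_vec n" if "i < n" for i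
    using orth that by (auto simp: orthonormal_family_def)
  have "A = spectral_mat n n u (\<lambda>i. complex_of_real (lam i))"
  proof (rule eq_matI)
    fix r c assume "r < dim_row (spectral_mat n n u (\<lambda>i. complex_of_real (lam i)))" "c < dim_col (spectral_mat n n u (\<lambda>i. complex_of_real (lam i)))"
    hence rc: "r < n" "c < n" by (auto simp: spectral_mat_def)
    have "A $$ (r, c) = (\<Sum>s<n. A $$ (r, s) * (if s = c then 1 else 0))"
      using rc by (simp add: if_distrib cong: if_cong)
    also have "\<dots> = (\<Sum>s<n. A $$ (r, s) * (\<Sum>i<n. u i $ s * cnj (u i $ c)))"
      using orthonormal_family_complete[OF orth] rc by (intro sum.cong refl) auto
    also have "\<dots> = (\<Sum>s<n. \<Sum>i<n. A $$ (r, s) * u i $ s * cnj (u i $ c))"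
      by (simp add: sum_distrib_left mult.assoc)
    also have "\<dots> = (\<Sum>i<n. \<Sum>s<n. A $$ (r, s) * u i $ s * cnj (u i $ c))"
      by (rule sum.swap)
    also have "\<dots> = (\<Sum>i<n. (A *\<^sub>v u i) $ r * cnj (u i $ c))"
      by (intro sum.cong refl, subst mult_mat_vec_eq_sum[OF A(1) u]) (auto simp: rc sum_distrib_right)
    also have "\<dots> = (\<Sum>i<n. complex_of_real (lam i) * u i $ r * cnj (u i $ c))"
      using u rc by (intro sum.cong refl) (simp add: ev carrier_vecD[OF u])
    also have "\<dots> = spectral_mat n n u (\<lambda>i. complex_of_real (lam i)) $$ (r, c)"
      using rc by (simp add: spectral_mat_def)
    finally show "A $$ (r, c) = spectral_mat n n u (\<lambda>i. complex_of_real (lam i)) $$ (r, c)" .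
  qed (use A in \<open>auto simp: spectral_mat_def\<close>)
  thus ?thesis using orth is_spectral_decomp_iff[OF A(1)] by blast
qed

section \<open>Matrices diagonal in an orthonormal basis\<close>

lemma spectral_mat_one:
  assumes "orthonormal_family n n u"
  shows "spectral_mat n n u (\<lambda>_. 1) = 1\<^sub>m n"
  using orthonormal_family_complete[OF assms] by (intro eq_matI) (auto simp: spectral_mat_def)

lemma cmod_cscalar_prod_commute:
  assumes "x \<in> carrier_vec n" "y \<in> carrier_vec n"
  shows "cmod (y \<bullet>c x) = cmod (x \<bullet>c y)"
  by (simp add: cscalar_prod_swap[OF assms])

lemma sesq_form_spectral_mat:
  assumes orth: "orthonormal_family n n u" and w: "w \<in> carrier_vec n"
  shows "sesq_form (spectral_mat n n u g) w = (\<Sum>i<n. g i * complex_of_real ((cmod (u i \<bullet>c w))\<^sup>2))"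
  unfolding sesq_form_def spectral_mat_cscalar_prod[OF orth w w]
proof (intro sum.cong refl)
  fix i assume "i \<in> {..<n}"
  hence u: "u i \<in> carrier_vec n" using orthonormal_family_carrier[OF orth] by simp
  show "g i * (w \<bullet>c u i) * (u i \<bullet>c w) = g i * complex_of_real ((cmod (u i \<bullet>c w))\<^sup>2)"
    unfolding cscalar_prod_swap[OF u w] complex_norm_square by simp
qed

lemma parseval:
  assumes orth: "orthonormal_family n n u" and w: "w \<in> carrier_vec n"
  shows "(\<Sum>i<n. (cmod (u i \<bullet>c w))\<^sup>2) = (l2_norm w)\<^sup>2"
proof -
  have "complex_of_real (\<Sum>i<n. (cmod (u i \<bullet>c w))\<^sup>2) = sesq_form (spectral_mat n n u (\<lambda>_. 1)) w"
    by (simp add: sesq_form_spectral_mat[OF orth w])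
  also have "\<dots> = complex_of_real ((l2_norm w)\<^sup>2)"
    using w by (simp add: spectral_mat_one[OF orth] sesq_form_def cscalar_prod_self[OF w])
  finally show ?thesis by (simp only: of_real_eq_iff)
qed

lemma l2_norm_spectral_mat:
  assumes orth: "orthonormal_family n n u" and w: "w \<in> carrier_vec n"
  shows "(l2_norm (spectral_mat n n u g *\<^sub>v w))\<^sup>2 = (\<Sum>i<n. (cmod (g i))\<^sup>2 * (cmod (u i \<bullet>c w))\<^sup>2)"
proof -
  define y where "y = spectral_mat n n u g *\<^sub>v w"
  have y: "y \<in> carrier_vec n"
    using spectral_mat_carrier[of n n u g] w unfolding y_def by (rule mult_mat_vec_carrier)
  have "(l2_norm y)\<^sup>2 = (\<Sum>i<n. (cmod (y \<bullet>c u i))\<^sup>2)"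
    unfolding parseval[OF orth y, symmetric]
    using orthonormal_family_carrier[OF orth] by (intro sum.cong refl) (simp add: cmod_cscalar_prod_commute[OF y])
  also have "\<dots> = (\<Sum>i<n. (cmod (g i * (w \<bullet>c u i)))\<^sup>2)"
    unfolding y_def by (intro sum.cong refl) (simp add: spectral_mat_cscalar_prod_basis[OF orth w])
  also have "\<dots> = (\<Sum>i<n. (cmod (g i))\<^sup>2 * (cmod (u i \<bullet>c w))\<^sup>2)"
    using orthonormal_family_carrier[OF orth]
    by (intro sum.cong refl) (simp add: norm_mult power_mult_distrib cmod_cscalar_prod_commute[OF w])
  finally show ?thesis by (simp add: y_def)
qed

lemma l2_norm_orthonormal:
  assumes "orthonormal_family n n u" "i < n"
  shows "l2_norm (u i) = 1"
proof -
  have "complex_of_real ((l2_norm (u i))\<^sup>2) = 1"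
    using cscalar_prod_self[OF orthonormal_family_carrier[OF assms]]
      orthonormal_family_cscalar_prod[OF assms(1) assms(2) assms(2)] by simp
  hence "(l2_norm (u i))\<^sup>2 = 1" by (metis of_real_eq_1_iff)
  thus ?thesis using l2_norm_nonneg[of "u i"] by (simp add: power2_eq_1_iff)
qed

lemma spectral_norm_spectral_mat:
  assumes orth: "orthonormal_family n n u" and "0 < n" and le: "\<And>i. i < n \<Longrightarrow> cmod (g i) \<le> 1"
  shows "spectral_norm (spectral_mat n n u g) \<le> 1"
    and "\<And>i. i < n \<Longrightarrow> cmod (g i) \<le> spectral_norm (spectral_mat n n u g)"
proof -
  define X where "X = {l2_norm (spectral_mat n n u g *\<^sub>v w) | w. w \<in> carrier_vec n \<and> l2_norm w = 1}"
  have norm: "spectral_norm (spectral_mat n n u g) = Sup X"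
    by (simp add: spectral_norm_def X_def spectral_mat_def)
  have bound: "x \<le> 1" if x: "x \<in> X" for x
  proof -
    obtain w where w: "w \<in> carrier_vec n" "l2_norm w = 1" "x = l2_norm (spectral_mat n n u g *\<^sub>v w)"
      using x by (auto simp: X_def)
    have "x\<^sup>2 \<le> (\<Sum>i<n. 1 * (cmod (u i \<bullet>c w))\<^sup>2)"
      unfolding w(3) l2_norm_spectral_mat[OF orth w(1)]
      using le by (intro sum_mono mult_right_mono) (auto simp: power_le_one)
    also have "\<dots> = 1" using parseval[OF orth w(1)] w(2) by simp
    finally show ?thesis by (simp add: abs_square_le_1)
  qed
  have mem: "cmod (g i) \<in> X" if i: "i < n" for i
  proof -
    have "(l2_norm (spectral_mat n n u g *\<^sub>v u i))\<^sup>2 = (\<Sum>j<n. if j = i then (cmod (g i))\<^sup>2 else 0)"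
      unfolding l2_norm_spectral_mat[OF orth orthonormal_family_carrier[OF orth i]]
      using orthonormal_family_cscalar_prod[OF orth] i by (intro sum.cong refl) auto
    also have "\<dots> = (cmod (g i))\<^sup>2" using i by simp
    finally have "l2_norm (spectral_mat n n u g *\<^sub>v u i) = cmod (g i)"
      using l2_norm_nonneg by (simp add: power2_eq_iff_nonneg)
    thus ?thesis
      using orthonormal_family_carrier[OF orth i] l2_norm_orthonormal[OF orth i]
      unfolding X_def by (metis (mono_tags, lifting) mem_Collect_eq)
  qed
  show "spectral_norm (spectral_mat n n u g) \<le> 1"
    unfolding norm using mem[OF \<open>0 < n\<close>] bound by (intro cSup_least) auto
  show "cmod (g i) \<le> spectral_norm (spectral_mat n n u g)" if "i < n" for i
    unfolding norm using mem[OF that] bound by (intro cSup_upper bdd_aboveI) auto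
qed

lemma spectral_decomp_eigenvalue:
  assumes A: "A \<in> carrier_mat n n" and decomp: "is_spectral_decomp A lam u" and i: "i < n"
  shows "complex_of_real (lam i) \<in> spectrum A"
proof -
  have orth: "orthonormal_family n n u" and eq: "A = spectral_mat n n u (\<lambda>i. complex_of_real (lam i))"
    using decomp by (auto simp: is_spectral_decomp_iff[OF A])
  note u = orthonormal_family_carrier[OF orth i]
  have "A *\<^sub>v u i = complex_of_real (lam i) \<cdot>\<^sub>v u i"
  proof (rule eq_vecI)
    fix r assume "r < dim_vec (complex_of_real (lam i) \<cdot>\<^sub>v u i)"
    hence r: "r < n" using u by auto
    have "(A *\<^sub>v u i) $ r = (\<Sum>j<n. if j = i then complex_of_real (lam i) * u i $ r else 0)"
      unfolding eq spectral_mat_mult_vec[OF orth u r]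
      using orthonormal_family_cscalar_prod[OF orth] i by (intro sum.cong refl) auto
    thus "(A *\<^sub>v u i) $ r = (complex_of_real (lam i) \<cdot>\<^sub>v u i) $ r"
      using i r u by simp
  qed (use A u in auto)
  moreover have "u i \<noteq> 0\<^sub>v n"
    using l2_norm_orthonormal[OF orth i] l2_norm_eq_0_iff[OF u] by auto
  ultimately show ?thesis
    using A u by (auto simp: spectrum_def eigenvalue_def eigenvector_def)
qed

lemma spectral_decomp_eigenvalue_bounds:
  assumes A: "A \<in> carrier_mat n n" and decomp: "is_spectral_decomp A lam u" and i: "i < n"
  shows "lambda_min A \<le> lam i" "lam i \<le> lambda_max A"
proof -
  have "lam i \<in> Re ` spectrum A"
    using spectral_decomp_eigenvalue[OF assms] by (metis Re_complex_of_real image_eqI)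
  moreover have "finite (Re ` spectrum A)"
    using card_finite_spectrum(1)[OF A] by simp
  ultimately show "lambda_min A \<le> lam i" "lam i \<le> lambda_max A"
    by (simp_all add: lambda_min_def lambda_max_def)
qed

section \<open>Random unit vectors and the concentration of moments\<close>

lemma sets_unif_sphere [measurable_cong]: "sets (unif_sphere n) = sets (\<Pi>\<^sub>M i\<in>{..<n}. borel)"
  by (simp add: unif_sphere_def)

lemma AE_nonzero_vector:
  fixes n :: nat
  assumes "0 < n"
  shows "AE x in \<Pi>\<^sub>M i\<in>{..<n}. lborel. (\<Sum>i<n. (x i :: real)\<^sup>2) \<noteq> 0"
proof (rule AE_I')
  interpret finite_product_sigma_finite "\<lambda>_. lborel :: real measure" "{..<n}"
    by (intro finite_product_sigma_finite.intro finite_product_sigma_finite_axioms.intro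
        product_sigma_finite.intro sigma_finite_lborel) simp
  have "emeasure (\<Pi>\<^sub>M i\<in>{..<n}. lborel) (\<Pi>\<^sub>E i\<in>{..<n}. {0 :: real}) = (\<Prod>i<n. emeasure lborel {0 :: real})"
    by (rule emeasure_PiM) auto
  also have "\<dots> = 0" using assms by (simp add: prod_zero_iff)
  finally show "(\<Pi>\<^sub>E i\<in>{..<n}. {0 :: real}) \<in> null_sets (\<Pi>\<^sub>M i\<in>{..<n}. lborel)"
    by (intro null_setsI sets_PiM_I_finite) auto
  show "{x \<in> space (\<Pi>\<^sub>M i\<in>{..<n}. lborel). \<not> (\<Sum>i<n. (x i :: real)\<^sup>2) \<noteq> 0} \<subseteq> (\<Pi>\<^sub>E i\<in>{..<n}. {0})"
  proof
    fix x :: "nat \<Rightarrow> real"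
    assume "x \<in> {x \<in> space (\<Pi>\<^sub>M i\<in>{..<n}. lborel). \<not> (\<Sum>i<n. (x i)\<^sup>2) \<noteq> 0}"
    hence "x \<in> extensional {..<n}" "\<And>i. i < n \<Longrightarrow> x i = 0"
      by (auto simp: space_PiM PiE_iff sum_nonneg_eq_0_iff)
    thus "x \<in> (\<Pi>\<^sub>E i\<in>{..<n}. {0})"
      by (intro PiE_I) (auto simp: extensional_def)
  qed
qed

text \<open>The radial projection sends the origin to itself rather than to a unit vector, but the origin is a null set.\<close>

lemma AE_unif_sphere:
  assumes "0 < n"
  shows "AE x in unif_sphere n. (\<Sum>i<n. (x i)\<^sup>2) = 1"
proof -
  let ?L = "\<Pi>\<^sub>M i\<in>{..<n}. lborel :: real measure"
  define f where "f x = (\<lambda>i\<in>{..<n}. x i / sqrt (\<Sum>j<n. (x j)\<^sup>2))" for x :: "nat \<Rightarrow> real"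
  have ball: "unit_ball n \<in> sets ?L"
    unfolding unit_ball_def by measurable
  have f: "f \<in> measurable (uniform_measure ?L (unit_ball n)) (\<Pi>\<^sub>M i\<in>{..<n}. borel)"
    unfolding f_def[abs_def] by measurable
  have "AE x in uniform_measure ?L (unit_ball n). (\<Sum>i<n. (f x i)\<^sup>2) = 1"
  proof (rule AE_uniform_measureI[OF ball])
    show "AE x in ?L. x \<in> unit_ball n \<longrightarrow> (\<Sum>i<n. (f x i)\<^sup>2) = 1"
      using AE_nonzero_vector[OF assms]
    proof eventually_elim
      case (elim x)
      have "(\<Sum>i<n. (f x i)\<^sup>2) = (\<Sum>i<n. (x i)\<^sup>2 / (\<Sum>j<n. (x j)\<^sup>2))"
        by (intro sum.cong refl) (simp add: f_def power_divide sum_nonneg)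
      also have "\<dots> = 1" using elim by (simp add: sum_divide_distrib[symmetric])
      finally show ?case by simp
    qed
  qed
  thus ?thesis
    unfolding unif_sphere_def f_def[symmetric, abs_def]
    by (subst AE_distr_iff[OF f]) measurable
qed

lemma l2_norm_cvec: "(l2_norm (cvec n x))\<^sup>2 = (\<Sum>i<n. (x i)\<^sup>2)"
  by (simp add: l2_norm_def cvec_def sum_nonneg)

lemma cvec_carrier: "cvec n x \<in> carrier_vec n"
  by (simp add: cvec_def)

lemma sesq_form_cvec:
  assumes "B \<in> carrier_mat n n"
  shows "sesq_form B (cvec n x)
    = (\<Sum>r<n. \<Sum>c<n. B $$ (r, c) * complex_of_real (x c) * complex_of_real (x r))"
proof -
  have "sesq_form B (cvec n x) = (\<Sum>r<n. (B *\<^sub>v cvec n x) $ r * cnj (cvec n x $ r))"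
    unfolding sesq_form_def by (rule cscalar_prod_eq_sum[OF cvec_carrier])
  also have "\<dots> = (\<Sum>r<n. \<Sum>c<n. B $$ (r, c) * complex_of_real (x c) * complex_of_real (x r))"
    by (intro sum.cong refl, subst mult_mat_vec_eq_sum[OF assms cvec_carrier])
      (auto simp: cvec_def sum_distrib_right)
  finally show ?thesis .
qed

lemma trace_deviation_measurable:
  assumes "B \<in> carrier_mat n n"
  shows "{v \<in> space (\<Pi>\<^sub>M l\<in>{1..m}. unif_sphere n).
      cmod (mat_trace B / of_nat n - (1 / of_nat m) * (\<Sum>l=1..m. sesq_form B (cvec n (v l)))) > t}
    \<in> sets (\<Pi>\<^sub>M l\<in>{1..m}. unif_sphere n)"
proof -
  have coord: "(\<lambda>v. v l i) \<in> borel_measurable (\<Pi>\<^sub>M l\<in>{1..m}. unif_sphere n)"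
    if "l \<in> {1..m}" "i < n" for l i
  proof -
    have "(\<lambda>v. v l) \<in> measurable (\<Pi>\<^sub>M l\<in>{1..m}. unif_sphere n) (unif_sphere n)"
      using that by (intro measurable_component_singleton)
    moreover have "(\<lambda>x. x i) \<in> measurable (unif_sphere n) borel"
      using that measurable_component_singleton[of i "{..<n}" "\<lambda>_. borel"]
      by (simp add: measurable_cong_sets[OF sets_unif_sphere refl])
    ultimately show ?thesis by (rule measurable_compose)
  qed
  have "(\<lambda>v. sesq_form B (cvec n (v l))) \<in> borel_measurable (\<Pi>\<^sub>M l\<in>{1..m}. unif_sphere n)"
    if "l \<in> {1..m}" for l
    unfolding sesq_form_cvec[OF assms]
    using coord[OF that] by (intro borel_measurable_sum borel_measurable_times borel_measurable_const
      measurable_compose[OF _ borel_measurable_of_real]) auto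
  hence [measurable]: "(\<lambda>v. \<Sum>l=1..m. sesq_form B (cvec n (v l))) \<in> borel_measurable (\<Pi>\<^sub>M l\<in>{1..m}. unif_sphere n)"
    by (rule borel_measurable_sum)
  show ?thesis by measurable
qed

text \<open>A norm of at most \<open>1\<close> can be dropped from the bound. Norm \<open>0\<close> is a separate case, as the quotient in the
  hypothesis is then \<open>0\<close> by convention; there is no deviation in this case.\<close>

lemma trace_concentration_spectral_mat:
  assumes c: "0 < c" "trace_concentration c" and pos: "0 < n" "0 < m" "0 < t"
    and orth: "orthonormal_family n n u" and g: "\<And>i. i < n \<Longrightarrow> cmod (g i) \<le> 1"
  shows "measure (\<Pi>\<^sub>M l\<in>{1..m}. unif_sphere n) {v \<in> space (\<Pi>\<^sub>M l\<in>{1..m}. unif_sphere n).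
      cmod (mat_trace (spectral_mat n n u g) / of_nat n
        - (1 / of_nat m) * (\<Sum>l=1..m. sesq_form (spectral_mat n n u g) (cvec n (v l)))) > t}
    \<le> 2 * exp (- (c * real n * real m * t\<^sup>2))"
proof (cases "spectral_norm (spectral_mat n n u g) = 0")
  case True
  hence "g i = 0" if "i < n" for i
    using spectral_norm_spectral_mat(2)[where g = g, OF orth pos(1) g that] by simp
  hence "mat_trace (spectral_mat n n u g) = 0" "sesq_form (spectral_mat n n u g) (cvec n x) = 0" for x
    by (simp_all add: mat_trace_spectral_mat[OF orth] sesq_form_spectral_mat[OF orth cvec_carrier])
  thus ?thesis using pos by simp
next
  case False
  define N where "N = spectral_norm (spectral_mat n n u g)"
  have "0 \<le> cmod (g 0)" by simp
  hence "0 \<le> N"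
    using spectral_norm_spectral_mat(2)[where g = g, OF orth pos(1) g pos(1)] unfolding N_def by linarith
  hence N: "0 < N" "N \<le> 1"
    using False spectral_norm_spectral_mat(1)[where g = g, OF orth pos(1) g] by (simp_all add: N_def)
  have "c * real n * real m * t\<^sup>2 \<le> c * real n * real m * t\<^sup>2 / N\<^sup>2"
    using N c pos by (simp add: pos_le_divide_eq mult_left_le power_le_one)
  hence "2 * exp (- (c * real n * real m * t\<^sup>2 / N\<^sup>2)) \<le> 2 * exp (- (c * real n * real m * t\<^sup>2))"
    by simp
  moreover have "measure (\<Pi>\<^sub>M l\<in>{1..m}. unif_sphere n) {v \<in> space (\<Pi>\<^sub>M l\<in>{1..m}. unif_sphere n).
      cmod (mat_trace (spectral_mat n n u g) / of_nat n
        - (1 / of_nat m) * (\<Sum>l=1..m. sesq_form (spectral_mat n n u g) (cvec n (v l)))) > t}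
    \<le> 2 * exp (- (c * real n * real m * t\<^sup>2 / N\<^sup>2))"
    unfolding N_def using c(2) pos spectral_mat_carrier[of n n u g]
    unfolding trace_concentration_def by blast
  ultimately show ?thesis by linarith
qed

lemma cesm_eq_step_fun:
  assumes "dim_row A = n" "spectral_decomp A = (lam, u)"
  shows "cesm A = step_fun n (\<lambda>_. 1 / real n) lam"
  unfolding cesm_def[abs_def] step_fun_def[abs_def] assms prod.case sum_distrib_left by (rule refl)

lemma wcesm_eq_step_fun:
  assumes "dim_row A = n" "spectral_decomp A = (lam, u)"
  shows "wcesm A x = step_fun n (\<lambda>i. (cmod (u i \<bullet>c x))\<^sup>2) lam"
  unfolding wcesm_def[abs_def] step_fun_def[abs_def] assms prod.case by (rule refl)

lemma is_spectral_decomp_spectral_decomp: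
  assumes "A \<in> carrier_mat n n" "hermitian_mat A" "spectral_decomp A = (lam, u)"
  shows "is_spectral_decomp A lam u"
proof -
  have "\<exists>x. case x of (lam, u) \<Rightarrow> is_spectral_decomp A lam u"
    using hermitian_spectral_decomp[OF assms(1,2)] by auto
  from someI_ex[OF this] show ?thesis
    using assms(3) by (simp add: spectral_decomp_def)
qed

theorem theorem3p11:
  fixes c \<epsilon> \<delta> :: real and n s m :: nat and A :: "complex mat"
    and M :: "'a measure" and v :: "nat \<Rightarrow> 'a \<Rightarrow> nat \<Rightarrow> real"
    and Q :: "(real \<Rightarrow> real) \<Rightarrow> real \<Rightarrow> real"
  assumes "0 < c" and "trace_concentration c"
    and "0 < n" and "A \<in> carrier_mat n n" and "hermitian_mat A"
    and "lambda_min A < lambda_max A"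
    and "0 < \<epsilon>" and "0 < \<delta>" and "\<delta> < 1"
    and "0 < s" and "0 < m"
    and "real s \<ge> 36 / \<epsilon>"
    and "real m \<ge> 7 * (ln (real s) + 1)\<^sup>2 / (c * real n * \<epsilon>\<^sup>2) * ln (2 * real s / \<delta>)"
    and "iid_samples M (unif_sphere n) m v"
    and "odd s \<and> Q = gauss_quad s \<or> Q = jackson_cheb_quad s (lambda_min A) (lambda_max A)"
  shows "measure M {\<omega> \<in> space M.
      wasserstein (cesm A)
        (\<lambda>x. (1 / real m) * (\<Sum>l=1..m. Q (wcesm A (cvec n (v l \<omega>))) x))
      > ennreal ((lambda_max A - lambda_min A) * \<epsilon>)} \<le> \<delta>"
proof -
  define a b where "a = lambda_min A" and "b = lambda_max A"
  obtain lam u where decomp: "spectral_decomp A = (lam, u)" by (metis surj_pair)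
  have is_decomp: "is_spectral_decomp A lam u"
    by (rule is_spectral_decomp_spectral_decomp[OF assms(4,5) decomp])
  have orth: "orthonormal_family n n u"
    using is_decomp by (simp add: is_spectral_decomp_iff[OF assms(4)])
  have lam: "a \<le> lam i" "lam i \<le> b" if "i < n" for i
    using spectral_decomp_eigenvalue_bounds[OF assms(4) is_decomp that] by (auto simp: a_def b_def)
  have ab: "a < b" using assms(6) by (simp add: a_def b_def)
  define L where "L = ln (real s) + 1"
  have L: "1 \<le> L" using assms(10) by (simp add: L_def)
  \<comment> \<open>The admissible error of each moment.\<close>
  define t where "t = \<epsilon> / (2 * L)"
  have t: "0 < t" using L assms(7) by (simp add: t_def)

  define g where "g k i = complex_of_real (cheb_shifted a b k (lam i))" for k i
  \<comment> \<open>The matrix \<open>T\<^sub>k(A)\<close>.\<close>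
  define B where "B k = spectral_mat n n u (g k)" for k
  define D where "D = (\<Pi>\<^sub>M l\<in>{1..m}. unif_sphere n)"
  define dev where "dev k y = cmod (mat_trace (B k) / of_nat n
      - (1 / of_nat m) * (\<Sum>l=1..m. sesq_form (B k) (cvec n (y l))))" for k and y :: "nat \<Rightarrow> nat \<Rightarrow> real"
  define S where "S k = {y \<in> space D. dev k y > t}" for k
  have S_sets: "S k \<in> sets D" for k
    unfolding S_def dev_def D_def B_def by (rule trace_deviation_measurable[OF spectral_mat_carrier])
  have S_measure: "measure D (S k) \<le> 2 * exp (- (c * real n * real m * t\<^sup>2))" for k
    unfolding S_def dev_def D_def B_def
  proof (rule trace_concentration_spectral_mat[OF assms(1,2,3,11) t orth])
    fix i assume "i < n"
    thus "cmod (g k i) \<le> 1" using abs_cheb_shifted_le_1[OF ab lam] by (simp add: g_def)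
  qed
  have dev_eq: "dev k y = \<bar>(\<Sum>i<n. 1 / real n * cheb_shifted a b k (lam i))
      - (1 / real m) * (\<Sum>l=1..m. \<Sum>i<n. (cmod (u i \<bullet>c cvec n (y l)))\<^sup>2 * cheb_shifted a b k (lam i))\<bar>" for k y
  proof -
    have "mat_trace (B k) / of_nat n - (1 / of_nat m) * (\<Sum>l=1..m. sesq_form (B k) (cvec n (y l)))
      = complex_of_real ((\<Sum>i<n. 1 / real n * cheb_shifted a b k (lam i))
      - (1 / real m) * (\<Sum>l=1..m. \<Sum>i<n. (cmod (u i \<bullet>c cvec n (y l)))\<^sup>2 * cheb_shifted a b k (lam i)))"
      by (simp add: B_def g_def mat_trace_spectral_mat[OF orth] sesq_form_spectral_mat[OF orth cvec_carrier]
          sum_divide_distrib mult.commute)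
    thus ?thesis unfolding dev_def by (simp only: norm_of_real)
  qed

  interpret M: prob_space M using assms(14) by (simp add: iid_samples_def)
  have indep: "M.indep_vars (\<lambda>_. unif_sphere n) v {1..m}"
    and law: "\<And>l. l \<in> {1..m} \<Longrightarrow> distr M (unif_sphere n) (v l) = unif_sphere n"
    using assms(14) by (auto simp: iid_samples_def)
  have v: "v l \<in> measurable M (unif_sphere n)" if "l \<in> {1..m}" for l
    using indep that by (simp add: M.indep_vars_def2)
  define V where "V \<omega> = (\<lambda>l\<in>{1..m}. v l \<omega>)" for \<omega>
  have V: "V \<in> measurable M D"
    unfolding V_def[abs_def] D_def using v by (intro measurable_restrict) auto
  have V_law: "distr M D V = D"
  proof -
    have "{1..m} \<noteq> {}" using assms(11) by simp
    from M.indep_vars_iff_distr_eq_PiM'[OF this v] indep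
    have "distr M D V = (\<Pi>\<^sub>M l\<in>{1..m}. distr M (unif_sphere n) (v l))"
      unfolding V_def[abs_def] D_def by simp
    also have "\<dots> = D" unfolding D_def by (intro PiM_cong refl law)
    finally show ?thesis .
  qed
  have unit: "AE \<omega> in M. \<forall>l\<in>{1..m}. (\<Sum>i<n. (v l \<omega> i)\<^sup>2) = 1"
  proof (rule AE_finite_allI)
    fix l assume l: "l \<in> {1..m}"
    have "AE x in distr M (unif_sphere n) (v l). (\<Sum>i<n. (x i)\<^sup>2) = 1"
      unfolding law[OF l] by (rule AE_unif_sphere[OF assms(3)])
    thus "AE \<omega> in M. (\<Sum>i<n. (v l \<omega> i)\<^sup>2) = 1"
      by (rule AE_distrD[OF v[OF l]])
  qed simp

  define W where "W \<omega> = wasserstein (cesm A) (\<lambda>x. (1 / real m) * (\<Sum>l=1..m. Q (wcesm A (cvec n (v l \<omega>))) x))" for \<omega>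
  have good: "W \<omega> \<le> ennreal ((b - a) * \<epsilon>)"
    if \<omega>: "\<forall>l\<in>{1..m}. (\<Sum>i<n. (v l \<omega> i)\<^sup>2) = 1" "\<forall>k\<in>{1..s}. dev k (V \<omega>) \<le> t" for \<omega>
  proof -
    have dim: "dim_row A = n" using assms(4) by auto
    define w where "w l i = (cmod (u i \<bullet>c cvec n (v l \<omega>)))\<^sup>2" for l i
    have "wasserstein (step_fun n (\<lambda>_. 1 / real n) lam)
        (\<lambda>x. (1 / real m) * (\<Sum>l=1..m. Q (step_fun n (w l) lam) x))
      \<le> ennreal ((b - a) * (jackson_angle s + 2 / pi * t * (ln (real s) + 1)))"
    proof (rule averaged_quadrature_error[OF ab assms(10,11)])
      show "odd s \<and> Q = gauss_quad s \<or> Q = jackson_cheb_quad s a b"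
        using assms(15) by (simp add: a_def b_def)
      show "weighted_points n (\<lambda>_. 1 / real n) lam a b"
        using assms(3) lam by unfold_locales auto
      show "weighted_points n (w l) lam a b" if l: "l \<in> {1..m}" for l
      proof
        show "(\<Sum>i<n. w l i) = 1"
          unfolding w_def parseval[OF orth cvec_carrier] l2_norm_cvec using \<omega>(1) l by blast
      qed (use lam in \<open>auto simp: w_def\<close>)
      show "\<bar>(\<Sum>i<n. 1 / real n * cheb_shifted a b k (lam i))
          - (1 / real m) * (\<Sum>l=1..m. \<Sum>i<n. w l i * cheb_shifted a b k (lam i))\<bar> \<le> t"
        if k: "k \<in> {1..s}" for k
      proof -
        have "(\<Sum>l=1..m. \<Sum>i<n. w l i * cheb_shifted a b k (lam i))
            = (\<Sum>l=1..m. \<Sum>i<n. (cmod (u i \<bullet>c cvec n (V \<omega> l)))\<^sup>2 * cheb_shifted a b k (lam i))"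
          by (intro sum.cong refl) (simp add: w_def V_def)
        thus ?thesis using \<omega>(2) k unfolding dev_eq by simp
      qed
    qed
    also have "\<dots> \<le> ennreal ((b - a) * \<epsilon>)"
    proof (intro ennreal_leI mult_left_mono)
      have "36 \<le> \<epsilon> * (real s + 2)"
        using assms(12) assms(7) by (simp add: field_simps)
      hence "pi * 36 \<le> pi * (\<epsilon> * (real s + 2))"
        by (intro mult_left_mono) auto
      hence "jackson_angle s \<le> \<epsilon> * pi / 36"
        by (simp add: jackson_angle_def field_simps)
      also have "\<dots> \<le> \<epsilon> / 9"
        using pi_less_4 assms(7) by (simp add: field_simps)
      finally have "jackson_angle s \<le> \<epsilon> / 9" .
      moreover have "2 / pi * t * (ln (real s) + 1) = \<epsilon> / pi"
        using L by (simp add: t_def L_def[symmetric])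
      moreover have "\<epsilon> / pi \<le> \<epsilon> / 2"
        using pi_ge_two assms(7) by (intro divide_left_mono) auto
      ultimately show "jackson_angle s + 2 / pi * t * (ln (real s) + 1) \<le> \<epsilon>"
        using assms(7) by linarith
    qed (use ab in simp)
    finally show ?thesis
      unfolding W_def cesm_eq_step_fun[OF dim decomp] wcesm_eq_step_fun[OF dim decomp] w_def .
  qed

  define U where "U = (\<Union>k\<in>{1..s}. V -` S k \<inter> space M)"
  have sets: "V -` S k \<inter> space M \<in> sets M" for k
    using V S_sets by (rule measurable_sets)
  \<comment> \<open>The inclusion in \<open>U\<close> needs unit vectors, which the samples are with probability \<open>1\<close>.\<close>
  have "measure M {\<omega> \<in> space M. W \<omega> > ennreal ((b - a) * \<epsilon>)} \<le> measure M U"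
  proof (rule M.finite_measure_mono_AE)
    show "U \<in> sets M" unfolding U_def using sets by (intro sets.finite_UN) simp_all
    show "AE \<omega> in M. \<omega> \<in> {\<omega> \<in> space M. W \<omega> > ennreal ((b - a) * \<epsilon>)} \<longrightarrow> \<omega> \<in> U"
      using unit
    proof eventually_elim
      case (elim \<omega>)
      show ?case
      proof
        assume \<omega>: "\<omega> \<in> {\<omega> \<in> space M. W \<omega> > ennreal ((b - a) * \<epsilon>)}"
        hence "\<not> (\<forall>k\<in>{1..s}. dev k (V \<omega>) \<le> t)"
          using good[OF elim] by (auto simp: not_le[symmetric])
        then obtain k where "k \<in> {1..s}" "t < dev k (V \<omega>)" by (auto simp: not_le)
        moreover have "V \<omega> \<in> space D" using V \<omega> by (auto dest: measurable_space)
        ultimately show "\<omega> \<in> U" using \<omega> by (auto simp: U_def S_def)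
      qed
    qed
  qed
  also have "measure M U \<le> (\<Sum>k=1..s. measure M (V -` S k \<inter> space M))"
    unfolding U_def using sets by (intro M.finite_measure_subadditive_finite) auto
  also have "\<dots> = (\<Sum>k=1..s. measure D (S k))"
  proof (intro sum.cong refl)
    fix k
    have "measure D (S k) = measure (distr M D V) (S k)" by (simp only: V_law)
    thus "measure M (V -` S k \<inter> space M) = measure D (S k)"
      using measure_distr[OF V S_sets] by simp
  qed
  also have "\<dots> \<le> (\<Sum>k=1..s. 2 * exp (- (c * real n * real m * t\<^sup>2)))"
    by (intro sum_mono S_measure)
  also have "\<dots> = 2 * real s * exp (- (c * real n * real m * t\<^sup>2))" by simp
  also have "\<dots> \<le> 2 * real s * exp (- ln (2 * real s / \<delta>))"
  proof -
    define q where "q = ln (2 * real s / \<delta>)"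
    have "1 \<le> 2 * real s / \<delta>" using assms(8,9,10) by (simp add: field_simps)
    hence q: "0 \<le> q" by (simp add: q_def)
    define d where "d = c * real n * \<epsilon>\<^sup>2"
    have d: "0 < d" using assms(1,3,7) by (simp add: d_def)
    have "real m \<ge> 7 * L\<^sup>2 / d * q"
      using assms(13) by (simp add: L_def d_def q_def)
    hence "d * (7 * L\<^sup>2 / d * q) \<le> d * real m"
      using d by (intro mult_left_mono) auto
    hence "7 * L\<^sup>2 * q \<le> d * real m" using d by simp
    moreover have "c * real n * real m * t\<^sup>2 = d * real m / (4 * L\<^sup>2)"
      by (simp add: t_def d_def power_divide power_mult_distrib)
    moreover have "7 * L\<^sup>2 * q / (4 * L\<^sup>2) \<le> d * real m / (4 * L\<^sup>2)"
      using \<open>7 * L\<^sup>2 * q \<le> d * real m\<close> by (rule divide_right_mono) simp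
    ultimately have "7 * L\<^sup>2 * q / (4 * L\<^sup>2) \<le> c * real n * real m * t\<^sup>2"
      by linarith
    moreover have "7 * L\<^sup>2 * q / (4 * L\<^sup>2) = 7 / 4 * q" using L by simp
    ultimately have "q \<le> c * real n * real m * t\<^sup>2" using q by linarith
    thus ?thesis by (simp add: q_def mult_left_mono)
  qed
  also have "\<dots> = \<delta>" using assms(8,10) by (simp add: exp_minus)
  finally show ?thesis unfolding W_def a_def b_def .
qed

end
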